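(* The function $e \mapsto I_{K_{2,2,1}}(e)$ has at least two local maxima on the open interval $(0,1)$.
   Context: For graphs $H$ and $G$, let $I(H,G)$ denote the number of induced subgraphs of $G$ isomorphic to $H$, and define the (induced) density $p(H,G) = I(H,G)/\binom{|V(G)|}{|V(H)|}$. For $e\in[0,1]$, define $I_H(e) = \limsup_{n\to\infty} \max\{p(H,G) : G \text{ an } n\text{-vertex graph with } p(K_2,G) = e + o(1)\}$, i.e. the supremum, over all sequences of graphs $(G_n)$ with $|V(G_n)|\to\infty$ and edge density $p(K_2,G_n)\to e$, of $\limsup_n p(H,G_n)$. Here $K_{2,2,1}$ is the complete $3$-partite graph on $5$ vertices with parts of sizes $2,2,1$. *)

theory Defs
  imports "HOL-Analysis.Analysis" "Graph_Theory.Graph_Theory"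
begin

text \<open>
  Finite simple graphs are the \<^locale>\<open>pair_graph\<close>s: finite, loop-free,
  symmetric relations on a vertex set, where the edge \<open>uv\<close> is the pair of arcs
  \<open>(u,v)\<close>, \<open>(v,u)\<close>.
\<close>

definition complete_graph :: "nat \<Rightarrow> nat pair_pre_digraph" where
  "complete_graph n = \<lparr> pverts = {..<n}, parcs = {(u, v). u < n \<and> v < n \<and> u \<noteq> v} \<rparr>"

text \<open>Part \<open>i\<close> of the complete multipartite graph is \<open>{(i, j) | j. j < ks ! i}\<close>.\<close>

definition complete_multipartite :: "nat list \<Rightarrow> (nat \<times> nat) pair_pre_digraph" where
  "complete_multipartite ks =
    (let V = {(i, j). i < length ks \<and> j < ks ! i}
     in \<lparr> pverts = V, parcs = {(u, v). u \<in> V \<and> v \<in> V \<and> fst u \<noteq> fst v} \<rparr>)"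

text \<open>Induced subgraphs correspond to vertex subsets, so copies of \<open>H\<close> are counted as subsets.\<close>

definition ind_count :: "'a pair_pre_digraph \<Rightarrow> 'b pair_pre_digraph \<Rightarrow> nat" where
  "ind_count H G =
    card {S. S \<subseteq> pverts G \<and> digraph_iso (with_proj H) (with_proj G \<restriction> S)}"

definition ind_density :: "'a pair_pre_digraph \<Rightarrow> 'b pair_pre_digraph \<Rightarrow> real" where
  "ind_density H G = real (ind_count H G) / real (card (pverts G) choose card (pverts H))"

text \<open>
  Every finite graph is isomorphic to one with vertices in \<^typ>\<open>nat\<close>, so this type loses no
  sequences. The values are extended reals only because \<^const>\<open>limsup\<close> needs a complete lattice;
  for \<open>0 \<le> e \<le> 1\<close> they lie in the unit interval.
\<close>

definition density_sequences :: "real \<Rightarrow> (nat \<Rightarrow> nat pair_pre_digraph) set" where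
  "density_sequences e = {G. (\<forall>n. pair_graph (G n))
     \<and> filterlim (\<lambda>n. card (pverts (G n))) at_top sequentially
     \<and> (\<lambda>n. ind_density (complete_graph 2) (G n)) \<longlonglongrightarrow> e}"

definition max_ind_density :: "'a pair_pre_digraph \<Rightarrow> real \<Rightarrow> ereal" where
  "max_ind_density H e =
    (SUP G \<in> density_sequences e. limsup (\<lambda>n. ereal (ind_density H (G n))))"

definition local_max_at :: "('a::topological_space \<Rightarrow> 'b::order) \<Rightarrow> 'a \<Rightarrow> bool" where
  "local_max_at f x \<longleftrightarrow> (\<forall>\<^sub>F y in nhds x. f y \<le> f x)"


lemma pair_graph_complete_graph: "pair_graph (complete_graph n)"
proof -
  have "finite {(u, v). u < n \<and> v < n \<and> u \<noteq> v}"
    by (rule finite_subset[of _ "{..<n} \<times> {..<n}"]) auto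
  then show ?thesis
    by unfold_locales (auto simp: complete_graph_def symmetric_def intro!: symI)
qed

lemma complete_digraph_complete_graph: "K\<^bsub>n\<^esub> (with_proj (complete_graph n))"
  unfolding complete_digraph_pair_def by (auto simp: complete_graph_def)

lemma finite_complete_multipartite:
  fixes ks :: "nat list"
  shows "finite {(i, j). i < length ks \<and> j < ks ! i}"
proof -
  have "{(i, j). i < length ks \<and> j < ks ! i} = (SIGMA i:{..<length ks}. {..<ks ! i})"
    by auto
  then show ?thesis by simp
qed

lemma card_complete_multipartite: "card (pverts (complete_multipartite ks)) = sum_list ks"
proof -
  have "pverts (complete_multipartite ks) = (SIGMA i:{..<length ks}. {..<ks ! i})"
    by (auto simp: complete_multipartite_def)
  then show ?thesis
    by (simp add: card_SigmaI sum_list_sum_nth atLeast0LessThan)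
qed

lemma pair_graph_complete_multipartite: "pair_graph (complete_multipartite ks)"
proof -
  let ?V = "{(i, j). i < length ks \<and> j < ks ! i}"
  have "finite {(u, v). u \<in> ?V \<and> v \<in> ?V \<and> fst u \<noteq> fst v}"
    by (rule finite_subset[of _ "?V \<times> ?V"]) (use finite_complete_multipartite in auto)
  then show ?thesis
    using finite_complete_multipartite[of ks]
    by unfold_locales (auto simp: complete_multipartite_def Let_def symmetric_def intro!: symI)
qed

lemma digraph_iso_with_proj_iff:
  assumes "pair_wf_digraph G" "pair_wf_digraph H"
  shows "digraph_iso (with_proj G) (with_proj H) \<longleftrightarrow>
    (\<exists>f. bij_betw f (pverts G) (pverts H) \<and>
      (\<forall>u\<in>pverts G. \<forall>v\<in>pverts G. (u, v) \<in> parcs G \<longleftrightarrow> (f u, f v) \<in> parcs H))"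
    (is "?L \<longleftrightarrow> ?R")
proof
  interpret G: pair_wf_digraph G by fact
  interpret H: pair_wf_digraph H by fact
  {
    assume ?L
    then obtain h where h: "pre_digraph.digraph_isomorphism (with_proj G) h"
      and eq: "with_proj H = app_iso h (with_proj G)"
      unfolding digraph_iso_def by blast
    let ?f = "iso_verts h"
    from eq have V: "pverts H = ?f ` pverts G" and A: "parcs H = iso_arcs h ` parcs G"
      and t: "iso_tail h = fst" and hd: "iso_head h = snd"
      by (auto simp: app_iso_def with_proj_def)
    have inj: "inj_on ?f (pverts G)" using h by (simp add: G.digraph_isomorphism_def)
    have arc: "iso_arcs h a = (?f (fst a), ?f (snd a))" if "a \<in> parcs G" for a
      using h that t hd by (simp add: G.digraph_isomorphism_def prod_eq_iff)
    have "(u, v) \<in> parcs G \<longleftrightarrow> (?f u, ?f v) \<in> parcs H"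
      if uv: "u \<in> pverts G" "v \<in> pverts G" for u v
    proof
      assume "(u, v) \<in> parcs G"
      then show "(?f u, ?f v) \<in> parcs H" unfolding A using arc by force
    next
      assume "(?f u, ?f v) \<in> parcs H"
      then obtain a where a: "a \<in> parcs G" "(?f u, ?f v) = (?f (fst a), ?f (snd a))"
        unfolding A using arc by force
      moreover have "fst a \<in> pverts G" "snd a \<in> pverts G"
        using a G.arc_fst_in_verts G.arc_snd_in_verts by auto
      ultimately have "fst a = u" "snd a = v" using uv inj by (auto dest: inj_onD)
      then show "(u, v) \<in> parcs G" using a by auto
    qed
    with inj V show ?R by (auto simp: bij_betw_def)
  }
  {
    assume ?R
    then obtain f where f: "inj_on f (pverts G)" "f ` pverts G = pverts H"
      and arc: "\<And>u v. u \<in> pverts G \<Longrightarrow> v \<in> pverts G \<Longrightarrow>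
        (u, v) \<in> parcs G \<longleftrightarrow> (f u, f v) \<in> parcs H"
      by (auto simp: bij_betw_def)
    let ?h = "\<lparr> iso_verts = f, iso_arcs = map_prod f f, iso_head = snd, iso_tail = fst \<rparr>"
    have sub: "parcs G \<subseteq> pverts G \<times> pverts G"
      using G.arc_fst_in_verts G.arc_snd_in_verts by fastforce
    have "inj_on (map_prod f f) (parcs G)"
      by (rule inj_on_subset[OF map_prod_inj_on[OF f(1) f(1)] sub])
    then have "pre_digraph.digraph_isomorphism (with_proj G) ?h"
      using f by (auto simp: G.digraph_isomorphism_def G.wf_digraph)
    moreover have "map_prod f f ` parcs G = parcs H"
    proof
      show "map_prod f f ` parcs G \<subseteq> parcs H" using arc sub by auto
      show "parcs H \<subseteq> map_prod f f ` parcs G"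
      proof
        fix a assume a: "a \<in> parcs H"
        then have "fst a \<in> f ` pverts G" "snd a \<in> f ` pverts G"
          using H.arc_fst_in_verts H.arc_snd_in_verts f(2) by auto
        then obtain u v where uv: "u \<in> pverts G" "v \<in> pverts G" "a = (f u, f v)"
          by (metis imageE prod.collapse)
        then have "(u, v) \<in> parcs G" using arc a by auto
        then show "a \<in> map_prod f f ` parcs G" using uv by force
      qed
    qed
    then have "with_proj H = app_iso ?h (with_proj G)"
      using f(2) by (simp add: app_iso_def with_proj_def)
    ultimately show ?L unfolding digraph_iso_def by blast
  }
qed

end

theory Submission
  imports Defs "HOL-Real_Asymp.Real_Asymp"
begin

text \<open>
  Write \<open>p\<close> for the density of \<open>K\<^sub>2\<^sub>,\<^sub>2\<^sub>,\<^sub>1\<close> and \<open>e\<close> for the edge density. The balanced complete 3-partite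
  graph gives \<open>p = 10/27\<close> at \<open>e = 2/3\<close> and the balanced complete 4-partite graph \<open>T\<^sub>4\<close> gives \<open>p = 45/128\<close> at
  \<open>e = 3/4\<close>, while \<open>p = 0\<close> at \<open>e = 0\<close> and \<open>e = 1\<close>. The extremal function is upper semicontinuous, so it
  suffices to find a point between 2/3 and 3/4 where it is below 45/128.

  For a complete multipartite graph with part size \<open>y(v)\<close> at \<open>v\<close> and \<open>s = E y\<close> one has the identity
  \<open>9/128 - (p + (15/16) e)/15 = E [(y - 1/4)\<^sup>2 (1/8 + 2 (s - y\<^sup>2))]\<close>, where \<open>s \<ge> y\<^sup>2\<close>, so \<open>T\<^sub>4\<close> is the unique stable
  maximiser of \<open>p + (15/16) e\<close> among them. Near \<open>T\<^sub>4\<close> every missing or superfluous edge costs \<open>p\<close> a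
  definite amount. Zykov symmetrisation does not decrease \<open>p + (15/16) e\<close> and moves one vertex at a time,
  hence cannot jump over the neighbourhood of \<open>T\<^sub>4\<close>; so all near-maximisers of \<open>p + (15/16) e\<close> are close to
  \<open>T\<^sub>4\<close>. A graph with \<open>e\<close> slightly below 3/4 and \<open>p\<close> about 45/128 would be such a near-maximiser, and then
  the local estimate forces \<open>p < 45/128\<close>.
\<close>

text \<open>Cloning a vertex changes the edge density, so symmetrisation cannot be run at fixed
  \<open>e\<close>; the linear term turns the constraint into a penalty. Its slope is forced by
  stationarity at four equal parts, and some penalty is unavoidable because three parts beat four
  for \<open>p\<close> alone. Normalised by \<open>n^5\<close> ordered tuples, \<open>p\<close>
  becomes \<open>p / 15\<close> and the coefficient becomes \<open>1/16\<close>.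

  The penalised bound by itself gives only \<open>p \<le> 45/128 + (15/16) (3/4 - e)\<close>, which
  is too weak to the left of 3/4. The sign is reversed by structure: near four equal parts, each arc
  missing from \<open>3/4 n^2\<close> lowers the upper bound on the count by \<open>n^3/64\<close>.
  Hence stability of the penalised problem is needed and not just its value, although symmetrisation
  destroys the structure of the graph it starts from.

  The constants are chosen backwards and generously: part sizes within \<open>n/1000\<close>, then
  \<open>10^-9 n^2\<close> mismatches, then a balance deficit of \<open>10^-13 n^5\<close>, which
  also bounds the distance of the dip from 3/4.\<close>

abbreviation (input) sum4 :: "'a set \<Rightarrow> ('a \<Rightarrow> 'a \<Rightarrow> 'a \<Rightarrow> 'a \<Rightarrow> 'b::comm_monoid_add) \<Rightarrow> 'b" where
  "sum4 V F \<equiv> (\<Sum>p\<in>V. \<Sum>q\<in>V. \<Sum>r\<in>V. \<Sum>s\<in>V. F p q r s)"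

abbreviation (input) sum5 :: "'a set \<Rightarrow> ('a \<Rightarrow> 'a \<Rightarrow> 'a \<Rightarrow> 'a \<Rightarrow> 'a \<Rightarrow> 'b::comm_monoid_add) \<Rightarrow> 'b" where
  "sum5 V F \<equiv> (\<Sum>p\<in>V. \<Sum>q\<in>V. \<Sum>r\<in>V. \<Sum>s\<in>V. \<Sum>t\<in>V. F p q r s t)"

text \<open>Copies are counted as labelled 5-tuples in which \<open>a = a'\<close> and \<open>b = b'\<close> are allowed. This changes the
  count by a lower-order term and makes it invariant under replacing weights by clones.\<close>

definition is_copy :: "('a \<Rightarrow> 'a \<Rightarrow> bool) \<Rightarrow> 'a \<Rightarrow> 'a \<Rightarrow> 'a \<Rightarrow> 'a \<Rightarrow> 'a \<Rightarrow> bool" where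
  "is_copy A a a' b b' c \<longleftrightarrow> \<not> A a a' \<and> \<not> A b b' \<and> A a b \<and> A a b' \<and> A a' b \<and> A a' b'
     \<and> A c a \<and> A c a' \<and> A c b \<and> A c b'"

definition wcopies :: "'a set \<Rightarrow> ('a \<Rightarrow> real) \<Rightarrow> ('a \<Rightarrow> 'a \<Rightarrow> bool) \<Rightarrow> real" where
  "wcopies V w A = sum5 V (\<lambda>a a' b b' c. w a * w a' * w b * w b' * w c * of_bool (is_copy A a a' b b' c))"

definition warcs :: "'a set \<Rightarrow> ('a \<Rightarrow> real) \<Rightarrow> ('a \<Rightarrow> 'a \<Rightarrow> bool) \<Rightarrow> real" where
  "warcs V w A = (\<Sum>a\<in>V. \<Sum>b\<in>V. w a * w b * of_bool (A a b))"

abbreviation copies :: "'a set \<Rightarrow> ('a \<Rightarrow> 'a \<Rightarrow> bool) \<Rightarrow> real" where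
  "copies V \<equiv> wcopies V (\<lambda>_. 1)"

abbreviation arcs_count :: "'a set \<Rightarrow> ('a \<Rightarrow> 'a \<Rightarrow> bool) \<Rightarrow> real" where
  "arcs_count V \<equiv> warcs V (\<lambda>_. 1)"

definition nonnbrs :: "'a set \<Rightarrow> ('a \<Rightarrow> 'a \<Rightarrow> bool) \<Rightarrow> 'a \<Rightarrow> real" where
  "nonnbrs V A v = (\<Sum>u\<in>V. of_bool (\<not> A v u))"

definition graph_on :: "'a set \<Rightarrow> ('a \<Rightarrow> 'a \<Rightarrow> bool) \<Rightarrow> bool" where
  "graph_on V A \<longleftrightarrow> finite V \<and> (\<forall>x\<in>V. \<not> A x x) \<and> (\<forall>x\<in>V. \<forall>y\<in>V. A x y = A y x)"

definition multipartite_on :: "'a set \<Rightarrow> ('a \<Rightarrow> 'a \<Rightarrow> bool) \<Rightarrow> bool" where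
  "multipartite_on V A \<longleftrightarrow> graph_on V A \<and> (\<forall>x\<in>V. \<forall>y\<in>V. \<forall>z\<in>V. \<not> A x y \<longrightarrow> A x z = A y z)"

section \<open>The deficit of complete multipartite graphs\<close>

text \<open>Non-adjacency is an equivalence relation here. Once adjacent \<open>a\<close> and
  \<open>b\<close> are chosen, \<open>a'\<close> and \<open>b'\<close> range freely over their two
  parts and \<open>c\<close> over everything outside them.\<close>

lemma multipartite_copies:
  assumes "multipartite_on V A"
  shows "copies V A = (\<Sum>a\<in>V. \<Sum>b\<in>V. of_bool (A a b) *
    (nonnbrs V A a * nonnbrs V A b * (real (card V) - nonnbrs V A a - nonnbrs V A b)))"
proof -
  have sym: "\<And>x y. x \<in> V \<Longrightarrow> y \<in> V \<Longrightarrow> A x y = A y x"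
    and tr: "\<And>x y z. x \<in> V \<Longrightarrow> y \<in> V \<Longrightarrow> z \<in> V \<Longrightarrow> \<not> A x y \<Longrightarrow> A x z = A y z"
    using assms unfolding multipartite_on_def graph_on_def by blast+
  have inner: "(\<Sum>a'\<in>V. \<Sum>b'\<in>V. \<Sum>c\<in>V. of_bool (is_copy A a a' b b' c)) = of_bool (A a b) *
    (nonnbrs V A a * nonnbrs V A b * (real (card V) - nonnbrs V A a - nonnbrs V A b))"
    if ab: "a \<in> V" "b \<in> V" for a b
  proof (cases "A a b")
    case False
    then show ?thesis by (simp add: is_copy_def)
  next
    case True
    have copy: "is_copy A a a' b b' c \<longleftrightarrow> \<not> A a a' \<and> \<not> A b b' \<and> A a c \<and> A b c"
      if V: "a' \<in> V" "b' \<in> V" "c \<in> V" for a' b' c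
    proof (cases "A a a' \<or> A b b'")
      case False
      then have "A a' z = A a z" "A b' z = A b z" if "z \<in> V" for z
        using tr ab V that by blast+
      moreover have "A c a = A a c" "A c b = A b c" "A c a' = A a' c" "A c b' = A b' c"
        using sym ab V by blast+
      moreover have "A b a = A a b" "A b' a = A a b'" using sym ab V by blast+
      ultimately show ?thesis
        unfolding is_copy_def using ab V True False by auto
    qed (auto simp: is_copy_def)
    have "(\<Sum>a'\<in>V. \<Sum>b'\<in>V. \<Sum>c\<in>V. of_bool (is_copy A a a' b b' c)) =
      (\<Sum>a'\<in>V. \<Sum>b'\<in>V. \<Sum>c\<in>V. of_bool (\<not> A a a') * (of_bool (\<not> A b b') * (1 - of_bool (\<not> A a c) - of_bool (\<not> A b c)) :: real))"
    proof (intro sum.cong refl)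
      fix a' b' c assume V: "a' \<in> V" "b' \<in> V" "c \<in> V"
      \<comment> \<open>No vertex is non-adjacent to both \<open>a\<close> and \<open>b\<close>, so
        subtracting both indicators never goes below 0.\<close>
      have "A a c \<or> A b c" using tr[of a c b] sym[of b c] ab V True by auto
      then show "of_bool (is_copy A a a' b b' c) =
        of_bool (\<not> A a a') * (of_bool (\<not> A b b') * (1 - of_bool (\<not> A a c) - of_bool (\<not> A b c)) :: real)"
        using copy[OF V] by auto
    qed
    also have "\<dots> = nonnbrs V A a * (nonnbrs V A b * (real (card V) - nonnbrs V A a - nonnbrs V A b))"
      unfolding sum_distrib_left[symmetric] sum_distrib_right[symmetric] sum_subtractf nonnbrs_def by simp
    finally show ?thesis using True by simp
  qed
  have "copies V A = sum5 V (\<lambda>a b a' b' c. of_bool (is_copy A a a' b b' c))"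
    unfolding wcopies_def by (rule sum.cong[OF refl], subst sum.swap) simp
  also have "\<dots> = (\<Sum>a\<in>V. \<Sum>b\<in>V. of_bool (A a b) *
    (nonnbrs V A a * nonnbrs V A b * (real (card V) - nonnbrs V A a - nonnbrs V A b)))"
    by (rule sum.cong[OF refl], rule sum.cong[OF refl], rule inner)
  finally show ?thesis .
qed

text \<open>Adjacent pairs are all pairs minus the pairs within a part, and \<open>nonnbrs\<close>
  is constant on a part. This removes the adjacency indicator and leaves only power sums.\<close>

lemma multipartite_copies_moments:
  assumes "multipartite_on V A"
  defines "n \<equiv> real (card V)" and "S1 \<equiv> \<Sum>v\<in>V. nonnbrs V A v"
    and "S2 \<equiv> \<Sum>v\<in>V. nonnbrs V A v ^ 2" and "S3 \<equiv> \<Sum>v\<in>V. nonnbrs V A v ^ 3"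
    and "S4 \<equiv> \<Sum>v\<in>V. nonnbrs V A v ^ 4"
  shows "copies V A = n * S1\<^sup>2 - 2 * S1 * S2 - n * S3 + 2 * S4"
    and "arcs_count V A = n\<^sup>2 - S1"
proof -
  define Y where "Y = nonnbrs V A"
  have tr: "\<And>x y z. x \<in> V \<Longrightarrow> y \<in> V \<Longrightarrow> z \<in> V \<Longrightarrow> \<not> A x y \<Longrightarrow> A x z = A y z"
    using assms unfolding multipartite_on_def graph_on_def by blast+
  have Yeq: "Y a = Y b" if "a \<in> V" "b \<in> V" "\<not> A a b" for a b
    unfolding Y_def nonnbrs_def using tr[OF that(1,2) _ that(3)] by (intro sum.cong) auto
  have "copies V A = (\<Sum>a\<in>V. \<Sum>b\<in>V. Y a * Y b * (n - Y a - Y b) - of_bool (\<not> A a b) * (Y a * Y a * (n - 2 * Y a)))"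
    unfolding multipartite_copies[OF assms(1)] Y_def[symmetric] n_def[symmetric]
    by (intro sum.cong refl) (use Yeq in auto)
  also have "\<dots> = (\<Sum>a\<in>V. \<Sum>b\<in>V. Y a * Y b * (n - Y a - Y b)) - (\<Sum>a\<in>V. Y a * (Y a * Y a * (n - 2 * Y a)))"
    by (simp only: sum_subtractf sum_distrib_right[symmetric]) (simp only: Y_def nonnbrs_def)
  also have "(\<Sum>a\<in>V. Y a * (Y a * Y a * (n - 2 * Y a))) = n * S3 - 2 * S4"
    unfolding S3_def S4_def Y_def[symmetric] sum_distrib_left sum_subtractf[symmetric]
    by (rule sum.cong[OF refl]) algebra
  also have "(\<Sum>a\<in>V. \<Sum>b\<in>V. Y a * Y b * (n - Y a - Y b)) = (\<Sum>a\<in>V. Y a * n * S1 - Y a ^ 2 * S1 - Y a * S2)"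
    unfolding S1_def S2_def Y_def[symmetric] sum_distrib_left sum_subtractf[symmetric]
    by (rule sum.cong[OF refl], rule sum.cong[OF refl]) algebra
  also have "\<dots> = n * S1\<^sup>2 - 2 * S1 * S2"
    unfolding sum_subtractf sum_distrib_right[symmetric] S1_def S2_def Y_def[symmetric]
    by (simp add: power2_eq_square)
  finally show "copies V A = n * S1\<^sup>2 - 2 * S1 * S2 - n * S3 + 2 * S4" by simp
  have "arcs_count V A = (\<Sum>a\<in>V. \<Sum>b\<in>V. 1 - of_bool (\<not> A a b))"
    unfolding warcs_def by (intro sum.cong refl) auto
  also have "\<dots> = n\<^sup>2 - S1"
    unfolding sum_subtractf S1_def nonnbrs_def n_def by (simp add: power2_eq_square)
  finally show "arcs_count V A = n\<^sup>2 - S1" .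
qed

text \<open>The coefficient 1/16 is the slope at \<open>s = 1/4\<close> of \<open>s\<^sup>2 (1 - s) (1 - 2 s)\<close>, the copy density of
  the balanced multipartite graph with parts of size \<open>s\<close>.\<close>

lemma multipartite_deficit:
  assumes "multipartite_on V A"
  defines "n \<equiv> real (card V)" and "Y \<equiv> nonnbrs V A"
  shows "9 / 128 * n ^ 5 - copies V A - n ^ 3 * arcs_count V A / 16 =
    (\<Sum>v\<in>V. (Y v - n / 4)\<^sup>2 * (n\<^sup>2 / 8 + 2 * ((\<Sum>u\<in>V. Y u) - (Y v)\<^sup>2)))"
proof -
  define S1 S2 S3 S4 where S: "S1 = (\<Sum>v\<in>V. Y v)" "S2 = (\<Sum>v\<in>V. Y v ^ 2)"
    "S3 = (\<Sum>v\<in>V. Y v ^ 3)" "S4 = (\<Sum>v\<in>V. Y v ^ 4)"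
  have "(\<Sum>v\<in>V. (Y v - n / 4)\<^sup>2 * (n\<^sup>2 / 8 + 2 * ((\<Sum>u\<in>V. Y u) - (Y v)\<^sup>2))) =
    (\<Sum>v\<in>V. 2 * S1 * Y v ^ 2 - 2 * Y v ^ 4 + n * Y v ^ 3 - (n ^ 3 / 16 + n * S1) * Y v
       + (n ^ 4 / 128 + n\<^sup>2 * S1 / 8))"
    unfolding S(1)[symmetric] by (rule sum.cong[OF refl]) (simp add: power_numeral_reduce field_simps)
  also have "\<dots> = 2 * S1 * S2 - 2 * S4 + n * S3 - (n ^ 3 / 16 + n * S1) * S1 + n * (n ^ 4 / 128 + n\<^sup>2 * S1 / 8)"
    unfolding S sum.distrib sum_subtractf sum_distrib_left[symmetric] by (simp add: n_def algebra_simps)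
  also have "\<dots> = 9 / 128 * n ^ 5 - copies V A - n ^ 3 * arcs_count V A / 16"
    unfolding multipartite_copies_moments[OF assms(1)] n_def[symmetric] Y_def[symmetric] S[symmetric]
    by (simp add: power_numeral_reduce field_simps)
  finally show ?thesis by simp
qed

text \<open>The vertices in the part of \<open>v\<close> alone contribute the left-hand side to the
  sum. This makes the second factor in the deficit identity at least \<open>n^2/8\<close>.\<close>

lemma multipartite_nonnbrs_sq_le:
  assumes "multipartite_on V A" "v \<in> V"
  shows "(nonnbrs V A v)\<^sup>2 \<le> (\<Sum>u\<in>V. nonnbrs V A u)"
proof -
  have tr: "\<And>x y z. x \<in> V \<Longrightarrow> y \<in> V \<Longrightarrow> z \<in> V \<Longrightarrow> \<not> A x y \<Longrightarrow> A x z = A y z"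
    using assms unfolding multipartite_on_def graph_on_def by blast+
  have "(nonnbrs V A v)\<^sup>2 = (\<Sum>u\<in>V. of_bool (\<not> A v u) * nonnbrs V A v)"
    unfolding sum_distrib_right[symmetric] by (simp add: nonnbrs_def power2_eq_square)
  also have "\<dots> \<le> (\<Sum>u\<in>V. nonnbrs V A u)"
  proof (rule sum_mono)
    fix u assume u: "u \<in> V"
    show "of_bool (\<not> A v u) * nonnbrs V A v \<le> nonnbrs V A u"
    proof (cases "A v u")
      case False
      then have "nonnbrs V A v = nonnbrs V A u"
        unfolding nonnbrs_def using tr[OF assms(2) u] by (intro sum.cong) auto
      then show ?thesis using False by simp
    qed (simp add: nonnbrs_def sum_nonneg)
  qed
  finally show ?thesis .
qed

text \<open>Stability form of the identity: a small deficit puts almost every vertex into a part of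
  size close to \<open>n/4\<close>.\<close>

lemma multipartite_deficit_ge:
  assumes "multipartite_on V A"
  defines "n \<equiv> real (card V)"
  shows "n\<^sup>2 / 8 * (\<Sum>v\<in>V. (nonnbrs V A v - n / 4)\<^sup>2) \<le> 9 / 128 * n ^ 5 - copies V A - n ^ 3 * arcs_count V A / 16"
  unfolding n_def multipartite_deficit[OF assms(1)] sum_distrib_left
proof (rule sum_mono)
  fix v assume "v \<in> V"
  from multipartite_nonnbrs_sq_le[OF assms(1) this]
  have "(nonnbrs V A v - card V / 4)\<^sup>2 * ((real (card V))\<^sup>2 / 8) \<le>
    (nonnbrs V A v - card V / 4)\<^sup>2 * ((real (card V))\<^sup>2 / 8 + 2 * ((\<Sum>u\<in>V. nonnbrs V A u) - (nonnbrs V A v)\<^sup>2))"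
    by (intro mult_left_mono) auto
  then show "(real (card V))\<^sup>2 / 8 * (nonnbrs V A v - card V / 4)\<^sup>2 \<le>
    (nonnbrs V A v - card V / 4)\<^sup>2 * ((real (card V))\<^sup>2 / 8 + 2 * ((\<Sum>u\<in>V. nonnbrs V A u) - (nonnbrs V A v)\<^sup>2))"
    by (simp add: mult.commute)
qed

section \<open>Symmetrisation\<close>

text \<open>With unit weights this is the sum of the squared degrees. Copies and arcs may stay
  constant under cloning; this quantity supplies the strict inequality.\<close>

definition wcherries :: "'a set \<Rightarrow> ('a \<Rightarrow> real) \<Rightarrow> ('a \<Rightarrow> 'a \<Rightarrow> bool) \<Rightarrow> real" where
  "wcherries V w A = (\<Sum>c\<in>V. \<Sum>a\<in>V. \<Sum>a'\<in>V. w c * w a * w a' * of_bool (A c a \<and> A c a'))"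

text \<open>Pulling \<open>A\<close> back along the map that sends \<open>u\<close> to
  \<open>v\<close> keeps the vertex set, so the counts before and after have the same
  normalisation.\<close>

definition clone :: "('a \<Rightarrow> 'a \<Rightarrow> bool) \<Rightarrow> 'a \<Rightarrow> 'a \<Rightarrow> 'a \<Rightarrow> 'a \<Rightarrow> bool" where
  "clone A u v x y = A (if x = u then v else x) (if y = u then v else y)"

text \<open>The image of the counting measure under that map: weight 0 at \<open>u\<close> and 2 at
  \<open>v\<close>. Exchanging \<open>u\<close> and \<open>v\<close> flips the sign of the
  perturbation of 1, which is what the convexity argument exploits.\<close>

definition shift_weight :: "'a \<Rightarrow> 'a \<Rightarrow> 'a \<Rightarrow> real" where
  "shift_weight u v x = 1 + (of_bool (x = v) - of_bool (x = u))"

lemma sum_clone: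
  fixes F :: "'a \<Rightarrow> real"
  assumes "finite V" "u \<in> V" "v \<in> V"
  shows "(\<Sum>x\<in>V. F (if x = u then v else x)) = (\<Sum>x\<in>V. shift_weight u v x * F x)"
proof -
  have "(\<Sum>x\<in>V. F (if x = u then v else x)) = (\<Sum>x\<in>V. F x + (if x = u then F v - F u else 0))"
    by (intro sum.cong) auto
  also have "\<dots> = (\<Sum>x\<in>V. F x) + F v - F u"
    using assms by (simp add: sum.distrib)
  also have "\<dots> = (\<Sum>x\<in>V. F x + (if x = v then F v else 0) - (if x = u then F u else 0))"
    using assms by (simp add: sum.distrib sum_subtractf)
  also have "\<dots> = (\<Sum>x\<in>V. shift_weight u v x * F x)"
    by (intro sum.cong) (auto simp: shift_weight_def algebra_simps)
  finally show ?thesis .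
qed

text \<open>As tuples may repeat a vertex in non-adjacent roles, the twins \<open>u\<close> and
  \<open>v\<close> call for no correction term. Each of the five sums is transported separately, the
  innermost first.\<close>

lemma copies_clone:
  assumes "finite V" "u \<in> V" "v \<in> V"
  shows "copies V (clone A u v) = wcopies V (shift_weight u v) A"
proof -
  define \<phi> where "\<phi> = (\<lambda>x. if x = u then v else x)"
  define w where "w = shift_weight u v"
  have R: "(\<Sum>x\<in>V. F (\<phi> x)) = (\<Sum>x\<in>V. w x * F x)" for F :: "_ \<Rightarrow> real"
    unfolding \<phi>_def w_def by (rule sum_clone[OF assms])
  define F where "F = (\<lambda>a a' b b' c. of_bool (is_copy A a a' b b' c) :: real)"
  have R1: "(\<Sum>c\<in>V. F a a' b b' (\<phi> c)) = (\<Sum>c\<in>V. w c * F a a' b b' c)" for a a' b b'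
    by (rule R)
  have R2: "(\<Sum>b'\<in>V. \<Sum>c\<in>V. w c * F a a' b (\<phi> b') c) = (\<Sum>b'\<in>V. w b' * (\<Sum>c\<in>V. w c * F a a' b b' c))" for a a' b
    by (rule R)
  have R3: "(\<Sum>b\<in>V. \<Sum>b'\<in>V. w b' * (\<Sum>c\<in>V. w c * F a a' (\<phi> b) b' c)) =
    (\<Sum>b\<in>V. w b * (\<Sum>b'\<in>V. w b' * (\<Sum>c\<in>V. w c * F a a' b b' c)))" for a a'
    by (rule R)
  have R4: "(\<Sum>a'\<in>V. \<Sum>b\<in>V. w b * (\<Sum>b'\<in>V. w b' * (\<Sum>c\<in>V. w c * F a (\<phi> a') b b' c))) =
    (\<Sum>a'\<in>V. w a' * (\<Sum>b\<in>V. w b * (\<Sum>b'\<in>V. w b' * (\<Sum>c\<in>V. w c * F a a' b b' c))))" for a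
    by (rule R)
  have R5: "(\<Sum>a\<in>V. \<Sum>a'\<in>V. w a' * (\<Sum>b\<in>V. w b * (\<Sum>b'\<in>V. w b' * (\<Sum>c\<in>V. w c * F (\<phi> a) a' b b' c)))) =
    (\<Sum>a\<in>V. w a * (\<Sum>a'\<in>V. w a' * (\<Sum>b\<in>V. w b * (\<Sum>b'\<in>V. w b' * (\<Sum>c\<in>V. w c * F a a' b b' c)))))"
    by (rule R)
  have "copies V (clone A u v) = sum5 V (\<lambda>a a' b b' c. F (\<phi> a) (\<phi> a') (\<phi> b) (\<phi> b') (\<phi> c))"
    by (simp only: wcopies_def F_def \<phi>_def is_copy_def clone_def mult_1)
  also have "\<dots> = wcopies V w A"
    unfolding R1 R2 R3 R4 R5 unfolding wcopies_def sum_distrib_left F_def by (simp only: mult.assoc)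
  finally show ?thesis unfolding w_def .
qed

lemma arcs_count_clone:
  assumes "finite V" "u \<in> V" "v \<in> V"
  shows "arcs_count V (clone A u v) = warcs V (shift_weight u v) A"
proof -
  have "arcs_count V (clone A u v) = (\<Sum>a\<in>V. shift_weight u v a * (\<Sum>b\<in>V. shift_weight u v b * of_bool (A a b)))"
    unfolding sum_clone[OF assms, symmetric] by (simp only: warcs_def clone_def mult_1)
  then show ?thesis by (simp only: warcs_def sum_distrib_left mult.assoc)
qed

lemma cherries_clone:
  assumes "finite V" "u \<in> V" "v \<in> V"
  shows "wcherries V (\<lambda>_. 1) (clone A u v) = wcherries V (shift_weight u v) A"
proof -
  have "wcherries V (\<lambda>_. 1) (clone A u v) = (\<Sum>c\<in>V. shift_weight u v c *
    (\<Sum>a\<in>V. shift_weight u v a * (\<Sum>a'\<in>V. shift_weight u v a' * of_bool (A c a \<and> A c a'))))"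
    unfolding sum_clone[OF assms, symmetric] by (simp only: wcherries_def clone_def mult_1)
  then show ?thesis by (simp only: wcherries_def sum_distrib_left mult.assoc)
qed

lemma sum5_swap_pairs:
  "sum5 V (\<lambda>a a' b b' c. F a a' b b' c) =
   sum5 V (\<lambda>b b' c a a'. F a a' b b' c :: real)"
proof -
  have "sum5 V (\<lambda>a a' b b' c. F a a' b b' c) =
    (\<Sum>p\<in>V \<times> V. \<Sum>q\<in>V \<times> V \<times> V. F (fst p) (snd p) (fst q) (fst (snd q)) (snd (snd q)))"
    by (simp add: sum.cartesian_product' split_def)
  also have "\<dots> = (\<Sum>q\<in>V \<times> V \<times> V. \<Sum>p\<in>V \<times> V. F (fst p) (snd p) (fst q) (fst (snd q)) (snd (snd q)))"
    by (rule sum.swap)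
  also have "\<dots> = sum5 V (\<lambda>b b' c a a'. F a a' b b' c)"
    by (simp add: sum.cartesian_product' split_def)
  finally show ?thesis .
qed


lemma sum3_rotate: "(\<Sum>b\<in>V. \<Sum>b'\<in>V. \<Sum>c\<in>V. F b b' c) = (\<Sum>c\<in>V. \<Sum>b\<in>V. \<Sum>b'\<in>V. F b b' c :: real)"
proof -
  have "(\<Sum>b\<in>V. \<Sum>b'\<in>V. \<Sum>c\<in>V. F b b' c) = (\<Sum>b\<in>V. \<Sum>c\<in>V. \<Sum>b'\<in>V. F b b' c)"
    by (rule sum.cong[OF refl], rule sum.swap)
  also have "\<dots> = (\<Sum>c\<in>V. \<Sum>b\<in>V. \<Sum>b'\<in>V. F b b' c)" by (rule sum.swap)
  finally show ?thesis .
qed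

lemma sum_product_nonneg:
  fixes F :: "'a \<Rightarrow> 'a \<Rightarrow> real"
  assumes "\<And>x y. x \<in> V \<Longrightarrow> y \<in> V \<Longrightarrow> F x y = k * (g x * g y)" "0 \<le> k"
  shows "0 \<le> (\<Sum>x\<in>V. \<Sum>y\<in>V. F x y)"
proof -
  have "(\<Sum>x\<in>V. \<Sum>y\<in>V. F x y) = (\<Sum>x\<in>V. \<Sum>y\<in>V. k * (g x * g y))"
    using assms by (intro sum.cong refl) auto
  also have "\<dots> = k * ((\<Sum>x\<in>V. g x) * (\<Sum>y\<in>V. g y))"
    using sum_product[of g V g V] by (simp only: sum_distrib_left)
  finally show ?thesis using assms(2) by simp
qed

text \<open>The hypotheses allow only one of the groups \<open>p, p'\<close>, then
  \<open>q, q'\<close>, then \<open>r\<close> to be non-zero. Terms of odd degree cancel between the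
  two signs, and the surviving quadratic terms join non-adjacent roles.\<close>

lemma product_pm:
  fixes p p' q q' r :: real
  assumes "p * q = 0" "p * q' = 0" "p' * q = 0" "p' * q' = 0" "p * r = 0" "p' * r = 0" "q * r = 0" "q' * r = 0"
  shows "(1 + p) * (1 + p') * (1 + q) * (1 + q') * (1 + r) + (1 - p) * (1 - p') * (1 - q) * (1 - q') * (1 - r)
    = 2 + 2 * (p * p' + q * q')"
proof (cases "r = 0")
  case False
  then show ?thesis using assms by auto
next
  case True
  show ?thesis
  proof (cases "p = 0 \<and> p' = 0")
    case True
    then show ?thesis using \<open>r = 0\<close> by (auto simp: algebra_simps)
  next
    case False
    then have "q = 0" "q' = 0" using assms by auto
    then show ?thesis using \<open>r = 0\<close> by (auto simp: algebra_simps)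
  qed
qed

locale nonadjacent =
  fixes V :: "'a set" and A :: "'a \<Rightarrow> 'a \<Rightarrow> bool" and u v :: 'a
  assumes graph: "graph_on V A" and uv: "u \<in> V" "v \<in> V" "\<not> A u v"
begin

definition d :: "'a \<Rightarrow> real" where "d x = of_bool (x = v) - of_bool (x = u)"

lemma d_nonadjacent:
  assumes "x \<in> V" "y \<in> V" "A x y"
  shows "d x * d y = 0"
proof -
  have "\<not> A u u" "\<not> A v v" "\<not> A v u" using graph uv unfolding graph_on_def by blast+
  then have "\<not> (x \<in> {u, v} \<and> y \<in> {u, v})" using assms uv by auto
  then show ?thesis by (auto simp: d_def)
qed

lemma weights: "shift_weight u v = (\<lambda>x. 1 + d x)" "shift_weight v u = (\<lambda>x. 1 - d x)"
  by (auto simp: shift_weight_def d_def)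

lemma copies_convex: "2 * copies V A \<le> wcopies V (shift_weight u v) A + wcopies V (shift_weight v u) A"
proof -
  let ?I = "\<lambda>a a' b b' c. of_bool (is_copy A a a' b b' c) :: real"
  have pw: "(1 + d a) * (1 + d a') * (1 + d b) * (1 + d b') * (1 + d c) * ?I a a' b b' c
      + (1 - d a) * (1 - d a') * (1 - d b) * (1 - d b') * (1 - d c) * ?I a a' b b' c
      = 2 * (1 * 1 * 1 * 1 * 1 * ?I a a' b b' c) + 2 * (d a * d a' * ?I a a' b b' c) + 2 * (d b * d b' * ?I a a' b b' c)"
    if "a \<in> V" "a' \<in> V" "b \<in> V" "b' \<in> V" "c \<in> V" for a a' b b' c
  proof (cases "is_copy A a a' b b' c")
    case True
    then have "d a * d b = 0" "d a * d b' = 0" "d a' * d b = 0" "d a' * d b' = 0"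
      "d c * d a = 0" "d c * d a' = 0" "d c * d b = 0" "d c * d b' = 0"
      unfolding is_copy_def using that d_nonadjacent by blast+
    then show ?thesis using True product_pm[of "d a" "d b" "d b'" "d a'" "d c"]
      by (simp add: mult.commute)
  qed simp
  have "wcopies V (shift_weight u v) A + wcopies V (shift_weight v u) A =
    sum5 V (\<lambda>a a' b b' c. 2 * (1 * 1 * 1 * 1 * 1 * ?I a a' b b' c)
      + 2 * (d a * d a' * ?I a a' b b' c) + 2 * (d b * d b' * ?I a a' b b' c))"
    unfolding wcopies_def weights sum.distrib[symmetric] by (intro sum.cong refl pw)
  also have "\<dots> = 2 * copies V A
      + 2 * sum5 V (\<lambda>a a' b b' c. d a * d a' * ?I a a' b b' c)
      + 2 * sum5 V (\<lambda>a a' b b' c. d b * d b' * ?I a a' b b' c)"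
    unfolding wcopies_def by (simp only: sum.distrib sum_distrib_left)
  finally have eq: "wcopies V (shift_weight u v) A + wcopies V (shift_weight v u) A = \<dots>" .
  have "0 \<le> sum5 V (\<lambda>a a' b b' c. d a * d a' * ?I a a' b b' c)"
  proof (subst sum5_swap_pairs, rule sum_nonneg, rule sum_nonneg, rule sum_nonneg)
    fix b b' c assume V: "b \<in> V" "b' \<in> V" "c \<in> V"
    define g where "g = (\<lambda>a. d a * of_bool (A a b \<and> A a b' \<and> A c a))"
    show "0 \<le> (\<Sum>a\<in>V. \<Sum>a'\<in>V. d a * d a' * ?I a a' b b' c)"
    proof (rule sum_product_nonneg)
      fix a a' assume a: "a \<in> V" "a' \<in> V"
      show "d a * d a' * ?I a a' b b' c = of_bool (\<not> A b b' \<and> A c b \<and> A c b') * (g a * g a')"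
      proof (cases "A a a'")
        case True
        then show ?thesis using d_nonadjacent[OF a True] by (auto simp: g_def)
      qed (auto simp: g_def is_copy_def)
    qed simp
  qed
  moreover have "0 \<le> sum5 V (\<lambda>a a' b b' c. d b * d b' * ?I a a' b b' c)"
  proof (rule sum_nonneg, rule sum_nonneg)
    fix a a' assume V: "a \<in> V" "a' \<in> V"
    show "0 \<le> (\<Sum>b\<in>V. \<Sum>b'\<in>V. \<Sum>c\<in>V. d b * d b' * ?I a a' b b' c)"
    proof (subst sum3_rotate, rule sum_nonneg)
      fix c assume c: "c \<in> V"
      define g where "g = (\<lambda>b. d b * of_bool (A a b \<and> A a' b \<and> A c b))"
      show "0 \<le> (\<Sum>b\<in>V. \<Sum>b'\<in>V. d b * d b' * ?I a a' b b' c)"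
      proof (rule sum_product_nonneg)
        fix b b' assume b: "b \<in> V" "b' \<in> V"
        show "d b * d b' * ?I a a' b b' c = of_bool (\<not> A a a' \<and> A c a \<and> A c a') * (g b * g b')"
        proof (cases "A b b'")
          case True
          then show ?thesis using d_nonadjacent[OF b True] by (auto simp: g_def)
        qed (auto simp: g_def is_copy_def)
      qed simp
    qed
  qed
  ultimately show ?thesis unfolding eq by simp
qed

lemma arcs_linear: "warcs V (shift_weight u v) A + warcs V (shift_weight v u) A = 2 * arcs_count V A"
proof -
  have "warcs V (shift_weight u v) A + warcs V (shift_weight v u) A = (\<Sum>a\<in>V. \<Sum>b\<in>V. 2 * (1 * 1 * of_bool (A a b)))"
    unfolding warcs_def weights sum.distrib[symmetric]
  proof (intro sum.cong refl)
    fix a b assume "a \<in> V" "b \<in> V"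
    then show "(1 + d a) * (1 + d b) * of_bool (A a b) + (1 - d a) * (1 - d b) * of_bool (A a b) = 2 * (1 * 1 * of_bool (A a b))"
      using d_nonadjacent[of a b] by (cases "A a b") (auto simp: algebra_simps)
  qed
  then show ?thesis by (simp only: warcs_def sum_distrib_left)
qed

text \<open>The surplus is the sum over \<open>c\<close> of the squared difference between adjacency
  to \<open>v\<close> and to \<open>u\<close>, which is positive as soon as the two neighbourhoods
  differ.\<close>

lemma cherries_strictly_convex:
  assumes "z \<in> V" "A u z \<noteq> A v z"
  shows "2 * wcherries V (\<lambda>_. 1) A < wcherries V (shift_weight u v) A + wcherries V (shift_weight v u) A"
proof -
  have fin: "finite V" using graph by (simp add: graph_on_def)
  have sym: "x \<in> V \<Longrightarrow> y \<in> V \<Longrightarrow> A x y \<longleftrightarrow> A y x" for x y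
    using graph unfolding graph_on_def by blast
  let ?I = "\<lambda>c a a'. of_bool (A c a \<and> A c a') :: real"
  have "wcherries V (shift_weight u v) A + wcherries V (shift_weight v u) A =
    (\<Sum>c\<in>V. \<Sum>a\<in>V. \<Sum>a'\<in>V. 2 * (1 * 1 * 1 * ?I c a a') + 2 * (d a * d a' * ?I c a a'))"
    unfolding wcherries_def weights sum.distrib[symmetric]
  proof (intro sum.cong refl)
    fix c a a' assume V: "c \<in> V" "a \<in> V" "a' \<in> V"
    show "(1 + d c) * (1 + d a) * (1 + d a') * ?I c a a' + (1 - d c) * (1 - d a) * (1 - d a') * ?I c a a'
      = 2 * (1 * 1 * 1 * ?I c a a') + 2 * (d a * d a' * ?I c a a')"
    proof (cases "A c a \<and> A c a'")
      case True
      then have "d c * d a = 0" "d c * d a' = 0" using V d_nonadjacent by blast+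
      then show ?thesis using True by (cases "d c = 0") (auto simp: algebra_simps)
    qed auto
  qed
  also have "\<dots> = 2 * wcherries V (\<lambda>_. 1) A + 2 * (\<Sum>c\<in>V. \<Sum>a\<in>V. \<Sum>a'\<in>V. d a * d a' * ?I c a a')"
    unfolding wcherries_def by (simp only: sum.distrib sum_distrib_left)
  also have "(\<Sum>c\<in>V. \<Sum>a\<in>V. \<Sum>a'\<in>V. d a * d a' * ?I c a a') = (\<Sum>c\<in>V. (\<Sum>a\<in>V. d a * of_bool (A c a))\<^sup>2)"
    unfolding power2_eq_square sum_product by (intro sum.cong refl) auto
  also have "\<dots> = (\<Sum>c\<in>V. (of_bool (A c v) - of_bool (A c u))\<^sup>2)"
  proof (rule sum.cong[OF refl])
    fix c
    have "(\<Sum>a\<in>V. d a * of_bool (A c a)) = (\<Sum>a\<in>V. (if a = v then of_bool (A c v) else 0) - (if a = u then of_bool (A c u) else 0))"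
      by (intro sum.cong) (auto simp: d_def)
    also have "\<dots> = of_bool (A c v) - of_bool (A c u)"
      using fin uv by (simp add: sum_subtractf)
    finally show "(\<Sum>a\<in>V. d a * of_bool (A c a))\<^sup>2 = (of_bool (A c v) - of_bool (A c u))\<^sup>2" by simp
  qed
  finally have eq: "wcherries V (shift_weight u v) A + wcherries V (shift_weight v u) A =
    2 * wcherries V (\<lambda>_. 1) A + 2 * (\<Sum>c\<in>V. (of_bool (A c v) - of_bool (A c u))\<^sup>2)" .
  have "(1::real) = (of_bool (A z v) - of_bool (A z u))\<^sup>2"
    using sym[OF assms(1) uv(1)] sym[OF assms(1) uv(2)] assms(2) by (auto simp: of_bool_def)
  also have "\<dots> \<le> (\<Sum>c\<in>V. (of_bool (A c v) - of_bool (A c u))\<^sup>2)"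
    by (rule member_le_sum[OF assms(1) _ fin]) simp
  finally show ?thesis unfolding eq by simp
qed

end

section \<open>The contribution of one vertex near a balanced 4-partition\<close>

text \<open>Counts ordered triples with the first two entries in one of three parts of sizes
  \<open>a\<close>, \<open>b\<close>, \<open>c\<close> and the third entry in another: the places
  left for \<open>b\<close>, \<open>b'\<close> and \<open>c\<close> of a copy.\<close>

definition sq_lin3 :: "real \<Rightarrow> real \<Rightarrow> real \<Rightarrow> real" where
  "sq_lin3 a b c = a\<^sup>2 * (b + c) + b\<^sup>2 * (a + c) + c\<^sup>2 * (a + b)"

text \<open>The number of copies through a vertex that has \<open>z\<^sub>i\<close> neighbours and \<open>n\<^sub>i\<close> non-neighbours in the
  \<open>i\<close>-th part of an otherwise complete 4-partite graph: the vertex plays either \<open>c\<close> (first line) or one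
  of the four other roles.\<close>

definition vertex_poly :: "real \<Rightarrow> real \<Rightarrow> real \<Rightarrow> real \<Rightarrow> real \<Rightarrow> real \<Rightarrow> real \<Rightarrow> real \<Rightarrow> real" where
  "vertex_poly z1 z2 z3 z4 n1 n2 n3 n4 =
     2 * (z1\<^sup>2 * z2\<^sup>2 + z1\<^sup>2 * z3\<^sup>2 + z1\<^sup>2 * z4\<^sup>2 + z2\<^sup>2 * z3\<^sup>2 + z2\<^sup>2 * z4\<^sup>2 + z3\<^sup>2 * z4\<^sup>2)
     + 4 * (n1 * sq_lin3 z2 z3 z4 + n2 * sq_lin3 z1 z3 z4 + n3 * sq_lin3 z1 z2 z4 + n4 * sq_lin3 z1 z2 z3)"

lemma vertex_poly_swap:
  "vertex_poly z1 z2 z3 z4 n1 n2 n3 n4 = vertex_poly z2 z1 z3 z4 n2 n1 n3 n4"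
  "vertex_poly z1 z2 z3 z4 n1 n2 n3 n4 = vertex_poly z3 z2 z1 z4 n3 n2 n1 n4"
  "vertex_poly z1 z2 z3 z4 n1 n2 n3 n4 = vertex_poly z4 z2 z3 z1 n4 n2 n3 n1"
  "vertex_poly z1 z2 z3 z4 n1 n2 n3 n4 = vertex_poly z1 z3 z2 z4 n1 n3 n2 n4"
  "vertex_poly z1 z2 z3 z4 n1 n2 n3 n4 = vertex_poly z1 z4 z3 z2 n1 n4 n3 n2"
  "vertex_poly z1 z2 z3 z4 n1 n2 n3 n4 = vertex_poly z1 z2 z4 z3 n1 n2 n4 n3"
  by (simp_all add: vertex_poly_def sq_lin3_def algebra_simps)

lemma sq_lin3_mono:
  assumes "0 \<le> a" "a \<le> a'" "0 \<le> b" "b \<le> b'" "0 \<le> c" "c \<le> c'"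
  shows "sq_lin3 a b c \<le> sq_lin3 a' b' c'"
  unfolding sq_lin3_def by (intro add_mono mult_mono power_mono) (use assms in auto)

lemma sq_lin3_nonneg: "0 \<le> a \<Longrightarrow> 0 \<le> b \<Longrightarrow> 0 \<le> c \<Longrightarrow> 0 \<le> sq_lin3 a b c"
  by (simp add: sq_lin3_def)

lemma vertex_poly_mono:
  assumes "0 \<le> z1" "z1 \<le> y1" "0 \<le> z2" "z2 \<le> y2" "0 \<le> z3" "z3 \<le> y3" "0 \<le> z4" "z4 \<le> y4"
    and "0 \<le> n1" "n1 \<le> m1" "0 \<le> n2" "n2 \<le> m2" "0 \<le> n3" "n3 \<le> m3" "0 \<le> n4" "n4 \<le> m4"
  shows "vertex_poly z1 z2 z3 z4 n1 n2 n3 n4 \<le> vertex_poly y1 y2 y3 y4 m1 m2 m3 m4"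
  unfolding vertex_poly_def
  by (intro add_mono mult_mono mult_left_mono power_mono sq_lin3_mono) (use assms in \<open>auto intro!: sq_lin3_nonneg add_nonneg_nonneg\<close>)

lemma quadratic_le_endpoints:
  fixes a b c l u h :: real
  assumes "0 \<le> a" "l \<le> u" "u \<le> h" "a * l\<^sup>2 + b * l + c \<le> 0" "a * h\<^sup>2 + b * h + c \<le> 0"
  shows "a * u\<^sup>2 + b * u + c \<le> 0"
proof (cases "l = h")
  case True
  then show ?thesis using assms by auto
next
  case False
  have "(h - l) * (a * u\<^sup>2 + b * u + c) = (h - u) * (a * l\<^sup>2 + b * l + c) + (u - l) * (a * h\<^sup>2 + b * h + c)
    - a * (u - l) * (h - u) * (h - l)"
    by (simp add: power2_eq_square algebra_simps)
  also have "\<dots> \<le> 0"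
    using mult_nonneg_nonpos[of "h - u" "a * l\<^sup>2 + b * l + c"] mult_nonneg_nonpos[of "u - l" "a * h\<^sup>2 + b * h + c"]
      mult_nonneg_nonneg[of "a * (u - l) * (h - u)" "h - l"] mult_nonneg_nonneg[of "a * (u - l)" "h - u"]
      mult_nonneg_nonneg[of a "u - l"] assms by linarith
  finally show ?thesis using False assms by (simp add: mult_le_0_iff)
qed

text \<open>No monomial of \<open>vertex_poly\<close> contains both \<open>z1\<close> and
  \<open>n1\<close>, and \<open>n1\<close> occurs linearly. Hence substituting \<open>x - u\<close>
  for \<open>n1\<close> leaves a quadratic in \<open>u\<close> whose leading coefficient is
  non-negative.\<close>

lemma vertex_poly_convex:
  assumes "l \<le> u" "u \<le> h" "0 \<le> z2" "0 \<le> z3" "0 \<le> z4" "0 \<le> n2" "0 \<le> n3" "0 \<le> n4"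
    and l: "vertex_poly l z2 z3 z4 (x - l) n2 n3 n4 + c * l + k \<le> 0"
    and h: "vertex_poly h z2 z3 z4 (x - h) n2 n3 n4 + c * h + k \<le> 0"
  shows "vertex_poly u z2 z3 z4 (x - u) n2 n3 n4 + c * u + k \<le> 0"
proof -
  let ?a = "2 * (z2\<^sup>2 + z3\<^sup>2 + z4\<^sup>2) + 4 * (n2 * (z3 + z4) + n3 * (z2 + z4) + n4 * (z2 + z3))"
  let ?b = "c - 4 * sq_lin3 z2 z3 z4 + 4 * (n2 * (z3\<^sup>2 + z4\<^sup>2) + n3 * (z2\<^sup>2 + z4\<^sup>2) + n4 * (z2\<^sup>2 + z3\<^sup>2))"
  let ?c = "k + vertex_poly 0 z2 z3 z4 x n2 n3 n4"
  have eq: "vertex_poly u z2 z3 z4 (x - u) n2 n3 n4 + c * u + k = ?a * u\<^sup>2 + ?b * u + ?c" for u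
    by (simp add: vertex_poly_def sq_lin3_def algebra_simps)
  show ?thesis
    unfolding eq by (rule quadratic_le_endpoints[OF _ assms(1,2) l[unfolded eq] h[unfolded eq]]) (use assms in simp)
qed

section \<open>One-variable quartics at the corners of the constraint region\<close>

context
  fixes t :: real
  assumes t: "0 \<le> t" "t \<le> 251/250"
begin

text \<open>In these lemmas the nominal part size is scaled to 1: \<open>t\<close> stands for
  \<open>4 * z2\<close>, \<open>251/250\<close> for the largest part, \<open>1/125\<close> for the
  slack \<open>1/500\<close>, and \<open>30\<close> is the value of
  \<open>vertex_poly 0 1 1 1 1 0 0 0\<close>. The penalties \<open>3/16\<close> and
  \<open>1/16\<close> become \<open>12\<close> and \<open>4\<close>. The squares form a certificate
  of negativity, here centred near the maximum of the quartic.\<close>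

lemma degenerate_quartic1:
  "vertex_poly (t + 1/125) t (251/250) (251/250) (251/250 - t) (251/250 - t) 0 0 + 12 * (t + 1/125)
     + 4 * (251/250 - t) \<le> 30 * (249/250) ^ 4"
proof -
  have "2 * t ^ 4 \<le> 2 * (251/250) * t ^ 3"
    using t mult_right_mono[of t "251/250" "t ^ 3"] by (simp add: power_numeral_reduce)
  moreover have "0 \<le> 14 * (t * (t - 13/20)\<^sup>2)" using t by simp
  moreover have "0 \<le> 10 * (t - 7/10)\<^sup>2" by simp
  moreover have "14 * (t * (t - 13/20)\<^sup>2) = 14 * t ^ 3 - 91/5 * t\<^sup>2 + 1183/200 * t"
    "10 * (t - 7/10)\<^sup>2 = 10 * t\<^sup>2 - 14 * t + 49/10"
    by (simp_all add: power_numeral_reduce field_simps)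
  moreover have "vertex_poly (t + 1/125) t (251/250) (251/250) (251/250 - t) (251/250 - t) 0 0 + 12 * (t + 1/125)
     + 4 * (251/250 - t) - 30 * (249/250) ^ 4
     = 2 * t ^ 4 - 2004/125 * t ^ 3 + 123996/15625 * t\<^sup>2 + 127008/15625 * t - 6890228987/976562500"
    unfolding vertex_poly_def sq_lin3_def by (simp add: power_numeral_reduce field_simps)
  moreover have "0 \<le> t ^ 3" "0 \<le> t\<^sup>2" using t by simp_all
  ultimately show ?thesis using t by linarith
qed

lemma degenerate_quartic2:
  "vertex_poly (t + 1/125) t t (251/250) (251/250 - t) (251/250 - t) (251/250 - t) 0 + 12 * (t + 1/125)
     + 8 * (251/250 - t) \<le> 30 * (249/250) ^ 4"
proof -
  have "0 \<le> 18 * (t\<^sup>2 - 13/20)\<^sup>2" by simp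
  moreover have "0 \<le> 17 * (t - 33/40)\<^sup>2" by simp
  moreover have "18 * (t\<^sup>2 - 13/20)\<^sup>2 = 18 * t ^ 4 - 117/5 * t\<^sup>2 + 1521/200"
    "17 * (t - 33/40)\<^sup>2 = 17 * t\<^sup>2 - 561/20 * t + 18513/1600"
    by (simp_all add: power_numeral_reduce field_simps)
  moreover have "vertex_poly (t + 1/125) t t (251/250) (251/250 - t) (251/250 - t) (251/250 - t) 0 + 12 * (t + 1/125)
     + 8 * (251/250 - t) - 30 * (249/250) ^ 4
     = - 18 * t ^ 4 - 16/125 * t ^ 3 + 191003/31250 * t\<^sup>2 + 55441256/1953125 * t - 41659093987/1953125000"
    unfolding vertex_poly_def sq_lin3_def by (simp add: power_numeral_reduce field_simps)
  moreover have "0 \<le> t ^ 3" "0 \<le> t\<^sup>2" using t by simp_all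
  ultimately show ?thesis using t by linarith
qed

lemma degenerate_quartic3:
  "vertex_poly (t + 1/125) t t t (251/250 - t) (251/250 - t) (251/250 - t) (251/250 - t) + 12 * (t + 1/125)
     + 12 * (251/250 - t) \<le> 30 * (249/250) ^ 4"
proof -
  have "0 \<le> 84 * (t\<^sup>2 - 4/7 * t - 3/10)\<^sup>2" by simp
  moreover have "0 \<le> 22 * (t - 13/20)\<^sup>2" by simp
  moreover have "84 * (t\<^sup>2 - 4/7 * t - 3/10)\<^sup>2 = 84 * t ^ 4 - 96 * t ^ 3 - 804/35 * t\<^sup>2 + 144/5 * t + 189/25"
    "22 * (t - 13/20)\<^sup>2 = 22 * t\<^sup>2 - 143/5 * t + 1859/200"
    by (simp_all add: power_numeral_reduce field_simps)
  moreover have "vertex_poly (t + 1/125) t t t (251/250 - t) (251/250 - t) (251/250 - t) (251/250 - t) + 12 * (t + 1/125)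
     + 12 * (251/250 - t) - 30 * (249/250) ^ 4
     = - 84 * t ^ 4 + 11988/125 * t ^ 3 + 9018/15625 * t\<^sup>2 + 3012/1953125 * t - 6788622003/390625000"
    unfolding vertex_poly_def sq_lin3_def by (simp add: power_numeral_reduce field_simps)
  moreover have "0 \<le> t ^ 3" "0 \<le> t\<^sup>2" using t by simp_all
  ultimately show ?thesis using t by linarith
qed

end

lemma vertex_poly_scale:
  "vertex_poly z1 z2 z3 z4 n1 n2 n3 n4 =
    vertex_poly (4 * z1) (4 * z2) (4 * z3) (4 * z4) (4 * n1) (4 * n2) (4 * n3) (4 * n4) / 256"
  by (simp add: vertex_poly_def sq_lin3_def algebra_simps)


text \<open>The polynomial is convex in each \<open>z\<^sub>i\<close>, so only the vertices of the constraint region matter;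
  the bound is attained at \<open>(0, x\<^sub>2, x\<^sub>3, x\<^sub>4)\<close> and has room to spare at every other vertex.\<close>

lemma vertex_poly_le_min:
  fixes x1 x2 x3 x4 z1 z2 z3 z4 :: real
  assumes x: "\<bar>x1 - 1/4\<bar> \<le> 1/1000" "\<bar>x2 - 1/4\<bar> \<le> 1/1000" "\<bar>x3 - 1/4\<bar> \<le> 1/1000" "\<bar>x4 - 1/4\<bar> \<le> 1/1000"
    and z: "0 \<le> z1" "z1 \<le> x1" "0 \<le> z2" "z2 \<le> x2" "0 \<le> z3" "z3 \<le> x3" "0 \<le> z4" "z4 \<le> x4"
    and least: "z1 \<le> z2 + 1/500" "z2 \<le> z3" "z2 \<le> z4"
  shows "vertex_poly z1 z2 z3 z4 (x1 - z1) (x2 - z2) (x3 - z3) (x4 - z4)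
    \<le> vertex_poly 0 x2 x3 x4 x1 0 0 0 - 3/16 * z1 - 1/16 * ((x2 - z2) + (x3 - z3) + (x4 - z4))"
proof -
  define L H where "L = (249/1000 :: real)" and "H = (251/1000 :: real)"
  define T where "T = vertex_poly 0 x2 x3 x4 x1 0 0 0"
  define G where "G = (\<lambda>z1 z2 z3 z4. vertex_poly z1 z2 z3 z4 (x1 - z1) (x2 - z2) (x3 - z3) (x4 - z4)
     + 3/16 * z1 + 1/16 * ((x2 - z2) + (x3 - z3) + (x4 - z4)) - T)"
  have xb: "L \<le> x1" "x1 \<le> H" "L \<le> x2" "x2 \<le> H" "L \<le> x3" "x3 \<le> H" "L \<le> x4" "x4 \<le> H"
    using x unfolding L_def H_def by linarith+
  have T: "30 * L ^ 4 \<le> T"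
  proof -
    have "vertex_poly 0 L L L L 0 0 0 \<le> T"
      unfolding T_def by (rule vertex_poly_mono) (use xb in \<open>auto simp: L_def\<close>)
    then show ?thesis by (simp add: vertex_poly_def sq_lin3_def power_numeral_reduce algebra_simps)
  qed
  have c1: "G u z2 z3 z4 \<le> 0"
    if "G l z2 z3 z4 \<le> 0" "G h z2 z3 z4 \<le> 0" "l \<le> u" "u \<le> h" "0 \<le> z2" "z2 \<le> x2" "0 \<le> z3" "z3 \<le> x3" "0 \<le> z4" "z4 \<le> x4"
    for l u h z2 z3 z4
  proof -
    have eq: "G u z2 z3 z4 = vertex_poly u z2 z3 z4 (x1 - u) (x2 - z2) (x3 - z3) (x4 - z4) + 3/16 * u
      + (1/16 * ((x2 - z2) + (x3 - z3) + (x4 - z4)) - T)" for u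
      unfolding G_def  by (simp add: field_simps)
    show ?thesis unfolding eq
      by (rule vertex_poly_convex[OF that(3,4) _ _ _ _ _ _ that(1)[unfolded eq] that(2)[unfolded eq]]) (use that in auto)
  qed
  have c2: "G z1 u z3 z4 \<le> 0"
    if "G z1 l z3 z4 \<le> 0" "G z1 h z3 z4 \<le> 0" "l \<le> u" "u \<le> h" "0 \<le> z1" "z1 \<le> x1" "0 \<le> z3" "z3 \<le> x3" "0 \<le> z4" "z4 \<le> x4"
    for l u h z1 z3 z4
  proof -
    have eq: "G z1 u z3 z4 = vertex_poly u z1 z3 z4 (x2 - u) (x1 - z1) (x3 - z3) (x4 - z4) + (- 1/16) * u
      + (3/16 * z1 + 1/16 * (x2 + (x3 - z3) + (x4 - z4)) - T)" for u
      unfolding G_def vertex_poly_swap(1)[of z1] by (simp add: field_simps)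
    show ?thesis unfolding eq
      by (rule vertex_poly_convex[OF that(3,4) _ _ _ _ _ _ that(1)[unfolded eq] that(2)[unfolded eq]]) (use that in auto)
  qed
  have c3: "G z1 z2 u z4 \<le> 0"
    if "G z1 z2 l z4 \<le> 0" "G z1 z2 h z4 \<le> 0" "l \<le> u" "u \<le> h" "0 \<le> z1" "z1 \<le> x1" "0 \<le> z2" "z2 \<le> x2" "0 \<le> z4" "z4 \<le> x4"
    for l u h z1 z2 z4
  proof -
    have eq: "G z1 z2 u z4 = vertex_poly u z2 z1 z4 (x3 - u) (x2 - z2) (x1 - z1) (x4 - z4) + (- 1/16) * u
      + (3/16 * z1 + 1/16 * (x3 + (x2 - z2) + (x4 - z4)) - T)" for u
      unfolding G_def vertex_poly_swap(2)[of z1] by (simp add: field_simps)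
    show ?thesis unfolding eq
      by (rule vertex_poly_convex[OF that(3,4) _ _ _ _ _ _ that(1)[unfolded eq] that(2)[unfolded eq]]) (use that in auto)
  qed
  have c4: "G z1 z2 z3 u \<le> 0"
    if "G z1 z2 z3 l \<le> 0" "G z1 z2 z3 h \<le> 0" "l \<le> u" "u \<le> h" "0 \<le> z1" "z1 \<le> x1" "0 \<le> z2" "z2 \<le> x2" "0 \<le> z3" "z3 \<le> x3"
    for l u h z1 z2 z3
  proof -
    have eq: "G z1 z2 z3 u = vertex_poly u z2 z3 z1 (x4 - u) (x2 - z2) (x3 - z3) (x1 - z1) + (- 1/16) * u
      + (3/16 * z1 + 1/16 * (x4 + (x2 - z2) + (x3 - z3)) - T)" for u
      unfolding G_def vertex_poly_swap(3)[of z1] by (simp add: field_simps)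
    show ?thesis unfolding eq
      by (rule vertex_poly_convex[OF that(3,4) _ _ _ _ _ _ that(1)[unfolded eq] that(2)[unfolded eq]]) (use that in auto)
  qed
  have zero: "G 0 z2 z3 z4 \<le> 0"
    if "0 \<le> z2" "z2 \<le> x2" "0 \<le> z3" "z3 \<le> x3" "0 \<le> z4" "z4 \<le> x4" for z2 z3 z4
  proof -
    \<comment> \<open>A copy through the vertex uses two adjacent neighbours of it, so neighbours in
      a single part give no copy, and the penalty alone stays well below \<open>T\<close>.\<close>
    have one: "G 0 y2 y3 y4 \<le> 0" if "(y2, y3, y4) \<in> {(0, 0, 0), (0, 0, x4), (0, x3, 0), (x2, 0, 0)}" for y2 y3 y4
    proof -
      have "vertex_poly 0 y2 y3 y4 x1 (x2 - y2) (x3 - y3) (x4 - y4) = 0"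
        using that by (auto simp: vertex_poly_def sq_lin3_def)
      moreover have "1/16 * ((x2 - y2) + (x3 - y3) + (x4 - y4)) \<le> 3/16 * H"
        using that xb by (auto simp: L_def)
      moreover have "3/16 * H \<le> 30 * L ^ 4" by (simp add: L_def H_def power_numeral_reduce)
      ultimately show ?thesis using T unfolding G_def by simp
    qed
    \<comment> \<open>Below, \<open>18 = 2 + 4 * (2 + 2)\<close>: the apex role gives 2, and each of
      the two parts without neighbours gives \<open>4 * 2\<close>.\<close>
    have two: "G 0 y2 y3 y4 \<le> 0" if "(y2, y3, y4) \<in> {(0, x3, x4), (x2, 0, x4), (x2, x3, 0)}" for y2 y3 y4
    proof -
      have "vertex_poly 0 y2 y3 y4 x1 (x2 - y2) (x3 - y3) (x4 - y4) \<le>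
        vertex_poly 0 (if y2 = 0 then 0 else H) (if y3 = 0 then 0 else H) (if y4 = 0 then 0 else H) H
          (if y2 = 0 then H else 0) (if y3 = 0 then H else 0) (if y4 = 0 then H else 0)"
        by (rule vertex_poly_mono) (use that xb in \<open>auto simp: L_def\<close>)
      also have "\<dots> \<le> 18 * H ^ 4"
        using that xb by (auto simp: vertex_poly_def sq_lin3_def L_def H_def power_numeral_reduce)
      finally have "vertex_poly 0 y2 y3 y4 x1 (x2 - y2) (x3 - y3) (x4 - y4) \<le> 18 * H ^ 4" .
      moreover have "1/16 * ((x2 - y2) + (x3 - y3) + (x4 - y4)) \<le> 1/16 * H"
        using that xb by (auto simp: L_def)
      moreover have "18 * H ^ 4 + 1/16 * H \<le> 30 * L ^ 4" by (simp add: L_def H_def power_numeral_reduce)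
      ultimately show ?thesis using T unfolding G_def by (simp add: field_simps)
    qed
    have tight: "G 0 x2 x3 x4 \<le> 0" by (simp add: G_def T_def)
    have x0: "0 \<le> x1" "0 \<le> x2" "0 \<le> x3" "0 \<le> x4" using xb by (auto simp: L_def)
    have v: "G 0 y2 y3 y4 \<le> 0" if "y2 \<in> {0, x2}" "y3 \<in> {0, x3}" "y4 \<in> {0, x4}" for y2 y3 y4
      using that one[of y2 y3 y4] two[of y2 y3 y4] tight by auto
    have v4: "G 0 y2 y3 z4 \<le> 0" if "y2 \<in> {0, x2}" "y3 \<in> {0, x3}" for y2 y3
      by (rule c4[of _ _ _ 0 x4]) (use v that x0 \<open>0 \<le> z4\<close> \<open>z4 \<le> x4\<close> in auto)
    have v3: "G 0 y2 z3 z4 \<le> 0" if "y2 \<in> {0, x2}" for y2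
      by (rule c3[of _ _ 0 _ x3]) (use v4 that x0 \<open>0 \<le> z3\<close> \<open>z3 \<le> x3\<close> \<open>0 \<le> z4\<close> \<open>z4 \<le> x4\<close> in auto)
    show ?thesis
      by (rule c2[of _ 0 _ _ x2]) (use v3 x0 that in auto)
  qed
  \<comment> \<open>The upper end of the range of \<open>z1\<close> moves with \<open>z2\<close>, so
    \<open>z2\<close> is not eliminated by convexity on this face. It survives as the variable of
    the quartics, while \<open>z3\<close> and \<open>z4\<close> range over \<open>[z2, x3]\<close>
    and \<open>[z2, x4]\<close>.\<close>
  define h where "h = min x1 (z2 + 1/500)"
  define t where "t = 4 * z2"
  have t: "0 \<le> t" "t \<le> 251/250" "z2 = t / 4" "H = (251/250) / 4"
    using z xb by (auto simp: t_def H_def)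
  have h: "z1 \<le> h" "h \<le> x1" "0 \<le> h" "h \<le> z2 + 1/500" "x1 - h \<le> H - z2"
    using z least xb unfolding h_def by (auto simp: min_def)
  have corner: "G h z2 y3 y4 \<le> 0" if "y3 \<in> {z2, x3}" "y4 \<in> {z2, x4}" for y3 y4
  proof -
    \<comment> \<open>Majorise by a corner with all parts of size \<open>H\<close> and multiply by
      256. Here \<open>k\<close> is the number of parts among 2, 3, 4 that hold only
      \<open>z2\<close> neighbours; each of them lacks at most \<open>H - z2\<close>.\<close>
    have bnd: "G h z2 y3 y4 \<le> 0"
      if "vertex_poly h z2 y3 y4 (x1 - h) (x2 - z2) (x3 - y3) (x4 - y4) \<le> vertex_poly (z2 + 1/500) z2 w3 w4 (H - z2) (H - z2) m3 m4"
        and "vertex_poly (4 * (z2 + 1/500)) (4 * z2) (4 * w3) (4 * w4) (4 * (H - z2)) (4 * (H - z2)) (4 * m3) (4 * m4)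
          + 12 * (4 * (z2 + 1/500)) + 4 * (k * (4 * (H - z2))) \<le> 30 * (249/250) ^ 4"
        and "x3 - y3 + (x4 - y4) \<le> (k - 1) * (H - z2)" for w3 w4 m3 m4 k
    proof -
      define K V W where "K = k * (H - z2)"
        and "V = vertex_poly h z2 y3 y4 (x1 - h) (x2 - z2) (x3 - y3) (x4 - y4)"
        and "W = vertex_poly (4 * (z2 + 1/500)) (4 * z2) (4 * w3) (4 * w4) (4 * (H - z2)) (4 * (H - z2)) (4 * m3) (4 * m4)"
      define S where "S = (x2 - z2) + (x3 - y3) + (x4 - y4)"
      have "S \<le> K" using that(3) xb unfolding S_def K_def by (simp add: algebra_simps)
      moreover have "30 * (249/250) ^ 4 = 256 * (30 * L ^ 4)" by (simp add: L_def power_numeral_reduce)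
      moreover have "V \<le> W / 256"
        using that(1) vertex_poly_scale[of "z2 + 1/500" z2 w3 w4 "H - z2" "H - z2" m3 m4] unfolding V_def W_def by simp
      moreover have "4 * (k * (4 * (H - z2))) = 16 * K" by (simp add: K_def)
      moreover note that(2)[folded W_def]
      ultimately have "V + 3/16 * h + 1/16 * S - T \<le> 0"
        using T h(4) by simp
      then show ?thesis unfolding G_def V_def S_def .
    qed
    have x0: "0 \<le> x1" "0 \<le> x2" "0 \<le> x3" "0 \<le> x4" using xb by (auto simp: L_def)
    have z0: "0 \<le> z2" "z2 \<le> x2" "z2 \<le> x3" "z2 \<le> x4" "z2 \<le> H" using z least xb by auto
    note q = degenerate_quartic1[OF t(1,2)] degenerate_quartic2[OF t(1,2)] degenerate_quartic3[OF t(1,2)]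
    consider "y3 = z2" "y4 = z2" | "y3 = x3" "y4 = z2" | "y3 = z2" "y4 = x4" | "y3 = x3" "y4 = x4"
      using \<open>y3 \<in> _\<close> \<open>y4 \<in> _\<close> by blast
    then show ?thesis
    proof cases
      case 1
      show ?thesis
      proof (rule bnd[of z2 z2 "H - z2" "H - z2" 3])
        show "vertex_poly h z2 y3 y4 (x1 - h) (x2 - z2) (x3 - y3) (x4 - y4)
          \<le> vertex_poly (z2 + 1 / 500) z2 z2 z2 (H - z2) (H - z2) (H - z2) (H - z2)"
          by (rule vertex_poly_mono) (use 1 h z0 xb in auto)
      qed (use q(3) 1 xb in \<open>simp_all add: t(3,4)\<close>)
    next
      case 2
      show ?thesis
      proof (rule bnd[of H z2 0 "H - z2" 2])
        show "vertex_poly h z2 y3 y4 (x1 - h) (x2 - z2) (x3 - y3) (x4 - y4)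
          \<le> vertex_poly (z2 + 1 / 500) z2 H z2 (H - z2) (H - z2) 0 (H - z2)"
          by (rule vertex_poly_mono) (use 2 h z0 x0 xb in auto)
      qed (use q(2) 2 xb in \<open>simp_all add: t(3,4) vertex_poly_swap(6)[of _ _ "251/250"]\<close>)
    next
      case 3
      show ?thesis
      proof (rule bnd[of z2 H "H - z2" 0 2])
        show "vertex_poly h z2 y3 y4 (x1 - h) (x2 - z2) (x3 - y3) (x4 - y4)
          \<le> vertex_poly (z2 + 1 / 500) z2 z2 H (H - z2) (H - z2) (H - z2) 0"
          by (rule vertex_poly_mono) (use 3 h z0 x0 xb in auto)
      qed (use q(2) 3 xb in \<open>simp_all add: t(3,4)\<close>)
    next
      case 4
      show ?thesis
      proof (rule bnd[of H H 0 0 1])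
        show "vertex_poly h z2 y3 y4 (x1 - h) (x2 - z2) (x3 - y3) (x4 - y4)
          \<le> vertex_poly (z2 + 1 / 500) z2 H H (H - z2) (H - z2) 0 0"
          by (rule vertex_poly_mono) (use 4 h z0 x0 xb in auto)
      qed (use q(1) 4 xb in \<open>simp_all add: t(3,4)\<close>)
    qed
  qed
  have x0: "0 \<le> x3" "0 \<le> x4" using xb by (auto simp: L_def)
  have e4: "G h z2 y3 z4 \<le> 0" if "y3 \<in> {z2, x3}" for y3
    by (rule c4[of _ _ _ z2 x4]) (use corner that z h x0 least in auto)
  have e3: "G h z2 z3 z4 \<le> 0"
    by (rule c3[of _ _ z2 _ x3]) (use e4 z h x0 least in auto)
  have "G z1 z2 z3 z4 \<le> 0"
    by (rule c1[of 0 _ _ _ h]) (use e3 zero z h in auto)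
  then show ?thesis unfolding G_def T_def by simp
qed

text \<open>By symmetry the smallest of \<open>z2\<close>, \<open>z3\<close>, \<open>z4\<close> may
  be taken to be \<open>z2\<close>. The hypotheses \<open>least\<close> say that the vertex sits in
  a part where it has almost the fewest neighbours; the slack is there because part sizes may differ
  by up to \<open>1/500\<close>.\<close>

lemma vertex_poly_le:
  fixes x1 x2 x3 x4 z1 z2 z3 z4 :: real
  assumes x: "\<bar>x1 - 1/4\<bar> \<le> 1/1000" "\<bar>x2 - 1/4\<bar> \<le> 1/1000" "\<bar>x3 - 1/4\<bar> \<le> 1/1000" "\<bar>x4 - 1/4\<bar> \<le> 1/1000"
    and z: "0 \<le> z1" "z1 \<le> x1" "0 \<le> z2" "z2 \<le> x2" "0 \<le> z3" "z3 \<le> x3" "0 \<le> z4" "z4 \<le> x4"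
    and least: "z1 \<le> z2 + 1/500" "z1 \<le> z3 + 1/500" "z1 \<le> z4 + 1/500"
  shows "vertex_poly z1 z2 z3 z4 (x1 - z1) (x2 - z2) (x3 - z3) (x4 - z4)
    \<le> vertex_poly 0 x2 x3 x4 x1 0 0 0 - 3/16 * z1 - 1/16 * ((x2 - z2) + (x3 - z3) + (x4 - z4))"
proof -
  consider "z2 \<le> z3" "z2 \<le> z4" | "z3 \<le> z2" "z3 \<le> z4" | "z4 \<le> z3" "z4 \<le> z2" by linarith
  then show ?thesis
  proof cases
    case 1
    then show ?thesis using vertex_poly_le_min[OF x z least(1)] by simp
  next
    case 2
    have "x3 - z3 + (x2 - z2) + (x4 - z4) = x2 - z2 + (x3 - z3) + (x4 - z4)" by simp
    then show ?thesis
      using vertex_poly_le_min[OF x(1,3,2,4) z(1,2,5,6,3,4,7,8) least(2) 2]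
      by (simp only: vertex_poly_swap(4)[of z1 z2 z3] vertex_poly_swap(4)[of 0 x2 x3])
  next
    case 3
    have "x4 - z4 + (x3 - z3) + (x2 - z2) = x2 - z2 + (x3 - z3) + (x4 - z4)" by simp
    then show ?thesis
      using vertex_poly_le_min[OF x(1,4,3,2) z(1,2,7,8,5,6,3,4) least(3) 3]
      by (simp only: vertex_poly_swap(5)[of z1 z2 z3 z4] vertex_poly_swap(5)[of 0 x2 x3 x4])
  qed
qed

section \<open>Resetting vertices one at a time\<close>

lemma sum_of_bool_eq_mult:
  fixes v :: 'a
  assumes "finite V" "v \<in> V"
  shows "(\<Sum>x\<in>V. of_bool (x = v) * (F x :: real)) = F v"
proof -
  have "(\<Sum>x\<in>V. of_bool (x = v) * F x) = (\<Sum>x\<in>V. if x = v then F x else 0)"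
    by (intro sum.cong) auto
  then show ?thesis using assms by simp
qed

section \<open>Change of the copy count when one vertex changes\<close>

definition copies_outer :: "'a set \<Rightarrow> ('a \<Rightarrow> 'a \<Rightarrow> bool) \<Rightarrow> 'a \<Rightarrow> real" where
  "copies_outer V A v = sum4 V (\<lambda>a' b b' c. of_bool (is_copy A v a' b b' c))"

definition copies_apex :: "'a set \<Rightarrow> ('a \<Rightarrow> 'a \<Rightarrow> bool) \<Rightarrow> 'a \<Rightarrow> real" where
  "copies_apex V A v = sum4 V (\<lambda>a a' b b'. of_bool (is_copy A a a' b b' v))"

lemma is_copy_sym:
  assumes "graph_on V A" "a \<in> V" "a' \<in> V" "b \<in> V" "b' \<in> V" "c \<in> V"
  shows "is_copy A a' a b b' c = is_copy A a a' b b' c"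
    and "is_copy A b b' a a' c = is_copy A a a' b b' c"
proof -
  have sym: "\<And>x y. x \<in> V \<Longrightarrow> y \<in> V \<Longrightarrow> A x y \<longleftrightarrow> A y x"
    using assms(1) unfolding graph_on_def by blast
  have "A a' a = A a a'" "A b a = A a b" "A b a' = A a' b" "A b' a = A a b'" "A b' a' = A a' b'"
    using sym assms(2-) by blast+
  then show "is_copy A a' a b b' c = is_copy A a a' b b' c" "is_copy A b b' a a' c = is_copy A a a' b b' c"
    unfolding is_copy_def by blast+
qed

text \<open>If \<open>m\<close> of the events hold, the right-hand side is
  \<open>m g + m (m - 1) / 2\<close>. It exceeds \<open>g\<close> by
  \<open>(m - 1) (g + m / 2)\<close>, which is non-negative for \<open>m \<ge> 1\<close> because
  \<open>g \<ge> -1\<close>.\<close>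

lemma difference_le_by_occurrences:
  fixes g :: real and e1 e2 e3 e4 e5 :: bool
  assumes "\<bar>g\<bar> \<le> 1" "\<not> e1 \<Longrightarrow> \<not> e2 \<Longrightarrow> \<not> e3 \<Longrightarrow> \<not> e4 \<Longrightarrow> \<not> e5 \<Longrightarrow> g = 0"
  shows "g \<le> of_bool e1 * g + of_bool e2 * g + of_bool e3 * g + of_bool e4 * g + of_bool e5 * g
    + (of_bool e1 * of_bool e2 + of_bool e1 * of_bool e3 + of_bool e1 * of_bool e4 + of_bool e1 * of_bool e5
     + of_bool e2 * of_bool e3 + of_bool e2 * of_bool e4 + of_bool e2 * of_bool e5
     + of_bool e3 * of_bool e4 + of_bool e3 * of_bool e5 + of_bool e4 * of_bool e5)"
  using assms by (cases e1; cases e2; cases e3; cases e4; cases e5) (simp_all add: abs_le_iff)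

text \<open>Only tuples containing \<open>v\<close> matter. The four outer roles are equivalent
  under the symmetries of a copy, and tuples in which \<open>v\<close> occupies one of the 10 pairs
  of positions number at most \<open>n^3\<close> for each pair.\<close>

lemma copies_diff_le:
  assumes H: "graph_on V H" and H': "graph_on V H'" and v: "v \<in> V"
    and agree: "\<And>x y. x \<in> V \<Longrightarrow> y \<in> V \<Longrightarrow> x \<noteq> v \<Longrightarrow> y \<noteq> v \<Longrightarrow> H x y = H' x y"
  shows "copies V H - copies V H' \<le> 4 * (copies_outer V H v - copies_outer V H' v)
    + (copies_apex V H v - copies_apex V H' v) + 10 * real (card V) ^ 3"
proof -
  have fin: "finite V" using H by (simp add: graph_on_def)
  define g where "g = (\<lambda>a a' b b' c. of_bool (is_copy H a a' b b' c) - of_bool (is_copy H' a a' b b' c) :: real)"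
  let ?e = "\<lambda>x. of_bool (x = v) :: real"
  let ?pairs = "\<lambda>a a' b b' c. ?e a * ?e a' + ?e a * ?e b + ?e a * ?e b' + ?e a * ?e c + ?e a' * ?e b + ?e a' * ?e b' + ?e a' * ?e c
     + ?e b * ?e b' + ?e b * ?e c + ?e b' * ?e c"
  note delta = sum_of_bool_eq_mult[OF fin v]
  have sums: "copies V H - copies V H' = sum5 V (\<lambda>a a' b b' c. g a a' b b' c)"
    unfolding wcopies_def g_def mult_1 by (simp only: sum_subtractf)
  have pw: "g a a' b b' c \<le> ?e a * g a a' b b' c + ?e a' * g a a' b b' c + ?e b * g a a' b b' c + ?e b' * g a a' b b' c + ?e c * g a a' b b' c
    + (?pairs a a' b b' c)"
    if "a \<in> V" "a' \<in> V" "b \<in> V" "b' \<in> V" "c \<in> V" for a a' b b' c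
  proof (rule difference_le_by_occurrences)
    show "\<bar>g a a' b b' c\<bar> \<le> 1" by (simp add: g_def)
    assume "a \<noteq> v" "a' \<noteq> v" "b \<noteq> v" "b' \<noteq> v" "c \<noteq> v"
    then have "is_copy H a a' b b' c = is_copy H' a a' b b' c"
      unfolding is_copy_def using agree that by blast
    then show "g a a' b b' c = 0" by (simp add: g_def)
  qed
  have gsym: "g a a' b b' c = g a' a b b' c" "g a a' b b' c = g b b' a a' c" if "a \<in> V" "a' \<in> V" "b \<in> V" "b' \<in> V" "c \<in> V" for a a' b b' c
    unfolding g_def is_copy_sym[OF H that] is_copy_sym[OF H' that] by simp_all
  define Q1 where "Q1 = sum4 V (\<lambda>a' b b' c. g v a' b b' c)"
  define Q0 where "Q0 = sum4 V (\<lambda>a a' b b'. g a a' b b' v)"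
  have p1: "sum5 V (\<lambda>a a' b b' c. ?e a * g a a' b b' c) = Q1"
    unfolding sum_distrib_left[symmetric] delta Q1_def ..
  have p2: "sum5 V (\<lambda>a a' b b' c. ?e a' * g a a' b b' c) = Q1"
    unfolding sum_distrib_left[symmetric] delta Q1_def by (intro sum.cong refl gsym(1)) (use v in auto)
  have p3: "sum5 V (\<lambda>a a' b b' c. ?e b * g a a' b b' c) = Q1"
  proof -
    have "sum5 V (\<lambda>a a' b b' c. ?e b * g a a' b b' c)
      = sum4 V (\<lambda>a a' b' c. g v b' a a' c)"
      unfolding sum_distrib_left[symmetric] delta by (intro sum.cong refl gsym(2)) (use v in auto)
    also have "\<dots> = sum4 V (\<lambda>b' a a' c. g v b' a a' c)"
      by (rule sum3_rotate)
    finally show ?thesis unfolding Q1_def .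
  qed
  have p4: "sum5 V (\<lambda>a a' b b' c. ?e b' * g a a' b b' c) = Q1"
  proof -
    have "sum5 V (\<lambda>a a' b b' c. ?e b' * g a a' b b' c)
      = sum4 V (\<lambda>a a' b c. g a a' b v c)"
      unfolding sum_distrib_left[symmetric] delta ..
    also have "\<dots> = sum4 V (\<lambda>a a' b c. g v b a a' c)"
    proof (intro sum.cong refl)
      fix a a' b c assume "a \<in> V" "a' \<in> V" "b \<in> V" "c \<in> V"
      then show "g a a' b v c = g v b a a' c"
        using gsym(2)[of a a' b v c] gsym(1)[of b v a a' c] v by simp
    qed
    also have "\<dots> = sum4 V (\<lambda>b' a a' c. g v b' a a' c)"
      by (rule sum3_rotate)
    finally show ?thesis unfolding Q1_def .
  qed
  have p5: "sum5 V (\<lambda>a a' b b' c. ?e c * g a a' b b' c) = Q0"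
    unfolding delta Q0_def ..
  have e1: "(\<Sum>x\<in>V. ?e x) = 1" using delta[of "\<lambda>_. 1"] by simp
  have pairs: "sum5 V (\<lambda>a a' b b' c. (?pairs a a' b b' c)) = 10 * real (card V) ^ 3"
    unfolding sum.distrib sum_distrib_left[symmetric] sum_distrib_right[symmetric] e1 sum_constant mult_1_right delta
    by (simp add: power3_eq_cube)
  have "copies V H - copies V H' \<le> sum5 V (\<lambda>a a' b b' c. ?e a * g a a' b b' c + ?e a' * g a a' b b' c + ?e b * g a a' b b' c + ?e b' * g a a' b b' c + ?e c * g a a' b b' c
    + (?pairs a a' b b' c))"
    unfolding sums by (intro sum_mono pw)
  also have "\<dots> = sum5 V (\<lambda>a a' b b' c. ?e a * g a a' b b' c)
    + sum5 V (\<lambda>a a' b b' c. ?e a' * g a a' b b' c)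
    + sum5 V (\<lambda>a a' b b' c. ?e b * g a a' b b' c)
    + sum5 V (\<lambda>a a' b b' c. ?e b' * g a a' b b' c)
    + sum5 V (\<lambda>a a' b b' c. ?e c * g a a' b b' c)
    + sum5 V (\<lambda>a a' b b' c. (?pairs a a' b b' c))"
    by (simp only: sum.distrib)
  also have "\<dots> = Q1 + Q1 + Q1 + Q1 + Q0 + 10 * real (card V) ^ 3"
    unfolding p1 p2 p3 p4 p5 pairs ..
  also have "Q1 = copies_outer V H v - copies_outer V H' v"
    unfolding Q1_def copies_outer_def g_def by (simp only: sum_subtractf)
  also have "Q0 = copies_apex V H v - copies_apex V H' v"
    unfolding Q0_def copies_apex_def g_def by (simp only: sum_subtractf)
  finally show ?thesis by simp
qed

lemma sum_mult_inner:
  fixes f :: "'a \<Rightarrow> real"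
  shows "(\<Sum>p\<in>V. \<Sum>q\<in>V. f q * M p q) = (\<Sum>q\<in>V. f q * (\<Sum>p\<in>V. M p q))"
  by (subst sum.swap) (simp only: sum_distrib_left)

text \<open>Of the \<open>4 * 6\<close> products of a vertex term with a pair term, 12 have the
  vertex inside the pair and 12 do not. The first kind is local, the second factorises.\<close>

lemma sum4_mult_sum_pairs:
  fixes f :: "'a \<Rightarrow> real" and M :: "'a \<Rightarrow> 'a \<Rightarrow> real"
  assumes sym: "\<And>x y. x \<in> V \<Longrightarrow> y \<in> V \<Longrightarrow> M x y = M y x"
  defines "n \<equiv> real (card V)" and "b \<equiv> \<lambda>x. \<Sum>y\<in>V. M x y"
  shows "sum4 V (\<lambda>p q r s. f p * M p q + f q * M p q + f r * M p q + f s * M p q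
    + f p * M p r + f q * M p r + f r * M p r + f s * M p r
    + f p * M p s + f q * M p s + f r * M p s + f s * M p s
    + f p * M q r + f q * M q r + f r * M q r + f s * M q r
    + f p * M q s + f q * M q s + f r * M q s + f s * M q s
    + f p * M r s + f q * M r s + f r * M r s + f s * M r s)
   = 12 * (n\<^sup>2 * (\<Sum>x\<in>V. f x * b x)) + 12 * (n * ((\<Sum>x\<in>V. f x) * (\<Sum>x\<in>V. b x)))"
proof -
  have inner: "(\<Sum>p\<in>V. \<Sum>q\<in>V. f q * M p q) = (\<Sum>q\<in>V. f q * b q)"
    unfolding sum_mult_inner b_def by (intro sum.cong refl) (use sym in \<open>auto intro!: sum.cong\<close>)
  have b: "(\<Sum>y\<in>V. M x y) = b x" for x unfolding b_def ..
  note rules = sum.distrib sum_distrib_left[symmetric] sum_distrib_right[symmetric] inner b sum_constant n_def[symmetric]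
  define B where "B = (\<Sum>x\<in>V. f x * b x)"
  have B1: "(\<Sum>x\<in>V. f x * (n * b x)) = n * B" "(\<Sum>x\<in>V. f x * (n * (n * b x))) = n * n * B"
    unfolding B_def sum_distrib_left by (intro sum.cong refl; simp)+
  have B2: "(\<Sum>p\<in>V. \<Sum>q\<in>V. f q * (n * M p q)) = n * B" "(\<Sum>p\<in>V. \<Sum>q\<in>V. f q * (n * (n * M p q))) = n * n * B"
    unfolding B_def inner[symmetric] sum_distrib_left by (intro sum.cong refl; simp)+
  show ?thesis
    unfolding rules unfolding rules unfolding rules unfolding rules
    unfolding B1 B2 B_def[symmetric] by (simp add: power2_eq_square)
qed


section \<open>Copy patterns relative to a 4-partition\<close>

definition part_count :: "'a set \<Rightarrow> ('a \<Rightarrow> nat) \<Rightarrow> ('a \<Rightarrow> bool) \<Rightarrow> nat \<Rightarrow> real" where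
  "part_count V \<pi> P j = (\<Sum>u\<in>V. of_bool (P u \<and> \<pi> u = j))"

lemma sum_by_part:
  assumes "finite V" "\<And>v. v \<in> V \<Longrightarrow> \<pi> v < (4::nat)"
  shows "(\<Sum>u\<in>V. of_bool (P u) * (F (\<pi> u) :: real)) = part_count V \<pi> P 0 * F 0 + part_count V \<pi> P 1 * F 1
    + part_count V \<pi> P 2 * F 2 + part_count V \<pi> P 3 * F 3"
  unfolding part_count_def sum_distrib_right sum.distrib[symmetric]
proof (rule sum.cong[OF refl])
  fix u assume "u \<in> V"
  then have "\<pi> u = 0 \<or> \<pi> u = 1 \<or> \<pi> u = 2 \<or> \<pi> u = 3" using assms(2)[of u] by linarith
  then show "of_bool (P u) * F (\<pi> u) = of_bool (P u \<and> \<pi> u = 0) * F 0 + of_bool (P u \<and> \<pi> u = 1) * F 1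
    + of_bool (P u \<and> \<pi> u = 2) * F 2 + of_bool (P u \<and> \<pi> u = 3) * F 3"
    by auto
qed

text \<open>The condition for a copy with a distinguished vertex in role \<open>a\<close>, if
  \<open>N\<close> is its neighbourhood and all other pairs follow the partition. It ignores the
  part of the distinguished vertex, so it serves before and after a reset;
  \<open>apex_pattern\<close> is the same for role \<open>c\<close>.\<close>

definition outer_pattern :: "('a \<Rightarrow> nat) \<Rightarrow> ('a \<Rightarrow> bool) \<Rightarrow> 'a \<Rightarrow> 'a \<Rightarrow> 'a \<Rightarrow> 'a \<Rightarrow> bool" where
  "outer_pattern \<pi> N a' b b' c \<longleftrightarrow> \<not> N a' \<and> N b \<and> N b' \<and> N c
    \<and> \<pi> b = \<pi> b' \<and> \<pi> a' \<noteq> \<pi> b \<and> \<pi> c \<noteq> \<pi> a' \<and> \<pi> c \<noteq> \<pi> b"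

definition apex_pattern :: "('a \<Rightarrow> nat) \<Rightarrow> ('a \<Rightarrow> bool) \<Rightarrow> 'a \<Rightarrow> 'a \<Rightarrow> 'a \<Rightarrow> 'a \<Rightarrow> bool" where
  "apex_pattern \<pi> N a a' b b' \<longleftrightarrow> N a \<and> N a' \<and> N b \<and> N b' \<and> \<pi> a = \<pi> a' \<and> \<pi> b = \<pi> b' \<and> \<pi> a \<noteq> \<pi> b"

lemma sum_patterns:
  fixes N :: "'a \<Rightarrow> bool"
  assumes "finite V" "\<And>v. v \<in> V \<Longrightarrow> \<pi> v < (4::nat)"
  defines "z \<equiv> part_count V \<pi> N" and "y \<equiv> part_count V \<pi> (\<lambda>u. \<not> N u)"
  shows "4 * sum4 V (\<lambda>p q r s. of_bool (outer_pattern \<pi> N p q r s))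
      + sum4 V (\<lambda>p q r s. of_bool (apex_pattern \<pi> N p q r s))
    = vertex_poly (z 0) (z 1) (z 2) (z 3) (y 0) (y 1) (y 2) (y 3)"
proof -
  note bp = sum_by_part[OF assms(1,2)]
  define S where "S = (\<lambda>F. z 0 * F 0 + z 1 * F 1 + z 2 * F 2 + z 3 * F (3::nat))"
  define R where "R = (\<lambda>F. y 0 * F 0 + y 1 * F 1 + y 2 * F 2 + y 3 * F (3::nat))"
  have N: "(\<Sum>u\<in>V. of_bool (N u) * F (\<pi> u)) = S F" and nN: "(\<Sum>u\<in>V. of_bool (\<not> N u) * F (\<pi> u)) = R F" for F
    unfolding S_def R_def z_def y_def by (rule bp[where P = N and F = F], assumption, rule bp[where P = "\<lambda>u. \<not> N u" and F = F], assumption)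
  define K :: "nat \<Rightarrow> nat \<Rightarrow> nat \<Rightarrow> nat \<Rightarrow> real" where
    "K = (\<lambda>j k k' l. of_bool (k = k' \<and> j \<noteq> k \<and> l \<noteq> j \<and> l \<noteq> k))"
  have "sum4 V (\<lambda>p q r s. of_bool (outer_pattern \<pi> N p q r s)) =
    (\<Sum>p\<in>V. of_bool (\<not> N p) * (\<Sum>q\<in>V. of_bool (N q) * (\<Sum>r\<in>V. of_bool (N r) * (\<Sum>s\<in>V. of_bool (N s) *
       K (\<pi> p) (\<pi> q) (\<pi> r) (\<pi> s)))))"
    unfolding sum_distrib_left outer_pattern_def K_def by (intro sum.cong refl) auto
  also have "\<dots> = R (\<lambda>j. S (\<lambda>k. S (\<lambda>k'. S (K j k k'))))"
    by (simp only: N[of "K _ _ _"] N[of "\<lambda>k'. S (K _ _ k')"] N[of "\<lambda>k. S (\<lambda>k'. S (K _ k k'))"]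
      nN[of "\<lambda>j. S (\<lambda>k. S (\<lambda>k'. S (K j k k')))"])
  finally have outer: "sum4 V (\<lambda>p q r s. of_bool (outer_pattern \<pi> N p q r s)) = \<dots>" .
  define L :: "nat \<Rightarrow> nat \<Rightarrow> nat \<Rightarrow> nat \<Rightarrow> real" where
    "L = (\<lambda>j j' k k'. of_bool (j = j' \<and> k = k' \<and> j \<noteq> k))"
  have "sum4 V (\<lambda>p q r s. of_bool (apex_pattern \<pi> N p q r s)) =
    (\<Sum>p\<in>V. of_bool (N p) * (\<Sum>q\<in>V. of_bool (N q) * (\<Sum>r\<in>V. of_bool (N r) * (\<Sum>s\<in>V. of_bool (N s) *
       L (\<pi> p) (\<pi> q) (\<pi> r) (\<pi> s)))))"
    unfolding sum_distrib_left apex_pattern_def L_def by (intro sum.cong refl) auto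
  also have "\<dots> = S (\<lambda>j. S (\<lambda>j'. S (\<lambda>k. S (L j j' k))))"
    by (simp only: N[of "L _ _ _"] N[of "\<lambda>k. S (L _ _ k)"] N[of "\<lambda>j'. S (\<lambda>k. S (L _ j' k))"]
      N[of "\<lambda>j. S (\<lambda>j'. S (\<lambda>k. S (L j j' k)))"])
  finally have apex: "sum4 V (\<lambda>p q r s. of_bool (apex_pattern \<pi> N p q r s)) = \<dots>" .
  have o: "R (\<lambda>j. S (\<lambda>k. S (\<lambda>k'. S (K j k k')))) = y 0 * sq_lin3 (z 1) (z 2) (z 3) + y 1 * sq_lin3 (z 0) (z 2) (z 3)
     + y 2 * sq_lin3 (z 0) (z 1) (z 3) + y 3 * sq_lin3 (z 0) (z 1) (z 2)"
    unfolding R_def S_def K_def sq_lin3_def by (simp add: power2_eq_square algebra_simps)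
  have a: "S (\<lambda>j. S (\<lambda>j'. S (\<lambda>k. S (L j j' k)))) = 2 * ((z 0)\<^sup>2 * (z 1)\<^sup>2 + (z 0)\<^sup>2 * (z 2)\<^sup>2 + (z 0)\<^sup>2 * (z 3)\<^sup>2
     + (z 1)\<^sup>2 * (z 2)\<^sup>2 + (z 1)\<^sup>2 * (z 3)\<^sup>2 + (z 2)\<^sup>2 * (z 3)\<^sup>2)"
    unfolding S_def L_def by (simp add: power2_eq_square algebra_simps)
  show ?thesis unfolding outer apex o a vertex_poly_def by simp
qed

definition mism :: "('a \<Rightarrow> nat) \<Rightarrow> ('a \<Rightarrow> 'a \<Rightarrow> bool) \<Rightarrow> 'a \<Rightarrow> 'a \<Rightarrow> real" where
  "mism \<pi> H x y = of_bool (H x y \<noteq> (\<pi> x \<noteq> \<pi> y))"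

definition mism_deg :: "'a set \<Rightarrow> ('a \<Rightarrow> nat) \<Rightarrow> ('a \<Rightarrow> 'a \<Rightarrow> bool) \<Rightarrow> 'a \<Rightarrow> real" where
  "mism_deg V \<pi> H x = (\<Sum>y\<in>V. mism \<pi> H x y)"

definition mism_total :: "'a set \<Rightarrow> ('a \<Rightarrow> nat) \<Rightarrow> ('a \<Rightarrow> 'a \<Rightarrow> bool) \<Rightarrow> real" where
  "mism_total V \<pi> H = (\<Sum>x\<in>V. mism_deg V \<pi> H x)"

definition reset :: "('a \<Rightarrow> nat) \<Rightarrow> 'a \<Rightarrow> ('a \<Rightarrow> 'a \<Rightarrow> bool) \<Rightarrow> 'a \<Rightarrow> 'a \<Rightarrow> bool" where
  "reset \<pi> v H x y = (if x = v \<or> y = v then \<pi> x \<noteq> \<pi> y else H x y)"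

lemma graph_on_reset:
  assumes "graph_on V H"
  shows "graph_on V (reset \<pi> v H)"
  unfolding graph_on_def
proof (intro conjI ballI)
  have sym: "H x y = H y x" if "x \<in> V" "y \<in> V" for x y
    using assms that unfolding graph_on_def by blast
  show "finite V" "\<And>x. x \<in> V \<Longrightarrow> \<not> reset \<pi> v H x x"
    using assms unfolding graph_on_def reset_def by auto
  show "reset \<pi> v H x y = reset \<pi> v H y x" if "x \<in> V" "y \<in> V" for x y
    using sym[OF that] unfolding reset_def by auto
qed

lemma mism_sym:
  assumes "graph_on V H" "x \<in> V" "y \<in> V"
  shows "mism \<pi> H x y = mism \<pi> H y x"
proof -
  have "H x y = H y x" using assms unfolding graph_on_def by blast
  then show ?thesis by (auto simp: mism_def)
qed

text \<open>\<open>h\<close> counts mismatches at the reset vertex and \<open>k\<close> those among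
  the other four. If \<open>h = 0\<close> the reset changes nothing, and if \<open>k = 0\<close>
  copies coincide with patterns. An error thus arises only when both occur, which makes it second
  order; it is at most 2.\<close>

lemma pattern_difference_le:
  fixes P P' Q Q' :: bool and h k :: real
  assumes "h = 0 \<Longrightarrow> P = P' \<and> Q = Q'" "k = 0 \<Longrightarrow> P = Q \<and> P' = Q'"
    and "h = 0 \<or> 1 \<le> h" "k = 0 \<or> 1 \<le> k"
  shows "of_bool P - of_bool P' \<le> of_bool Q - of_bool Q' + 2 * (h * k)"
proof (cases "h = 0 \<or> k = 0")
  case True
  then show ?thesis using assms(1,2) by auto
next
  case False
  then have "1 * 1 \<le> h * k" using assms(3,4) by (intro mult_mono) auto
  then show ?thesis by (cases P; cases P'; cases Q; cases Q') auto
qed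

lemma
  fixes \<pi> :: "'a \<Rightarrow> nat"
  assumes H: "graph_on V H" and V: "v \<in> V" "p \<in> V" "q \<in> V" "r \<in> V" "s \<in> V"
  defines "f \<equiv> mism \<pi> H v" and "M \<equiv> mism \<pi> H"
  defines "h \<equiv> f p + f q + f r + f s" and "k \<equiv> M p q + M p r + M p s + M q r + M q s + M r s"
  shows outer_difference_le: "of_bool (is_copy H v p q r s) - of_bool (is_copy (reset \<pi> v H) v p q r s) \<le>
      of_bool (outer_pattern \<pi> (H v) p q r s) - of_bool (outer_pattern \<pi> (\<lambda>u. \<pi> v \<noteq> \<pi> u) p q r s) + 2 * (h * k)"
    and apex_difference_le: "of_bool (is_copy H p q r s v) - of_bool (is_copy (reset \<pi> v H) p q r s v) \<le>
      of_bool (apex_pattern \<pi> (H v) p q r s) - of_bool (apex_pattern \<pi> (\<lambda>u. \<pi> v \<noteq> \<pi> u) p q r s) + 2 * (h * k)"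
proof -
  have irr: "\<And>x. x \<in> V \<Longrightarrow> \<not> H x x" and sym: "\<And>x y. x \<in> V \<Longrightarrow> y \<in> V \<Longrightarrow> H x y \<longleftrightarrow> H y x"
    using H unfolding graph_on_def by blast+
  have h: "h = 0 \<or> 1 \<le> h" and k: "k = 0 \<or> 1 \<le> k"
    unfolding h_def k_def f_def M_def mism_def by (simp_all add: of_bool_def)
  have row: "H v x \<longleftrightarrow> \<pi> v \<noteq> \<pi> x" "H x v \<longleftrightarrow> \<pi> v \<noteq> \<pi> x" if "h = 0" "x \<in> {v, p, q, r, s}" for x
  proof -
    have "f p = 0" "f q = 0" "f r = 0" "f s = 0"
      using that(1) unfolding h_def f_def mism_def by (auto simp: of_bool_def split: if_splits)
    then have "H v x \<longleftrightarrow> \<pi> v \<noteq> \<pi> x"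
      using that(2) irr[OF V(1)] unfolding f_def mism_def by auto
    then show "H v x \<longleftrightarrow> \<pi> v \<noteq> \<pi> x" "H x v \<longleftrightarrow> \<pi> v \<noteq> \<pi> x"
      using sym[OF V(1), of x] that(2) V by auto
  qed
  have same: "reset \<pi> v H x y = H x y" if "h = 0" "x \<in> {v, p, q, r, s}" "y \<in> {v, p, q, r, s}" for x y
    using row[OF that(1,2)] row[OF that(1,3)] unfolding reset_def by auto
  have cons: "H x y \<longleftrightarrow> \<pi> x \<noteq> \<pi> y" if "k = 0" "x \<in> {p, q, r, s}" "y \<in> {p, q, r, s}" for x y
  proof -
    have M0: "M p q = 0" "M p r = 0" "M p s = 0" "M q r = 0" "M q s = 0" "M r s = 0"
      using that(1) unfolding k_def M_def mism_def by (auto simp: of_bool_def split: if_splits)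
    have "M y x = M x y" if "x \<in> V" "y \<in> V" for x y unfolding M_def by (rule mism_sym[OF H that(2,1)])
    then have "M q p = 0" "M r p = 0" "M s p = 0" "M r q = 0" "M s q = 0" "M s r = 0"
      using M0 V by auto
    then have "x = y \<or> M x y = 0" using M0 that(2,3) by auto
    then show ?thesis using irr V that(2) unfolding M_def mism_def by auto
  qed
  have cons': "reset \<pi> v H x y \<longleftrightarrow> \<pi> x \<noteq> \<pi> y" if "k = 0" "x \<in> {p, q, r, s}" "y \<in> {p, q, r, s}" for x y
    using cons[OF that] unfolding reset_def by auto
  have rv: "H x v \<longleftrightarrow> H v x" if "x \<in> {p, q, r, s}" for x using sym[OF V(1)] that V by auto
  have rv': "reset \<pi> v H x v \<longleftrightarrow> \<pi> v \<noteq> \<pi> x" "reset \<pi> v H v x \<longleftrightarrow> \<pi> v \<noteq> \<pi> x" for x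
    unfolding reset_def by auto
  show "of_bool (is_copy H v p q r s) - of_bool (is_copy (reset \<pi> v H) v p q r s) \<le>
      of_bool (outer_pattern \<pi> (H v) p q r s) - of_bool (outer_pattern \<pi> (\<lambda>u. \<pi> v \<noteq> \<pi> u) p q r s) + 2 * (h * k)"
  proof (rule pattern_difference_le[OF _ _ h k])
    show "is_copy H v p q r s = is_copy (reset \<pi> v H) v p q r s \<and>
        outer_pattern \<pi> (H v) p q r s = outer_pattern \<pi> (\<lambda>u. \<pi> v \<noteq> \<pi> u) p q r s" if "h = 0"
      unfolding is_copy_def outer_pattern_def using that by (simp add: same row)
    show "is_copy H v p q r s = outer_pattern \<pi> (H v) p q r s \<and>
        is_copy (reset \<pi> v H) v p q r s = outer_pattern \<pi> (\<lambda>u. \<pi> v \<noteq> \<pi> u) p q r s" if "k = 0"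
      unfolding is_copy_def outer_pattern_def using that rv[of s] by (auto simp: cons cons' rv')
  qed
  show "of_bool (is_copy H p q r s v) - of_bool (is_copy (reset \<pi> v H) p q r s v) \<le>
      of_bool (apex_pattern \<pi> (H v) p q r s) - of_bool (apex_pattern \<pi> (\<lambda>u. \<pi> v \<noteq> \<pi> u) p q r s) + 2 * (h * k)"
  proof (rule pattern_difference_le[OF _ _ h k])
    show "is_copy H p q r s v = is_copy (reset \<pi> v H) p q r s v \<and>
        apex_pattern \<pi> (H v) p q r s = apex_pattern \<pi> (\<lambda>u. \<pi> v \<noteq> \<pi> u) p q r s" if "h = 0"
      unfolding is_copy_def apex_pattern_def using that by (simp add: same row)
    show "is_copy H p q r s v = apex_pattern \<pi> (H v) p q r s \<and>
        is_copy (reset \<pi> v H) p q r s v = apex_pattern \<pi> (\<lambda>u. \<pi> v \<noteq> \<pi> u) p q r s" if "k = 0"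
      unfolding is_copy_def apex_pattern_def using that by (auto simp: cons cons' rv')
  qed
qed


text \<open>The first-order change is a difference of two values of \<open>vertex_poly\<close>. For
  the errors, the outer roles contribute \<open>4 * 2\<close> and the apex \<open>2\<close>, each
  times the 12 of \<open>sum4_mult_sum_pairs\<close>: hence 120.\<close>

lemma copies_reset_le:
  fixes \<pi> :: "'a \<Rightarrow> nat"
  assumes H: "graph_on V H" and v: "v \<in> V" and \<pi>: "\<And>u. u \<in> V \<Longrightarrow> \<pi> u < 4"
  defines "n \<equiv> real (card V)"
    and "z \<equiv> part_count V \<pi> (H v)" and "y \<equiv> part_count V \<pi> (\<lambda>u. \<not> H v u)"
    and "z' \<equiv> part_count V \<pi> (\<lambda>u. \<pi> v \<noteq> \<pi> u)" and "y' \<equiv> part_count V \<pi> (\<lambda>u. \<not> \<pi> v \<noteq> \<pi> u)"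
  shows "copies V H - copies V (reset \<pi> v H) \<le>
    vertex_poly (z 0) (z 1) (z 2) (z 3) (y 0) (y 1) (y 2) (y 3)
    - vertex_poly (z' 0) (z' 1) (z' 2) (z' 3) (y' 0) (y' 1) (y' 2) (y' 3)
    + 120 * (n\<^sup>2 * (\<Sum>x\<in>V. mism \<pi> H v x * mism_deg V \<pi> H x))
    + 120 * (n * (mism_deg V \<pi> H v * mism_total V \<pi> H)) + 10 * n ^ 3"
proof -
  have fin: "finite V" using H by (simp add: graph_on_def)
  define f M where "f = mism \<pi> H v" and "M = mism \<pi> H"
  define bad where "bad = (\<lambda>p q r s. (f p + f q + f r + f s) * (M p q + M p r + M p s + M q r + M q s + M r s))"
  define B where "B = 12 * (n\<^sup>2 * (\<Sum>x\<in>V. mism \<pi> H v x * mism_deg V \<pi> H x)) + 12 * (n * (mism_deg V \<pi> H v * mism_total V \<pi> H))"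
  have "sum4 V (\<lambda>p q r s. bad p q r s) = sum4 V (\<lambda>p q r s. f p * M p q + f q * M p q + f r * M p q + f s * M p q
    + f p * M p r + f q * M p r + f r * M p r + f s * M p r
    + f p * M p s + f q * M p s + f r * M p s + f s * M p s
    + f p * M q r + f q * M q r + f r * M q r + f s * M q r
    + f p * M q s + f q * M q s + f r * M q s + f s * M q s
    + f p * M r s + f q * M r s + f r * M r s + f s * M r s)"
    unfolding bad_def by (intro sum.cong refl) (simp add: algebra_simps)
  also have "\<dots> = B"
    by (subst sum4_mult_sum_pairs) (use mism_sym[OF H] in \<open>auto simp: M_def f_def B_def n_def mism_deg_def mism_total_def\<close>)
  finally have bad: "sum4 V (\<lambda>p q r s. bad p q r s) = B" .
  define N where "N = (\<lambda>u. \<pi> v \<noteq> \<pi> u)"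
  have "copies_outer V H v - copies_outer V (reset \<pi> v H) v \<le> sum4 V (\<lambda>p q r s. of_bool (outer_pattern \<pi> (H v) p q r s) - of_bool (outer_pattern \<pi> N p q r s) + 2 * bad p q r s)"
    unfolding copies_outer_def sum_subtractf[symmetric]
    by (intro sum_mono) (use outer_difference_le[OF H v] in \<open>simp add: bad_def f_def M_def N_def\<close>)
  also have "\<dots> = sum4 V (\<lambda>p q r s. of_bool (outer_pattern \<pi> (H v) p q r s))
    - sum4 V (\<lambda>p q r s. of_bool (outer_pattern \<pi> N p q r s)) + 2 * B"
    unfolding bad[symmetric] by (simp only: sum.distrib sum_subtractf sum_distrib_left)
  finally have outer: "copies_outer V H v - copies_outer V (reset \<pi> v H) v \<le> \<dots>" .
  have "copies_apex V H v - copies_apex V (reset \<pi> v H) v \<le> sum4 V (\<lambda>p q r s. of_bool (apex_pattern \<pi> (H v) p q r s) - of_bool (apex_pattern \<pi> N p q r s) + 2 * bad p q r s)"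
    unfolding copies_apex_def sum_subtractf[symmetric]
    by (intro sum_mono) (use apex_difference_le[OF H v] in \<open>simp add: bad_def f_def M_def N_def\<close>)
  also have "\<dots> = sum4 V (\<lambda>p q r s. of_bool (apex_pattern \<pi> (H v) p q r s))
    - sum4 V (\<lambda>p q r s. of_bool (apex_pattern \<pi> N p q r s)) + 2 * B"
    unfolding bad[symmetric] by (simp only: sum.distrib sum_subtractf sum_distrib_left)
  finally have apex: "copies_apex V H v - copies_apex V (reset \<pi> v H) v \<le> \<dots>" .
  have total: "copies V H - copies V (reset \<pi> v H) \<le> 4 * (copies_outer V H v - copies_outer V (reset \<pi> v H) v)
    + (copies_apex V H v - copies_apex V (reset \<pi> v H) v) + 10 * n ^ 3"
    unfolding n_def by (rule copies_diff_le[OF H graph_on_reset[OF H] v]) (simp add: reset_def)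
  have pats: "4 * sum4 V (\<lambda>p q r s. of_bool (outer_pattern \<pi> (H v) p q r s))
      + sum4 V (\<lambda>p q r s. of_bool (apex_pattern \<pi> (H v) p q r s))
    = vertex_poly (z 0) (z 1) (z 2) (z 3) (y 0) (y 1) (y 2) (y 3)"
    unfolding z_def y_def by (rule sum_patterns[OF fin]) (rule \<pi>)
  have pats': "4 * sum4 V (\<lambda>p q r s. of_bool (outer_pattern \<pi> N p q r s))
      + sum4 V (\<lambda>p q r s. of_bool (apex_pattern \<pi> N p q r s))
    = vertex_poly (z' 0) (z' 1) (z' 2) (z' 3) (y' 0) (y' 1) (y' 2) (y' 3)"
    unfolding z'_def y'_def N_def by (rule sum_patterns[OF fin]) (rule \<pi>)
  have combine: "c \<le> p1 - p2 + 10 * b + t"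
    if "c \<le> 4 * x + w + t" "x \<le> o1 - o2 + 2 * b" "w \<le> a1 - a2 + 2 * b" "4 * o1 + a1 = p1" "4 * o2 + a2 = p2"
    for c x w t o1 o2 a1 a2 b p1 p2 :: real
    using that by linarith
  show ?thesis
    using combine[OF total outer apex pats pats'] unfolding B_def by (simp add: algebra_simps)
qed

section \<open>First-order gain of a reset\<close>

definition inside_deg :: "'a set \<Rightarrow> ('a \<Rightarrow> nat) \<Rightarrow> ('a \<Rightarrow> 'a \<Rightarrow> bool) \<Rightarrow> 'a \<Rightarrow> real" where
  "inside_deg V \<pi> H v = (\<Sum>u\<in>V. of_bool (\<pi> v = \<pi> u \<and> H v u))"

definition cross_codeg :: "'a set \<Rightarrow> ('a \<Rightarrow> nat) \<Rightarrow> ('a \<Rightarrow> 'a \<Rightarrow> bool) \<Rightarrow> 'a \<Rightarrow> real" where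
  "cross_codeg V \<pi> H v = (\<Sum>u\<in>V. of_bool (\<pi> v \<noteq> \<pi> u \<and> \<not> H v u))"

abbreviation inside_total :: "'a set \<Rightarrow> ('a \<Rightarrow> nat) \<Rightarrow> ('a \<Rightarrow> 'a \<Rightarrow> bool) \<Rightarrow> real" where
  "inside_total V \<pi> H \<equiv> (\<Sum>v\<in>V. inside_deg V \<pi> H v)"

abbreviation cross_total :: "'a set \<Rightarrow> ('a \<Rightarrow> nat) \<Rightarrow> ('a \<Rightarrow> 'a \<Rightarrow> bool) \<Rightarrow> real" where
  "cross_total V \<pi> H \<equiv> (\<Sum>v\<in>V. cross_codeg V \<pi> H v)"

abbreviation part_size :: "'a set \<Rightarrow> ('a \<Rightarrow> nat) \<Rightarrow> nat \<Rightarrow> real" where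
  "part_size V \<pi> \<equiv> part_count V \<pi> (\<lambda>_. True)"

lemma mism_deg_eq: "mism_deg V \<pi> H v = inside_deg V \<pi> H v + cross_codeg V \<pi> H v"
  unfolding mism_deg_def inside_deg_def cross_codeg_def sum.distrib[symmetric] mism_def
  by (rule sum.cong[OF refl]) (auto simp: of_bool_def)

lemma mism_total_eq: "mism_total V \<pi> H = inside_total V \<pi> H + cross_total V \<pi> H"
  unfolding mism_total_def mism_deg_eq sum.distrib ..

lemma part_count_compl: "part_count V \<pi> (\<lambda>u. \<not> P u) j = part_size V \<pi> j - part_count V \<pi> P j"
  unfolding part_count_def sum_subtractf[symmetric] by (rule sum.cong[OF refl]) auto

lemma part_count_nonneg: "0 \<le> part_count V \<pi> P j"
  unfolding part_count_def by (simp add: sum_nonneg)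

lemma part_count_le: "part_count V \<pi> P j \<le> part_size V \<pi> j"
  unfolding part_count_def by (rule sum_mono) auto

lemma part_count_own:
  "part_count V \<pi> (\<lambda>u. i \<noteq> \<pi> u) j = (if j = i then 0 else part_size V \<pi> j)"
  unfolding part_count_def by (auto intro!: sum.neutral sum.cong)

lemma inside_deg_eq: "inside_deg V \<pi> H v = part_count V \<pi> (H v) (\<pi> v)"
  unfolding inside_deg_def part_count_def by (rule sum.cong[OF refl]) auto

lemma cross_codeg_eq:
  assumes "finite V" "\<And>v. v \<in> V \<Longrightarrow> \<pi> v < (4::nat)"
  shows "cross_codeg V \<pi> H v = (\<Sum>j\<in>{0,1,2,3} - {\<pi> v}. part_size V \<pi> j - part_count V \<pi> (H v) j)"
proof -
  have "cross_codeg V \<pi> H v = (\<Sum>u\<in>V. of_bool (\<not> H v u) * of_bool (\<pi> v \<noteq> \<pi> u))"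
    unfolding cross_codeg_def by (rule sum.cong[OF refl]) auto
  also have "\<dots> = part_count V \<pi> (\<lambda>u. \<not> H v u) 0 * of_bool (\<pi> v \<noteq> 0) + part_count V \<pi> (\<lambda>u. \<not> H v u) 1 * of_bool (\<pi> v \<noteq> 1)
    + part_count V \<pi> (\<lambda>u. \<not> H v u) 2 * of_bool (\<pi> v \<noteq> 2) + part_count V \<pi> (\<lambda>u. \<not> H v u) 3 * of_bool (\<pi> v \<noteq> 3)"
    by (rule sum_by_part[where F = "\<lambda>j. of_bool (\<pi> v \<noteq> j)"]) (use assms in auto)
  also have "\<dots> = (\<Sum>j\<in>{0,1,2,3} - {\<pi> v}. part_size V \<pi> j - part_count V \<pi> (H v) j)"
    unfolding part_count_compl by (auto simp: insert_Diff_if)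
  finally show ?thesis .
qed

lemma vertex_poly_homogeneous:
  "vertex_poly (t * z1) (t * z2) (t * z3) (t * z4) (t * n1) (t * n2) (t * n3) (t * n4) =
    t ^ 4 * vertex_poly z1 z2 z3 z4 n1 n2 n3 n4"
  by (simp add: vertex_poly_def sq_lin3_def algebra_simps power_numeral_reduce)

lemma vertex_poly_le_scaled:
  fixes x1 x2 x3 x4 z1 z2 z3 z4 n :: real
  assumes n: "0 < n"
    and x: "\<bar>x1 - n / 4\<bar> \<le> n / 1000" "\<bar>x2 - n / 4\<bar> \<le> n / 1000" "\<bar>x3 - n / 4\<bar> \<le> n / 1000" "\<bar>x4 - n / 4\<bar> \<le> n / 1000"
    and z: "0 \<le> z1" "z1 \<le> x1" "0 \<le> z2" "z2 \<le> x2" "0 \<le> z3" "z3 \<le> x3" "0 \<le> z4" "z4 \<le> x4"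
    and least: "z1 \<le> z2 + n / 500" "z1 \<le> z3 + n / 500" "z1 \<le> z4 + n / 500"
  shows "vertex_poly z1 z2 z3 z4 (x1 - z1) (x2 - z2) (x3 - z3) (x4 - z4)
    \<le> vertex_poly 0 x2 x3 x4 x1 0 0 0 - n ^ 3 * (3/16 * z1 + 1/16 * ((x2 - z2) + (x3 - z3) + (x4 - z4)))"
proof -
  have sc: "n * (a / n) = a" "n * (a / n - b / n) = a - b" for a b using n by (auto simp: field_simps)
  have "vertex_poly (z1/n) (z2/n) (z3/n) (z4/n) (x1/n - z1/n) (x2/n - z2/n) (x3/n - z3/n) (x4/n - z4/n)
    \<le> vertex_poly 0 (x2/n) (x3/n) (x4/n) (x1/n) 0 0 0
      - 3/16 * (z1/n) - 1/16 * ((x2/n - z2/n) + (x3/n - z3/n) + (x4/n - z4/n))"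
  proof (rule vertex_poly_le)
    have "\<bar>a / n - 1/4\<bar> \<le> 1/1000" if "\<bar>a - n / 4\<bar> \<le> n / 1000" for a
      using that n by (simp add: abs_le_iff field_simps)
    then show "\<bar>x1/n - 1/4\<bar> \<le> 1/1000" "\<bar>x2/n - 1/4\<bar> \<le> 1/1000" "\<bar>x3/n - 1/4\<bar> \<le> 1/1000" "\<bar>x4/n - 1/4\<bar> \<le> 1/1000"
      using x by blast+
    have "a / n \<le> b / n + 1/500" if "a \<le> b + n / 500" for a b
      using that n by (simp add: field_simps)
    then show "z1/n \<le> z2/n + 1/500" "z1/n \<le> z3/n + 1/500" "z1/n \<le> z4/n + 1/500" using least by blast+
  qed (use n z in \<open>auto intro: divide_right_mono\<close>)
  from mult_left_mono[OF this, of "n ^ 4"] n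
  have "n ^ 4 * vertex_poly (z1/n) (z2/n) (z3/n) (z4/n) (x1/n - z1/n) (x2/n - z2/n) (x3/n - z3/n) (x4/n - z4/n)
    \<le> n ^ 4 * vertex_poly 0 (x2/n) (x3/n) (x4/n) (x1/n) 0 0 0
      - n ^ 4 * (3/16 * (z1/n) + 1/16 * ((x2/n - z2/n) + (x3/n - z3/n) + (x4/n - z4/n)))"
    by (simp add: algebra_simps)
  also have "n ^ 4 * (3/16 * (z1/n) + 1/16 * ((x2/n - z2/n) + (x3/n - z3/n) + (x4/n - z4/n)))
    = n ^ 3 * (3/16 * z1 + 1/16 * ((x2 - z2) + (x3 - z3) + (x4 - z4)))"
    using n by (simp add: power_numeral_reduce field_simps)
  finally show ?thesis
    unfolding vertex_poly_homogeneous[symmetric] sc by simp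
qed

text \<open>A reset moves \<open>v\<close> to the corner at which \<open>vertex_poly_le\<close> is
  attained, once the symmetries of \<open>vertex_poly\<close> have put the part of \<open>v\<close>
  first. The inequality therefore reads off the gain directly.\<close>

lemma copies_reset_gain:
  fixes \<pi> :: "'a \<Rightarrow> nat"
  assumes H: "graph_on V H" and v: "v \<in> V" and \<pi>: "\<And>u. u \<in> V \<Longrightarrow> \<pi> u < 4"
  defines "n \<equiv> real (card V)"
  assumes size: "\<And>j. j < 4 \<Longrightarrow> \<bar>part_size V \<pi> j - n / 4\<bar> \<le> n / 1000"
    and least: "\<And>j. j < 4 \<Longrightarrow> inside_deg V \<pi> H v \<le> part_count V \<pi> (H v) j + n / 500"
  shows "copies V H \<le> copies V (reset \<pi> v H) - n ^ 3 * (3/16 * inside_deg V \<pi> H v + 1/16 * cross_codeg V \<pi> H v)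
    + 120 * (n\<^sup>2 * (\<Sum>x\<in>V. mism \<pi> H v x * mism_deg V \<pi> H x))
    + 120 * (n * (mism_deg V \<pi> H v * mism_total V \<pi> H)) + 10 * n ^ 3"
proof -
  have fin: "finite V" using H by (simp add: graph_on_def)
  then have n: "0 < n" using v unfolding n_def by (auto simp: card_gt_0_iff)
  define z where "z = part_count V \<pi> (H v)"
  define x where "x = part_size V \<pi>"
  have z: "0 \<le> z j" "z j \<le> x j" for j
    unfolding z_def x_def by (rule part_count_nonneg part_count_le)+
  have sz: "\<bar>x 0 - n / 4\<bar> \<le> n / 1000" "\<bar>x 1 - n / 4\<bar> \<le> n / 1000" "\<bar>x 2 - n / 4\<bar> \<le> n / 1000" "\<bar>x 3 - n / 4\<bar> \<le> n / 1000"
    unfolding x_def by (rule size; simp)+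
  have ls: "z (\<pi> v) \<le> z 0 + n / 500" "z (\<pi> v) \<le> z 1 + n / 500" "z (\<pi> v) \<le> z 2 + n / 500" "z (\<pi> v) \<le> z 3 + n / 500"
    using least[of 0] least[of 1] least[of 2] least[of 3] unfolding z_def inside_deg_eq by auto
  have "vertex_poly (z 0) (z 1) (z 2) (z 3) (x 0 - z 0) (x 1 - z 1) (x 2 - z 2) (x 3 - z 3)
    \<le> (let w = (\<lambda>j. if j = \<pi> v then 0 else x j) in vertex_poly (w 0) (w 1) (w 2) (w 3) (x 0 - w 0) (x 1 - w 1) (x 2 - w 2) (x 3 - w 3))
     - n ^ 3 * (3/16 * z (\<pi> v) + 1/16 * (\<Sum>j\<in>{0,1,2,3} - {\<pi> v}. x j - z j))"
  proof -
    have "\<pi> v < 4" by (rule \<pi>[OF v])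
    then consider "\<pi> v = 0" | "\<pi> v = 1" | "\<pi> v = 2" | "\<pi> v = 3" by linarith
    then show ?thesis
    proof cases
      case 1
      have "vertex_poly (z 0) (z 1) (z 2) (z 3) (x 0 - z 0) (x 1 - z 1) (x 2 - z 2) (x 3 - z 3)
        \<le> vertex_poly 0 (x 1) (x 2) (x 3) (x 0) 0 0 0 - n ^ 3 * (3/16 * z 0 + 1/16 * ((x 1 - z 1) + (x 2 - z 2) + (x 3 - z 3)))"
        by (rule vertex_poly_le_scaled[OF n]) (use sz z ls 1 in auto)
      then show ?thesis
        using 1 by (simp add: Let_def insert_Diff_if algebra_simps)
    next
      case 2
      have "vertex_poly (z 1) (z 0) (z 2) (z 3) (x 1 - z 1) (x 0 - z 0) (x 2 - z 2) (x 3 - z 3)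
        \<le> vertex_poly 0 (x 0) (x 2) (x 3) (x 1) 0 0 0 - n ^ 3 * (3/16 * z 1 + 1/16 * ((x 0 - z 0) + (x 2 - z 2) + (x 3 - z 3)))"
        by (rule vertex_poly_le_scaled[OF n]) (use sz z ls 2 in auto)
      then show ?thesis
        using 2 vertex_poly_swap(1)[of "z 0" "z 1"] vertex_poly_swap(1)[of "x 0" 0]
        by (simp add: Let_def insert_Diff_if algebra_simps)
    next
      case 3
      have "vertex_poly (z 2) (z 1) (z 0) (z 3) (x 2 - z 2) (x 1 - z 1) (x 0 - z 0) (x 3 - z 3)
        \<le> vertex_poly 0 (x 1) (x 0) (x 3) (x 2) 0 0 0 - n ^ 3 * (3/16 * z 2 + 1/16 * ((x 1 - z 1) + (x 0 - z 0) + (x 3 - z 3)))"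
        by (rule vertex_poly_le_scaled[OF n]) (use sz z ls 3 in auto)
      then show ?thesis
        using 3 vertex_poly_swap(2)[of "z 0" "z 1" "z 2"] vertex_poly_swap(2)[of "x 0" "x 1" 0]
        by (simp add: Let_def insert_Diff_if algebra_simps)
    next
      case 4
      have "vertex_poly (z 3) (z 1) (z 2) (z 0) (x 3 - z 3) (x 1 - z 1) (x 2 - z 2) (x 0 - z 0)
        \<le> vertex_poly 0 (x 1) (x 2) (x 0) (x 3) 0 0 0 - n ^ 3 * (3/16 * z 3 + 1/16 * ((x 1 - z 1) + (x 2 - z 2) + (x 0 - z 0)))"
        by (rule vertex_poly_le_scaled[OF n]) (use sz z ls 4 in auto)
      then show ?thesis
        using 4 vertex_poly_swap(3)[of "z 0" "z 1" "z 2" "z 3"] vertex_poly_swap(3)[of "x 0" "x 1" "x 2" 0]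
        by (simp add: Let_def insert_Diff_if algebra_simps)
    qed
  qed
  note bound = this
  have cc: "cross_codeg V \<pi> H v = (\<Sum>j\<in>{0,1,2,3} - {\<pi> v}. x j - z j)"
    unfolding x_def z_def by (rule cross_codeg_eq[OF fin]) (rule \<pi>)
  have main: "vertex_poly (z 0) (z 1) (z 2) (z 3) (x 0 - z 0) (x 1 - z 1) (x 2 - z 2) (x 3 - z 3)
    \<le> vertex_poly (w 0) (w 1) (w 2) (w 3) (x 0 - w 0) (x 1 - w 1) (x 2 - w 2) (x 3 - w 3)
     - n ^ 3 * (3/16 * inside_deg V \<pi> H v + 1/16 * cross_codeg V \<pi> H v)"
    if "w = (\<lambda>j. if j = \<pi> v then 0 else x j)" for w
    using bound unfolding inside_deg_eq z_def[symmetric] cc that Let_def .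
  have step: "copies V H - copies V (reset \<pi> v H) \<le>
    vertex_poly (z 0) (z 1) (z 2) (z 3) (x 0 - z 0) (x 1 - z 1) (x 2 - z 2) (x 3 - z 3)
    - vertex_poly (w 0) (w 1) (w 2) (w 3) (x 0 - w 0) (x 1 - w 1) (x 2 - w 2) (x 3 - w 3)
    + 120 * (n\<^sup>2 * (\<Sum>x\<in>V. mism \<pi> H v x * mism_deg V \<pi> H x))
    + 120 * (n * (mism_deg V \<pi> H v * mism_total V \<pi> H)) + 10 * n ^ 3"
    if w: "w = part_count V \<pi> (\<lambda>u. \<pi> v \<noteq> \<pi> u)" for w
    unfolding z_def x_def w part_count_compl[symmetric] n_def by (rule copies_reset_le[OF H v]) (rule \<pi>)
  have w: "part_count V \<pi> (\<lambda>u. \<pi> v \<noteq> \<pi> u) = (\<lambda>j. if j = \<pi> v then 0 else x j)"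
    unfolding x_def by (rule ext) (rule part_count_own)
  have combine: "c - c' \<le> p - q + r + s + t \<Longrightarrow> p \<le> q - u \<Longrightarrow> c \<le> c' - u + r + s + t" for c c' p q r s t u :: real
    by linarith
  show ?thesis by (rule combine[OF step[OF refl] main[OF w]])
qed

section \<open>Resetting all vertices in succession\<close>

definition reset_set :: "('a \<Rightarrow> nat) \<Rightarrow> 'a set \<Rightarrow> ('a \<Rightarrow> 'a \<Rightarrow> bool) \<Rightarrow> 'a \<Rightarrow> 'a \<Rightarrow> bool" where
  "reset_set \<pi> X H x y = (if x \<in> X \<or> y \<in> X then \<pi> x \<noteq> \<pi> y else H x y)"

lemma reset_set_insert: "reset_set \<pi> (insert v X) H = reset \<pi> v (reset_set \<pi> X H)"
  by (auto simp: reset_set_def reset_def fun_eq_iff)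

lemma reset_set_empty: "reset_set \<pi> {} H = H"
  by (simp add: reset_set_def fun_eq_iff)

lemma graph_on_reset_set:
  assumes "graph_on V H"
  shows "graph_on V (reset_set \<pi> X H)"
  unfolding graph_on_def
proof (intro conjI ballI)
  have sym: "H x y = H y x" if "x \<in> V" "y \<in> V" for x y
    using assms that unfolding graph_on_def by blast
  show "finite V" "\<And>x. x \<in> V \<Longrightarrow> \<not> reset_set \<pi> X H x x"
    using assms unfolding graph_on_def reset_set_def by auto
  show "reset_set \<pi> X H x y = reset_set \<pi> X H y x" if "x \<in> V" "y \<in> V" for x y
    using sym[OF that] unfolding reset_set_def by auto
qed

lemma sum_remove_row_column:
  fixes g :: "'a \<Rightarrow> 'a \<Rightarrow> real"
  assumes "finite V" "v \<in> V" "\<And>x y. x \<in> V \<Longrightarrow> y \<in> V \<Longrightarrow> g x y = g y x" "g v v = 0"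
  shows "(\<Sum>x\<in>V. \<Sum>y\<in>V. g x y) = (\<Sum>x\<in>V. \<Sum>y\<in>V. if x = v \<or> y = v then 0 else g x y) + 2 * (\<Sum>y\<in>V. g v y)"
proof -
  have "(\<Sum>x\<in>V. \<Sum>y\<in>V. g x y) = (\<Sum>x\<in>V. \<Sum>y\<in>V. (if x = v \<or> y = v then 0 else g x y)
    + of_bool (x = v) * g v y + of_bool (y = v) * g x v)"
    by (intro sum.cong refl) (use assms(4) in auto)
  also have "\<dots> = (\<Sum>x\<in>V. \<Sum>y\<in>V. if x = v \<or> y = v then 0 else g x y) + (\<Sum>y\<in>V. g v y) + (\<Sum>x\<in>V. g x v)"
    unfolding sum.distrib sum_of_bool_eq_mult[OF assms(1,2)] sum_distrib_left[symmetric] ..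
  also have "(\<Sum>x\<in>V. g x v) = (\<Sum>y\<in>V. g v y)" by (rule sum.cong[OF refl]) (use assms in auto)
  finally show ?thesis by simp
qed

lemma
  assumes H: "graph_on V H" and v: "v \<in> V"
  shows inside_total_reset: "inside_total V \<pi> H = inside_total V \<pi> (reset \<pi> v H) + 2 * inside_deg V \<pi> H v"
    and cross_total_reset: "cross_total V \<pi> H = cross_total V \<pi> (reset \<pi> v H) + 2 * cross_codeg V \<pi> H v"
proof -
  have fin: "finite V" and irr: "\<not> H v v" using H v unfolding graph_on_def by blast+
  have sym: "H x y = H y x" if "x \<in> V" "y \<in> V" for x y
    using H that unfolding graph_on_def by blast
  have "inside_total V \<pi> H = (\<Sum>x\<in>V. \<Sum>y\<in>V. if x = v \<or> y = v then 0 else of_bool (\<pi> x = \<pi> y \<and> H x y)) + 2 * (\<Sum>y\<in>V. of_bool (\<pi> v = \<pi> y \<and> H v y))"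
    unfolding inside_deg_def
  proof (rule sum_remove_row_column[OF fin v])
    show "of_bool (\<pi> x = \<pi> y \<and> H x y) = (of_bool (\<pi> y = \<pi> x \<and> H y x) :: real)" if "x \<in> V" "y \<in> V" for x y
      using sym[OF that] by auto
  qed (use irr in simp)
  also have "(\<Sum>x\<in>V. \<Sum>y\<in>V. if x = v \<or> y = v then 0 else of_bool (\<pi> x = \<pi> y \<and> H x y)) = inside_total V \<pi> (reset \<pi> v H)"
    unfolding inside_deg_def reset_def by (intro sum.cong refl) auto
  finally show "inside_total V \<pi> H = inside_total V \<pi> (reset \<pi> v H) + 2 * inside_deg V \<pi> H v"
    unfolding inside_deg_def .
  have "cross_total V \<pi> H = (\<Sum>x\<in>V. \<Sum>y\<in>V. if x = v \<or> y = v then 0 else of_bool (\<pi> x \<noteq> \<pi> y \<and> \<not> H x y)) + 2 * (\<Sum>y\<in>V. of_bool (\<pi> v \<noteq> \<pi> y \<and> \<not> H v y))"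
    unfolding cross_codeg_def
  proof (rule sum_remove_row_column[OF fin v])
    show "of_bool (\<pi> x \<noteq> \<pi> y \<and> \<not> H x y) = (of_bool (\<pi> y \<noteq> \<pi> x \<and> \<not> H y x) :: real)" if "x \<in> V" "y \<in> V" for x y
      using sym[OF that] by auto
  qed simp
  also have "(\<Sum>x\<in>V. \<Sum>y\<in>V. if x = v \<or> y = v then 0 else of_bool (\<pi> x \<noteq> \<pi> y \<and> \<not> H x y)) = cross_total V \<pi> (reset \<pi> v H)"
    unfolding cross_codeg_def reset_def by (intro sum.cong refl) auto
  finally show "cross_total V \<pi> H = cross_total V \<pi> (reset \<pi> v H) + 2 * cross_codeg V \<pi> H v"
    unfolding cross_codeg_def .
qed

lemma sum_chain_le:
  fixes \<Psi> :: "'a set \<Rightarrow> real"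
  assumes "finite Y" "X \<inter> Y = {}"
    and "\<And>Z v. Z \<subseteq> Y \<Longrightarrow> v \<in> Y \<Longrightarrow> v \<notin> Z \<Longrightarrow> \<Psi> (X \<union> Z) \<le> \<Psi> (insert v (X \<union> Z)) + e v"
  shows "\<Psi> X \<le> \<Psi> (X \<union> Y) + (\<Sum>v\<in>Y. e v)"
  using assms
proof (induction Y rule: finite_induct)
  case (insert v Y)
  have "\<Psi> X \<le> \<Psi> (X \<union> Y) + (\<Sum>v\<in>Y. e v)" using insert by (intro insert.IH) auto
  moreover have "\<Psi> (X \<union> Y) \<le> \<Psi> (insert v (X \<union> Y)) + e v" using insert by (intro insert.prems(2)) auto
  ultimately show ?case using insert.hyps by simp
qed simp

lemma mism_nonneg: "0 \<le> mism \<pi> H x y" and mism_le_1: "mism \<pi> H x y \<le> 1"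
  by (simp_all add: mism_def)

lemma mism_deg_nonneg: "0 \<le> mism_deg V \<pi> H x"
  unfolding mism_deg_def by (simp add: sum_nonneg mism_nonneg)

lemma mism_reset_set_le: "mism \<pi> (reset_set \<pi> X H) x y \<le> mism \<pi> H x y"
  by (simp add: mism_def reset_set_def)

lemma mism_deg_reset_set_le: "mism_deg V \<pi> (reset_set \<pi> X H) x \<le> mism_deg V \<pi> H x"
  unfolding mism_deg_def by (rule sum_mono) (rule mism_reset_set_le)

lemma mism_deg_reset_set_member: "x \<in> X \<Longrightarrow> mism_deg V \<pi> (reset_set \<pi> X H) x = 0"
  by (simp add: mism_deg_def mism_def reset_set_def)

lemma mism_total_reset_set_le: "mism_total V \<pi> (reset_set \<pi> X H) \<le> mism_total V \<pi> H"
  unfolding mism_total_def by (rule sum_mono) (rule mism_deg_reset_set_le)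

text \<open>Vertices with many mismatches are reset first: there are few of them, and once they are gone
  the mismatches seen by any later vertex lie at vertices of small mismatch degree, so that the
  second-order errors are dominated by the first-order gain.\<close>

lemma copies_le_partition:
  fixes \<pi> :: "'a \<Rightarrow> nat"
  assumes A: "graph_on V A" and \<pi>: "\<And>u. u \<in> V \<Longrightarrow> \<pi> u < 4" and ne: "V \<noteq> {}"
  defines "n \<equiv> real (card V)"
  assumes size: "\<And>j. j < 4 \<Longrightarrow> \<bar>part_size V \<pi> j - n / 4\<bar> \<le> n / 1000"
    and least: "\<And>v j. v \<in> V \<Longrightarrow> j < 4 \<Longrightarrow> inside_deg V \<pi> A v \<le> part_count V \<pi> (A v) j + n / 500"
    and few: "mism_total V \<pi> A \<le> n\<^sup>2 / 25000\<^sup>2"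
  shows "copies V A \<le> copies V (\<lambda>x y. \<pi> x \<noteq> \<pi> y) - n ^ 3 * inside_total V \<pi> A / 16 - n ^ 3 * mism_total V \<pi> A / 64 + 10 * n ^ 4"
proof -
  have fin: "finite V" using A by (simp add: graph_on_def)
  then have n: "0 < n" using ne unfolding n_def by (auto simp: card_gt_0_iff)
  define R where "R = (\<lambda>X. reset_set \<pi> X A)"
  \<comment> \<open>Each mismatched pair is counted at both ends in the totals, so the coefficients
    are half of the gains \<open>3/16\<close> and \<open>1/16\<close> per reset; first-order terms
    then cancel along the chain.\<close>
  define \<Psi> where "\<Psi> = (\<lambda>X. copies V (R X) + n ^ 3 * (3/32 * inside_total V \<pi> (R X) + 1/32 * cross_total V \<pi> (R X)))"
  define D where "D = mism_total V \<pi> A"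
  define m where "m = mism_deg V \<pi> A"
  define \<beta> where "\<beta> = (1 / 25000 :: real)"
  define B where "B = {v \<in> V. \<beta> * n \<le> m v}"
  have m0: "0 \<le> m v" for v unfolding m_def by (rule mism_deg_nonneg)
  have Dm: "D = (\<Sum>v\<in>V. m v)" unfolding D_def m_def mism_total_def ..
  have D0: "0 \<le> D" unfolding Dm by (simp add: sum_nonneg m0)
  have gR: "graph_on V (R X)" for X unfolding R_def by (rule graph_on_reset_set[OF A])
  have step: "\<Psi> X \<le> \<Psi> (insert v X) + (120 * (n\<^sup>2 * (\<Sum>x\<in>V. mism \<pi> (R X) v x * mism_deg V \<pi> (R X) x)) + 120 * (n * (m v * D)) + 10 * n ^ 3)"
    if v: "v \<in> V" "v \<notin> X" for X v
  proof -
    have "copies V (R X) \<le> copies V (reset \<pi> v (R X)) - n ^ 3 * (3/16 * inside_deg V \<pi> (R X) v + 1/16 * cross_codeg V \<pi> (R X) v)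
    + 120 * (n\<^sup>2 * (\<Sum>x\<in>V. mism \<pi> (R X) v x * mism_deg V \<pi> (R X) x))
    + 120 * (n * (mism_deg V \<pi> (R X) v * mism_total V \<pi> (R X))) + 10 * n ^ 3"
      unfolding n_def
    proof (rule copies_reset_gain[OF gR v(1)])
      show "\<bar>part_size V \<pi> j - real (card V) / 4\<bar> \<le> real (card V) / 1000" if "j < 4" for j
        using size[OF that] unfolding n_def .
      \<comment> \<open>Earlier resets can only remove neighbours of \<open>v\<close> from its own
        part and add neighbours in the others, so the hypothesis \<open>least\<close>
        survives.\<close>
      have le: "inside_deg V \<pi> (R X) v \<le> inside_deg V \<pi> A v"
        unfolding inside_deg_def by (rule sum_mono) (use v in \<open>auto simp: R_def reset_set_def\<close>)
      show "inside_deg V \<pi> (R X) v \<le> part_count V \<pi> (R X v) j + real (card V) / 500" if j: "j < 4" for j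
      proof (cases "j = \<pi> v")
        case True
        then show ?thesis by (simp add: inside_deg_eq)
      next
        case False
        then have "part_count V \<pi> (A v) j \<le> part_count V \<pi> (R X v) j"
          unfolding part_count_def by (intro sum_mono) (auto simp: R_def reset_set_def)
        then show ?thesis using le least[OF v(1) j] unfolding n_def by linarith
      qed
    qed (rule \<pi>)
    moreover have "reset \<pi> v (R X) = R (insert v X)" unfolding R_def reset_set_insert ..
    moreover have "mism_deg V \<pi> (R X) v * mism_total V \<pi> (R X) \<le> m v * D"
      unfolding m_def D_def R_def
      by (intro mult_mono mism_deg_reset_set_le mism_total_reset_set_le mism_deg_nonneg)
         (simp add: mism_total_def sum_nonneg mism_deg_nonneg)
    then have "n * (mism_deg V \<pi> (R X) v * mism_total V \<pi> (R X)) \<le> n * (m v * D)" using n by simp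
    moreover note inside_total_reset[OF gR v(1), of \<pi> X] cross_total_reset[OF gR v(1), of \<pi> X]
    ultimately show ?thesis
      unfolding \<Psi>_def by (simp add: algebra_simps)
  qed
  \<comment> \<open>Here the mismatch indicators are bounded crudely by 1. The cost
    \<open>n^2 D\<close> per vertex is affordable because \<open>B\<close> has at most
    \<open>\<beta> * n\<close> elements.\<close>
  have phase1: "\<Psi> {} \<le> \<Psi> ({} \<union> B) + (\<Sum>v\<in>B. 120 * (n\<^sup>2 * D) + 120 * (n * (m v * D)) + 10 * n ^ 3)"
  proof (rule sum_chain_le)
    show "finite B" using fin by (simp add: B_def)
    fix Z v assume Z: "Z \<subseteq> B" "v \<in> B" "v \<notin> Z"
    have "(\<Sum>x\<in>V. mism \<pi> (R Z) v x * mism_deg V \<pi> (R Z) x) \<le> (\<Sum>x\<in>V. 1 * m x)"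
      unfolding m_def R_def
      by (intro sum_mono mult_mono mism_le_1 mism_deg_reset_set_le mism_deg_nonneg) simp
    also have "\<dots> = D" by (simp add: Dm)
    finally have "n\<^sup>2 * (\<Sum>x\<in>V. mism \<pi> (R Z) v x * mism_deg V \<pi> (R Z) x) \<le> n\<^sup>2 * D" using n by simp
    then show "\<Psi> ({} \<union> Z) \<le> \<Psi> (insert v ({} \<union> Z)) + (120 * (n\<^sup>2 * D) + 120 * (n * (m v * D)) + 10 * n ^ 3)"
      using step[of v Z] Z unfolding B_def by simp
  qed simp
  \<comment> \<open>Members of \<open>B\<close> no longer have mismatches, so every degree in the
    error sum is at most \<open>\<beta> * n\<close>, and the error is a small multiple of
    \<open>n^3 * m v\<close>.\<close>
  have phase2: "\<Psi> B \<le> \<Psi> (B \<union> (V - B)) + (\<Sum>v\<in>V - B. 120 * (n\<^sup>2 * (\<beta> * n * m v)) + 120 * (n * (m v * D)) + 10 * n ^ 3)"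
  proof (rule sum_chain_le)
    show "finite (V - B)" using fin by simp
    fix Z v assume Z: "Z \<subseteq> V - B" "v \<in> V - B" "v \<notin> Z"
    have "(\<Sum>x\<in>V. mism \<pi> (R (B \<union> Z)) v x * mism_deg V \<pi> (R (B \<union> Z)) x) \<le> (\<Sum>x\<in>V. mism \<pi> A v x * (\<beta> * n))"
    proof (intro sum_mono mult_mono)
      fix x assume x: "x \<in> V"
      show "mism_deg V \<pi> (R (B \<union> Z)) x \<le> \<beta> * n"
      proof (cases "x \<in> B")
        case True
        then show ?thesis using n by (simp add: R_def mism_deg_reset_set_member \<beta>_def)
      next
        case False
        then have "m x \<le> \<beta> * n" using x by (simp add: B_def)
        then show ?thesis using mism_deg_reset_set_le[of V \<pi> "B \<union> Z" A x] unfolding m_def R_def by linarith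
      qed
    qed (simp_all add: R_def mism_reset_set_le mism_nonneg mism_deg_nonneg)
    also have "\<dots> = \<beta> * n * m v"
      unfolding sum_distrib_right[symmetric] m_def mism_deg_def by simp
    finally have "n\<^sup>2 * (\<Sum>x\<in>V. mism \<pi> (R (B \<union> Z)) v x * mism_deg V \<pi> (R (B \<union> Z)) x) \<le> n\<^sup>2 * (\<beta> * n * m v)" using n by simp
    then show "\<Psi> (B \<union> Z) \<le> \<Psi> (insert v (B \<union> Z)) + (120 * (n\<^sup>2 * (\<beta> * n * m v)) + 120 * (n * (m v * D)) + 10 * n ^ 3)"
      using step[of v "B \<union> Z"] Z by simp
  qed simp
  have BV: "B \<subseteq> V" "B \<union> (V - B) = V" by (auto simp: B_def)
  \<comment> \<open>Markov's inequality, using that the total is at most the square of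
    \<open>\<beta> * n\<close>.\<close>
  have cardB: "real (card B) \<le> \<beta> * n"
  proof -
    have "real (card B) * (\<beta> * n) = (\<Sum>v\<in>B. \<beta> * n)" by simp
    also have "\<dots> \<le> (\<Sum>v\<in>B. m v)" by (rule sum_mono) (simp add: B_def)
    also have "\<dots> \<le> D" unfolding Dm by (rule sum_mono2[OF fin BV(1)]) (rule m0)
    also have "\<dots> \<le> (\<beta> * n) * (\<beta> * n)" using few unfolding D_def \<beta>_def by (simp add: power2_eq_square)
    finally show ?thesis using n by (simp add: \<beta>_def)
  qed
  \<comment> \<open>The choice of \<open>\<beta>\<close> makes
    \<open>240 \<beta> + 120 \<beta>^2 \<le> 1/64\<close>, so half of the smaller gain
    \<open>1/32\<close> pays for all second-order terms.\<close>
  have errors: "(\<Sum>v\<in>B. 120 * (n\<^sup>2 * D) + 120 * (n * (m v * D)) + 10 * n ^ 3)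
      + (\<Sum>v\<in>V - B. 120 * (n\<^sup>2 * (\<beta> * n * m v)) + 120 * (n * (m v * D)) + 10 * n ^ 3)
    \<le> n ^ 3 * D / 64 + 10 * n ^ 4"
  proof -
    have split: "sum f V = sum f B + sum f (V - B)" for f :: "'a \<Rightarrow> real"
      using sum.subset_diff[OF BV(1) fin, of f] by simp
    have "(\<Sum>v\<in>B. 120 * (n\<^sup>2 * D) + 120 * (n * (m v * D)) + 10 * n ^ 3)
      + (\<Sum>v\<in>V - B. 120 * (n\<^sup>2 * (\<beta> * n * m v)) + 120 * (n * (m v * D)) + 10 * n ^ 3)
      = real (card B) * (120 * (n\<^sup>2 * D)) + 120 * \<beta> * n ^ 3 * (\<Sum>v\<in>V - B. m v) + (120 * n * D * (\<Sum>v\<in>V. m v) + (\<Sum>v\<in>V. 10 * n ^ 3))"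
      unfolding split[of m] split[of "\<lambda>_. 10 * n ^ 3"]
      unfolding sum_distrib_left distrib_left sum.distrib by (simp add: power2_eq_square power3_eq_cube algebra_simps)
    also have "\<dots> \<le> \<beta> * n * (120 * (n\<^sup>2 * D)) + 120 * \<beta> * n ^ 3 * D + (120 * n * D * (\<beta>\<^sup>2 * n\<^sup>2) + 10 * n ^ 4)"
    proof (intro add_mono)
      show "real (card B) * (120 * (n\<^sup>2 * D)) \<le> \<beta> * n * (120 * (n\<^sup>2 * D))"
        by (rule mult_right_mono[OF cardB]) (use D0 in simp)
      show "120 * \<beta> * n ^ 3 * (\<Sum>v\<in>V - B. m v) \<le> 120 * \<beta> * n ^ 3 * D"
        unfolding Dm by (intro mult_left_mono sum_mono2[OF fin]) (use m0 n in \<open>auto simp: \<beta>_def\<close>)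
      show "120 * n * D * (\<Sum>v\<in>V. m v) \<le> 120 * n * D * (\<beta>\<^sup>2 * n\<^sup>2)"
        unfolding Dm[symmetric] using few D0 n by (intro mult_left_mono) (auto simp: D_def \<beta>_def power2_eq_square)
      show "(\<Sum>v\<in>V. 10 * n ^ 3) \<le> 10 * n ^ 4"
        by (simp add: n_def power_numeral_reduce)
    qed
    also have "\<dots> = (240 * \<beta> + 120 * \<beta>\<^sup>2) * (n ^ 3 * D) + 10 * n ^ 4"
      by (simp add: power2_eq_square power3_eq_cube algebra_simps)
    also have "(240 * \<beta> + 120 * \<beta>\<^sup>2) * (n ^ 3 * D) \<le> 1 / 64 * (n ^ 3 * D)"
      by (rule mult_right_mono) (use D0 n in \<open>simp_all add: \<beta>_def power2_eq_square\<close>)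
    finally show ?thesis by simp
  qed
  have start: "\<Psi> {} = copies V A + n ^ 3 * (3/32 * inside_total V \<pi> A + 1/32 * cross_total V \<pi> A)"
    unfolding \<Psi>_def R_def reset_set_empty ..
  have target: "\<Psi> V = copies V (\<lambda>x y. \<pi> x \<noteq> \<pi> y)"
  proof -
    have "inside_total V \<pi> (R V) = 0" "cross_total V \<pi> (R V) = 0"
      unfolding inside_deg_def cross_codeg_def R_def reset_set_def by (auto intro!: sum.neutral)
    moreover have "copies V (R V) = copies V (\<lambda>x y. \<pi> x \<noteq> \<pi> y)"
      unfolding wcopies_def by (intro sum.cong refl) (auto simp: is_copy_def R_def reset_set_def)
    ultimately show ?thesis unfolding \<Psi>_def by simp
  qed
  have "\<Psi> {} \<le> \<Psi> V + (n ^ 3 * D / 64 + 10 * n ^ 4)"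
    using phase1 phase2 errors unfolding BV by simp
  then show ?thesis
    unfolding start target D_def mism_total_eq by (simp add: field_simps)
qed

section \<open>Graphs close to a 4-partition\<close>

lemma multipartite_on_partition: "finite V \<Longrightarrow> multipartite_on V (\<lambda>x y. \<pi> x \<noteq> \<pi> y)"
  by (auto simp: multipartite_on_def graph_on_def)

lemma nonnbrs_partition: "nonnbrs V (\<lambda>x y. \<pi> x \<noteq> \<pi> y) v = part_size V \<pi> (\<pi> v)"
  unfolding nonnbrs_def part_count_def by (rule sum.cong[OF refl]) auto

lemma sum_part_sizes:
  assumes "finite V" "\<And>v. v \<in> V \<Longrightarrow> \<pi> v < (4::nat)"
  shows "(\<Sum>v\<in>V. g (part_size V \<pi> (\<pi> v))) = part_size V \<pi> 0 * g (part_size V \<pi> 0) + part_size V \<pi> 1 * g (part_size V \<pi> 1)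
    + part_size V \<pi> 2 * g (part_size V \<pi> 2) + part_size V \<pi> 3 * (g (part_size V \<pi> 3) :: real)"
proof -
  have "(\<Sum>v\<in>V. g (part_size V \<pi> (\<pi> v))) = (\<Sum>v\<in>V. of_bool True * g (part_size V \<pi> (\<pi> v)))" by simp
  also have "\<dots> = part_size V \<pi> 0 * g (part_size V \<pi> 0) + part_size V \<pi> 1 * g (part_size V \<pi> 1)
    + part_size V \<pi> 2 * g (part_size V \<pi> 2) + part_size V \<pi> 3 * g (part_size V \<pi> 3)"
    by (rule sum_by_part[where F = "\<lambda>j. g (part_size V \<pi> j)"]) (use assms in auto)
  finally show ?thesis .
qed

lemma arcs_count_partition:
  "arcs_count V A = arcs_count V (\<lambda>x y. \<pi> x \<noteq> \<pi> y) + inside_total V \<pi> A - cross_total V \<pi> A"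
  unfolding warcs_def inside_deg_def cross_codeg_def sum.distrib[symmetric] sum_subtractf[symmetric]
  by (intro sum.cong refl) (auto simp: of_bool_def)

text \<open>A copy of \<open>A\<close> that is not a copy of the partition graph contains a mismatch
  on one of its ten pairs, and each position of the pair accounts for \<open>n^3\<close> times the
  total.\<close>

lemma copies_le_mism:
  "copies V A \<le> copies V (\<lambda>x y. \<pi> x \<noteq> \<pi> y) + 10 * real (card V) ^ 3 * mism_total V \<pi> A"
proof -
  let ?M = "mism \<pi> A"
  let ?ten = "\<lambda>a a' b b' c. ?M a a' + ?M b b' + ?M a b + ?M a b' + ?M a' b + ?M a' b' + ?M c a + ?M c a' + ?M c b + ?M c b'"
  let ?D = "mism_total V \<pi> A"
  define n where "n = real (card V)"
  have D: "(\<Sum>x\<in>V. \<Sum>y\<in>V. ?M x y) = ?D" unfolding mism_total_def mism_deg_def ..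
  have D': "(\<Sum>y\<in>V. \<Sum>x\<in>V. ?M x y) = ?D" unfolding D[symmetric] by (rule sum.swap)
  have "copies V A \<le> sum5 V (\<lambda>a a' b b' c. 1 * 1 * 1 * 1 * 1 * of_bool (is_copy (\<lambda>x y. \<pi> x \<noteq> \<pi> y) a a' b b' c)
      + (?ten a a' b b' c))"
    unfolding wcopies_def
  proof (intro sum_mono)
    fix a a' b b' c
    show "1 * 1 * 1 * 1 * 1 * of_bool (is_copy A a a' b b' c) \<le> 1 * 1 * 1 * 1 * 1 * of_bool (is_copy (\<lambda>x y. \<pi> x \<noteq> \<pi> y) a a' b b' c)
      + (?ten a a' b b' c)"
    proof (cases "?M a a' = 0 \<and> ?M b b' = 0 \<and> ?M a b = 0 \<and> ?M a b' = 0 \<and> ?M a' b = 0 \<and> ?M a' b' = 0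
        \<and> ?M c a = 0 \<and> ?M c a' = 0 \<and> ?M c b = 0 \<and> ?M c b' = 0")
      case True
      then have "is_copy A a a' b b' c = is_copy (\<lambda>x y. \<pi> x \<noteq> \<pi> y) a a' b b' c"
        unfolding mism_def is_copy_def by auto
      then show ?thesis using True by simp
    next
      case False
      have *: "?M x y = 0 \<or> ?M x y = 1" for x y unfolding mism_def by auto
      have "1 \<le> ?ten a a' b b' c"
      proof -
        have nn: "0 \<le> ?M a a'" "0 \<le> ?M b b'" "0 \<le> ?M a b" "0 \<le> ?M a b'" "0 \<le> ?M a' b" "0 \<le> ?M a' b'"
          "0 \<le> ?M c a" "0 \<le> ?M c a'" "0 \<le> ?M c b" "0 \<le> ?M c b'" by (rule mism_nonneg)+
        have "?M a a' = 1 \<or> ?M b b' = 1 \<or> ?M a b = 1 \<or> ?M a b' = 1 \<or> ?M a' b = 1 \<or> ?M a' b' = 1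
          \<or> ?M c a = 1 \<or> ?M c a' = 1 \<or> ?M c b = 1 \<or> ?M c b' = 1"
          using False * by blast
        then show ?thesis by (elim disjE) (use nn in linarith)+
      qed
      moreover have "of_bool (is_copy A a a' b b' c) \<le> (1::real)" "0 \<le> (of_bool (is_copy (\<lambda>x y. \<pi> x \<noteq> \<pi> y) a a' b b' c) :: real)"
        by simp_all
      ultimately show ?thesis by linarith
    qed
  qed
  also have "\<dots> = copies V (\<lambda>x y. \<pi> x \<noteq> \<pi> y) + 10 * (n ^ 3 * ?D)"
  proof -
    have sum_c: "(\<Sum>x\<in>V. \<Sum>y\<in>V. \<Sum>c\<in>V. ?M c x) = n * ?D" "(\<Sum>y\<in>V. \<Sum>c\<in>V. ?M c y) = ?D"
      "(\<Sum>x\<in>V. \<Sum>y\<in>V. \<Sum>c\<in>V. ?M c y) = n * ?D"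
      unfolding D' sum_constant n_def sum_distrib_left[symmetric] by (simp_all add: D')
    note rules = sum.distrib sum_distrib_left[symmetric] sum_constant n_def[symmetric] D sum_c
    show ?thesis
      unfolding wcopies_def unfolding rules unfolding rules unfolding rules unfolding rules
      by (simp add: power3_eq_cube algebra_simps)
  qed
  finally show ?thesis unfolding n_def by simp
qed

text \<open>The weight \<open>x j\<close> makes the hypothesis empty for tiny parts, so these are
  excluded separately: a part below \<open>n/8\<close> leaves more than \<open>7n/8\<close> to three
  parts of size at most \<open>n/4 + n/1000\<close> each.\<close>

lemma part_sizes_near:
  fixes x :: "nat \<Rightarrow> real"
  assumes n: "0 < n" and nonneg: "\<And>j. j < 4 \<Longrightarrow> 0 \<le> x j" and total: "x 0 + x 1 + x 2 + x 3 = n"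
    and small: "\<And>j. j < 4 \<Longrightarrow> x j * (x j - n / 4)\<^sup>2 \<le> n ^ 3 / 8000000"
    and j: "j < 4"
  shows "\<bar>x j - n / 4\<bar> \<le> n / 1000"
proof -
  have large: "\<bar>x i - n / 4\<bar> \<le> n / 1000" if "i < 4" "n / 8 \<le> x i" for i
  proof -
    have "n / 8 * (x i - n / 4)\<^sup>2 \<le> x i * (x i - n / 4)\<^sup>2" by (rule mult_right_mono[OF that(2)]) simp
    also have "\<dots> \<le> n / 8 * (n / 1000)\<^sup>2" using small[OF that(1)] by (simp add: power2_eq_square power3_eq_cube)
    finally have "(x i - n / 4)\<^sup>2 \<le> (n / 1000)\<^sup>2" using n by simp
    then show ?thesis using n by (simp add: abs_le_square_iff[symmetric])
  qed
  then have upper: "x i \<le> n / 4 + n / 1000" if "i < 4" for i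
  proof (cases "n / 8 \<le> x i")
    case True
    from large[OF that True] show ?thesis by linarith
  next
    case False
    then show ?thesis using n by linarith
  qed
  show ?thesis
  proof (rule large[OF j], rule ccontr)
    assume "\<not> n / 8 \<le> x j"
    moreover have "j = 0 \<or> j = 1 \<or> j = 2 \<or> j = 3" using j by linarith
    ultimately show False
      using upper[of 0] upper[of 1] upper[of 2] upper[of 3] total n by auto
  qed
qed

text \<open>Divided by \<open>n^5\<close>, this is \<open>(p + (15/16) e) / 15\<close> up to
  lower-order terms; four equal parts give \<open>9/128\<close>.\<close>

definition balance :: "'a set \<Rightarrow> ('a \<Rightarrow> 'a \<Rightarrow> bool) \<Rightarrow> real" where
  "balance V A = copies V A + real (card V) ^ 3 * arcs_count V A / 16"

text \<open>Passing to the partition graph loses at most \<open>10 + 1/16\<close> units of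
  \<open>10^-9 n^5\<close>, for copies and arcs, on top of the one unit granted by
  \<open>opt\<close>. With 12 as a round bound, the weighted variance is at most
  \<open>96 * 10^-9 n^3\<close>, below the \<open>n^3 / 8000000\<close> that
  \<open>part_sizes_near\<close> allows.\<close>

lemma partition_sizes_near:
  fixes \<pi> :: "'a \<Rightarrow> nat"
  assumes A: "graph_on V A" and \<pi>: "\<And>u. u \<in> V \<Longrightarrow> \<pi> u < 4" and ne: "V \<noteq> {}"
  defines "n \<equiv> real (card V)"
  assumes few: "mism_total V \<pi> A \<le> n\<^sup>2 / 1000000000" and opt: "(9/128 - 1 / 1000000000) * n ^ 5 \<le> balance V A"
    and j: "j < 4"
  shows "\<bar>part_size V \<pi> j - n / 4\<bar> \<le> n / 1000"
proof -
  have fin: "finite V" using A by (simp add: graph_on_def)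
  then have n: "0 < n" using ne unfolding n_def by (auto simp: card_gt_0_iff)
  define T where "T = (\<lambda>x y. \<pi> x \<noteq> \<pi> y)"
  let ?x = "part_size V \<pi>"
  have D: "n ^ 3 * mism_total V \<pi> A \<le> n ^ 5 / 1000000000"
    using mult_left_mono[OF few, of "n ^ 3"] n by (simp add: power_numeral_reduce)
  have "0 \<le> cross_total V \<pi> A" unfolding cross_codeg_def by (simp add: sum_nonneg)
  then have "arcs_count V A \<le> arcs_count V T + mism_total V \<pi> A"
    unfolding arcs_count_partition[of V A \<pi>] mism_total_eq T_def by simp
  then have "n ^ 3 * arcs_count V A \<le> n ^ 3 * arcs_count V T + n ^ 5 / 1000000000"
    using mult_left_mono[of "arcs_count V A" "arcs_count V T + mism_total V \<pi> A" "n ^ 3"] D n by (simp add: distrib_left)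
  moreover have "copies V A \<le> copies V T + 10 * (n ^ 5 / 1000000000)"
    using copies_le_mism[of V A \<pi>] D unfolding n_def T_def by simp
  ultimately have "9 / 128 * n ^ 5 - copies V T - n ^ 3 * arcs_count V T / 16 \<le> 12 / 1000000000 * n ^ 5"
    using opt n zero_less_power[OF n, of 5] unfolding balance_def n_def[symmetric] left_diff_distrib by linarith
  then have "n\<^sup>2 / 8 * (\<Sum>v\<in>V. (nonnbrs V T v - n / 4)\<^sup>2) \<le> 12 / 1000000000 * n ^ 5"
    using multipartite_deficit_ge[OF multipartite_on_partition[OF fin, of \<pi>], folded T_def] unfolding n_def by linarith
  then have total: "(\<Sum>v\<in>V. (?x (\<pi> v) - n / 4)\<^sup>2) \<le> n ^ 3 / 8000000"
  proof -
    define Q where "Q = (\<Sum>v\<in>V. (?x (\<pi> v) - n / 4)\<^sup>2)"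
    have "n\<^sup>2 / 8 * Q \<le> n\<^sup>2 / 8 * (96 / 1000000000 * n ^ 3)"
      using \<open>n\<^sup>2 / 8 * (\<Sum>v\<in>V. (nonnbrs V T v - n / 4)\<^sup>2) \<le> _\<close>
      unfolding T_def nonnbrs_partition Q_def[symmetric] by (simp add: power_numeral_reduce)
    then have "Q \<le> 96 / 1000000000 * n ^ 3" by (rule mult_left_le_imp_le) (use n in simp)
    also have "\<dots> \<le> n ^ 3 / 8000000" using n by simp
    finally show ?thesis unfolding Q_def .
  qed
  have "(\<Sum>v\<in>V. (?x (\<pi> v) - n / 4)\<^sup>2) = ?x 0 * (?x 0 - n / 4)\<^sup>2 + ?x 1 * (?x 1 - n / 4)\<^sup>2
    + ?x 2 * (?x 2 - n / 4)\<^sup>2 + ?x 3 * (?x 3 - n / 4)\<^sup>2"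
    by (rule sum_part_sizes[where g = "\<lambda>t. (t - n / 4)\<^sup>2"]) (use fin \<pi> in auto)
  moreover have nn: "0 \<le> ?x i * (?x i - n / 4)\<^sup>2" for i by (simp add: part_count_nonneg)
  moreover have "?x 0 + ?x 1 + ?x 2 + ?x 3 = n"
    using sum_part_sizes[of V \<pi> "\<lambda>_. 1"] fin \<pi> by (simp add: n_def)
  moreover have "?x i * (?x i - n / 4)\<^sup>2 \<le> n ^ 3 / 8000000" if "i < 4" for i
  proof -
    have "i = 0 \<or> i = 1 \<or> i = 2 \<or> i = 3" using that by linarith
    then show ?thesis using calculation(1) total nn[of 0] nn[of 1] nn[of 2] nn[of 3] by auto
  qed
  ultimately show ?thesis
    using part_sizes_near[of n ?x j] n j part_count_nonneg[of V \<pi>] by blast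
qed

text \<open>Placed in part \<open>i\<close>, a vertex has twice its neighbours in that part minus
  the part size as its mismatch count, up to a term independent of \<open>i\<close> and up to the
  vertex itself. With nearly equal sizes, optimality means almost fewest neighbours in the own
  part.\<close>

lemma optimal_partition_least:
  fixes \<pi> :: "'a \<Rightarrow> nat"
  assumes A: "graph_on V A" and v: "v \<in> V"
    and opt: "mism_total V \<pi> A \<le> mism_total V (\<pi>(v := j)) A"
  shows "2 * inside_deg V \<pi> A v - part_size V \<pi> (\<pi> v) \<le> 2 * part_count V \<pi> (A v) j - part_size V \<pi> j"
proof (cases "j = \<pi> v")
  case True
  then show ?thesis by (simp add: inside_deg_eq)
next
  case False
  have fin: "finite V" and irr: "\<not> A v v" using A v unfolding graph_on_def by blast+
  define \<rho> where "\<rho> = \<pi>(v := j)"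
  have total: "mism_total V \<sigma> A = (\<Sum>x\<in>V. \<Sum>y\<in>V. if x = v \<or> y = v then 0 else mism \<sigma> A x y) + 2 * mism_deg V \<sigma> A v" for \<sigma>
    unfolding mism_total_def mism_deg_def
    by (rule sum_remove_row_column[OF fin v mism_sym[OF A]]) (use irr in \<open>auto simp: mism_def\<close>)
  have "(\<Sum>x\<in>V. \<Sum>y\<in>V. if x = v \<or> y = v then 0 else mism \<pi> A x y) = (\<Sum>x\<in>V. \<Sum>y\<in>V. if x = v \<or> y = v then 0 else mism \<rho> A x y)"
    by (intro sum.cong refl) (auto simp: \<rho>_def mism_def)
  then have "mism_deg V \<pi> A v \<le> mism_deg V \<rho> A v"
    using opt total[of \<pi>] total[of \<rho>] unfolding \<rho>_def by linarith
  \<comment> \<open>The right-hand side keeps the old label of \<open>v\<close> at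
    \<open>u = v\<close>, which counts one mismatch that \<open>\<rho>\<close> does not have; hence
    an inequality.\<close>
  also have "\<dots> \<le> (\<Sum>u\<in>V. of_bool (A v u \<noteq> (j \<noteq> \<pi> u)))"
    unfolding mism_deg_def by (rule sum_mono) (auto simp: mism_def \<rho>_def irr)
  finally have "0 \<le> (\<Sum>u\<in>V. of_bool (A v u \<noteq> (j \<noteq> \<pi> u))) - mism_deg V \<pi> A v" by simp
  also have "\<dots> = (\<Sum>u\<in>V. (2 * of_bool (A v u \<and> \<pi> u = j) - of_bool (True \<and> \<pi> u = j))
     - (2 * of_bool (A v u \<and> \<pi> u = \<pi> v) - of_bool (True \<and> \<pi> u = \<pi> v)))"
    unfolding mism_deg_def mism_def sum_subtractf[symmetric]
  proof (rule sum.cong[OF refl])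
    fix u
    have "j \<noteq> \<pi> u \<or> \<pi> v \<noteq> \<pi> u" using False by auto
    then show "of_bool (A v u \<noteq> (j \<noteq> \<pi> u)) - of_bool (A v u \<noteq> (\<pi> v \<noteq> \<pi> u)) =
      (2 * of_bool (A v u \<and> \<pi> u = j) - of_bool (True \<and> \<pi> u = j))
     - (2 * of_bool (A v u \<and> \<pi> u = \<pi> v) - of_bool (True \<and> \<pi> u = \<pi> v) :: real)"
      by (cases "A v u"; cases "\<pi> u = j"; cases "\<pi> u = \<pi> v") simp_all
  qed
  also have "\<dots> = (2 * part_count V \<pi> (A v) j - part_size V \<pi> j) - (2 * inside_deg V \<pi> A v - part_size V \<pi> (\<pi> v))"
    unfolding inside_deg_eq part_count_def by (simp only: sum_subtractf sum_distrib_left)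
  finally show ?thesis by simp
qed

context
  fixes V :: "'a set" and A :: "'a \<Rightarrow> 'a \<Rightarrow> bool" and \<pi> :: "'a \<Rightarrow> nat" and n :: real
  assumes A: "graph_on V A" and \<pi>: "\<And>u. u \<in> V \<Longrightarrow> \<pi> u < 4" and ne: "V \<noteq> {}" and n_def: "n = real (card V)"
    and few: "mism_total V \<pi> A \<le> n\<^sup>2 / 1000000000" and near_opt: "(9/128 - 1 / 1000000000) * n ^ 5 \<le> balance V A"
    and opt: "\<And>v j. v \<in> V \<Longrightarrow> j < 4 \<Longrightarrow> mism_total V \<pi> A \<le> mism_total V (\<pi>(v := j)) A"
begin

lemma near_pos: "0 < n" "finite V"
  using A ne unfolding n_def by (auto simp: card_gt_0_iff graph_on_def)

lemma near_sizes: "j < 4 \<Longrightarrow> \<bar>part_size V \<pi> j - n / 4\<bar> \<le> n / 1000"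
  unfolding n_def
  by (rule partition_sizes_near[OF A \<pi> ne]) (use few near_opt in \<open>simp_all add: n_def\<close>)

lemma near_copies_le:
  "copies V A \<le> copies V (\<lambda>x y. \<pi> x \<noteq> \<pi> y) - n ^ 3 * inside_total V \<pi> A / 16 - n ^ 3 * mism_total V \<pi> A / 64 + 10 * n ^ 4"
  unfolding n_def
proof (rule copies_le_partition[OF A _ ne])
  show "\<bar>part_size V \<pi> j - real (card V) / 4\<bar> \<le> real (card V) / 1000" if "j < 4" for j
    using near_sizes[OF that] unfolding n_def .
  show "inside_deg V \<pi> A v \<le> part_count V \<pi> (A v) j + real (card V) / 500" if "v \<in> V" "j < 4" for v j
    using optimal_partition_least[OF A that(1) opt[OF that]] near_sizes[OF that(2)] near_sizes[OF \<pi>[OF that(1)]]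
    unfolding n_def[symmetric] by linarith
  show "mism_total V \<pi> A \<le> (real (card V))\<^sup>2 / 25000\<^sup>2"
    by (rule order_trans[OF few]) (simp add: n_def divide_left_mono)
qed (rule \<pi>)

text \<open>An arc inside a part adds \<open>n^3/16\<close> to the arc term, exactly what the term
  with \<open>inside_total\<close> in \<open>near_copies_le\<close> takes away; a missing cross arc
  only lowers the arc term. So each mismatch still costs \<open>n^3/64\<close>.\<close>

lemma near_balance_le: "balance V A \<le> 9/128 * n ^ 5 - n ^ 3 * mism_total V \<pi> A / 64 + 10 * n ^ 4"
proof -
  let ?T = "\<lambda>x y. \<pi> x \<noteq> \<pi> y"
  have "0 \<le> n\<^sup>2 / 8 * (\<Sum>v\<in>V. (nonnbrs V ?T v - n / 4)\<^sup>2)" by (simp add: sum_nonneg)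
  then have "copies V ?T + n ^ 3 * arcs_count V ?T / 16 \<le> 9/128 * n ^ 5"
    using multipartite_deficit_ge[OF multipartite_on_partition[OF near_pos(2), of \<pi>]] unfolding n_def by linarith
  moreover have "0 \<le> cross_total V \<pi> A" unfolding cross_codeg_def by (simp add: sum_nonneg)
  then have "n ^ 3 * arcs_count V A \<le> n ^ 3 * (arcs_count V ?T + inside_total V \<pi> A)"
    using near_pos unfolding arcs_count_partition[of V A \<pi>] by (intro mult_left_mono) auto
  ultimately show ?thesis
    using near_copies_le unfolding balance_def n_def[symmetric] by (simp add: distrib_left)
qed

text \<open>A shortage of arcs comes from uneven parts, measured by \<open>S - n^2/4\<close>, or
  from mismatches. Since fewer arcs relax the balance bound by \<open>1/16\<close> per arc,
  unevenness must cost \<open>5/64 = 1/16 + 1/64\<close>. The estimate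
  \<open>multipartite_deficit_ge\<close> yields only about \<open>1/32\<close>, so the full deficit
  identity is used.\<close>

lemma near_copies_le_arcs: "copies V A \<le> 3/128 * n ^ 5 - n ^ 3 * (3/4 * n\<^sup>2 - arcs_count V A) / 64 + 10 * n ^ 4"
proof -
  let ?T = "\<lambda>x y. \<pi> x \<noteq> \<pi> y"
  let ?x = "part_size V \<pi>"
  define S where "S = (\<Sum>v\<in>V. ?x (\<pi> v))"
  have n: "0 < n" by (rule near_pos)
  have x: "?x 0 + ?x 1 + ?x 2 + ?x 3 = n"
    using sum_part_sizes[of V \<pi> "\<lambda>_. 1"] near_pos \<pi> by (simp add: n_def)
  have S: "S = ?x 0 * ?x 0 + ?x 1 * ?x 1 + ?x 2 * ?x 2 + ?x 3 * ?x 3"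
    unfolding S_def using sum_part_sizes[of V \<pi> "\<lambda>t. t"] near_pos \<pi> by simp
  have excess: "S - n\<^sup>2 / 4 = (?x 0 - n/4)\<^sup>2 + (?x 1 - n/4)\<^sup>2 + (?x 2 - n/4)\<^sup>2 + (?x 3 - n/4)\<^sup>2"
    unfolding S x[symmetric] by (simp add: power2_eq_square field_simps)
  then have S0: "0 \<le> S - n\<^sup>2 / 4" by simp
  have xb: "249/1000 * n \<le> ?x j" "?x j \<le> 251/1000 * n" if "j < 4" for j
    using near_sizes[OF that] by linarith+
  have "n ^ 3 * (5/64 * (S - n\<^sup>2 / 4)) \<le> 249/1000 * n * (n\<^sup>2 * 2 / 5) * (S - n\<^sup>2 / 4)"
    using mult_right_mono[of "5/64" "249/1000 * (2/5)" "n ^ 3 * (S - n\<^sup>2 / 4)"] n S0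
    by (simp add: power2_eq_square power3_eq_cube field_simps)
  also have "\<dots> = (n\<^sup>2 * 2 / 5) * ((249/1000 * n) * (?x 0 - n/4)\<^sup>2 + (249/1000 * n) * (?x 1 - n/4)\<^sup>2
      + (249/1000 * n) * (?x 2 - n/4)\<^sup>2 + (249/1000 * n) * (?x 3 - n/4)\<^sup>2)"
    unfolding excess by (simp add: algebra_simps)
  also have "\<dots> \<le> (n\<^sup>2 * 2 / 5) * (?x 0 * (?x 0 - n/4)\<^sup>2 + ?x 1 * (?x 1 - n/4)\<^sup>2 + ?x 2 * (?x 2 - n/4)\<^sup>2 + ?x 3 * (?x 3 - n/4)\<^sup>2)"
    by (intro mult_left_mono add_mono mult_right_mono xb) simp_all
  also have "\<dots> = (n\<^sup>2 * 2 / 5) * (\<Sum>v\<in>V. (?x (\<pi> v) - n/4)\<^sup>2)"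
    using sum_part_sizes[of V \<pi> "\<lambda>t. (t - n/4)\<^sup>2"] near_pos \<pi> by simp
  also have "\<dots> \<le> (\<Sum>v\<in>V. (?x (\<pi> v) - n/4)\<^sup>2 * (n\<^sup>2 / 8 + 2 * (S - (?x (\<pi> v))\<^sup>2)))"
    unfolding sum_distrib_left
  proof (rule sum_mono)
    fix v assume v: "v \<in> V"
    define y where "y = ?x (\<pi> v)"
    have "y\<^sup>2 \<le> (251/1000 * n)\<^sup>2"
      unfolding y_def by (rule power_mono[OF xb(2)[OF \<pi>[OF v]] part_count_nonneg])
    also have "\<dots> = 63001/1000000 * n\<^sup>2" by (simp add: power2_eq_square)
    finally have "n\<^sup>2 * 2 / 5 \<le> n\<^sup>2 / 8 + 2 * (S - y\<^sup>2)"
      using S0 zero_le_power2[of n] unfolding right_diff_distrib by linarith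
    then have "n\<^sup>2 * 2 / 5 \<le> n\<^sup>2 / 8 + 2 * (S - (?x (\<pi> v))\<^sup>2)" unfolding y_def .
    from mult_right_mono[OF this, of "(?x (\<pi> v) - n/4)\<^sup>2"]
    show "n\<^sup>2 * 2 / 5 * (?x (\<pi> v) - n/4)\<^sup>2 \<le> (?x (\<pi> v) - n/4)\<^sup>2 * (n\<^sup>2 / 8 + 2 * (S - (?x (\<pi> v))\<^sup>2))"
      by (simp add: mult.commute)
  qed
  also have "\<dots> = 9/128 * n ^ 5 - copies V ?T - n ^ 3 * arcs_count V ?T / 16"
    using multipartite_deficit[OF multipartite_on_partition[OF near_pos(2), of \<pi>]]
    unfolding nonnbrs_partition n_def[symmetric] S_def[symmetric] by simp
  finally have T: "copies V ?T \<le> 9/128 * n ^ 5 - n ^ 3 * arcs_count V ?T / 16 - n ^ 3 * (5/64 * (S - n\<^sup>2 / 4))" by simp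
  have arcsT: "arcs_count V ?T = n\<^sup>2 - S"
    using multipartite_copies_moments(2)[OF multipartite_on_partition[OF near_pos(2), of \<pi>]]
    unfolding nonnbrs_partition n_def[symmetric] S_def[symmetric] .
  have "0 \<le> inside_total V \<pi> A" unfolding inside_deg_def by (simp add: sum_nonneg)
  moreover from this have "3/4 * n\<^sup>2 - arcs_count V A \<le> (S - n\<^sup>2 / 4) + mism_total V \<pi> A"
    unfolding arcs_count_partition[of V A \<pi>] arcsT mism_total_eq by simp
  then have "n ^ 3 * (3/4 * n\<^sup>2 - arcs_count V A) \<le> n ^ 3 * ((S - n\<^sup>2 / 4) + mism_total V \<pi> A)"
    using n by (intro mult_left_mono) auto
  moreover have "0 \<le> n ^ 3 * inside_total V \<pi> A" using n calculation(1) by simp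
  ultimately show ?thesis
    using near_copies_le T unfolding arcsT by (simp add: power_numeral_reduce field_simps)
qed

end

section \<open>Graphs of nearly optimal balance\<close>

lemma exists_optimal_partition:
  fixes \<pi>0 :: "'a \<Rightarrow> nat"
  assumes fin: "finite V" and \<pi>0: "\<And>u. u \<in> V \<Longrightarrow> \<pi>0 u < 4"
  obtains \<pi> where "\<And>u. u \<in> V \<Longrightarrow> \<pi> u < 4" "mism_total V \<pi> A \<le> mism_total V \<pi>0 A"
    "\<And>v j. v \<in> V \<Longrightarrow> j < 4 \<Longrightarrow> mism_total V \<pi> A \<le> mism_total V (\<pi>(v := j)) A"
proof -
  define F where "F = PiE V (\<lambda>_. {..<4::nat})"
  define \<sigma> where "\<sigma> = restrict \<pi>0 V"
  have F: "finite F" "\<sigma> \<in> F" using fin \<pi>0 unfolding F_def \<sigma>_def by (auto intro: finite_PiE)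
  then obtain \<pi> where \<pi>: "\<pi> \<in> F" "\<And>\<rho>. \<rho> \<in> F \<Longrightarrow> mism_total V \<pi> A \<le> mism_total V \<rho> A"
    using arg_min_if_finite(1)[of F "\<lambda>\<pi>. mism_total V \<pi> A"] arg_min_least[of F _ "\<lambda>\<pi>. mism_total V \<pi> A"] by blast
  show ?thesis
  proof
    show "\<pi> u < 4" if "u \<in> V" for u using \<pi>(1) that unfolding F_def by auto
    have "mism_total V \<sigma> A = mism_total V \<pi>0 A"
      unfolding mism_total_def mism_deg_def mism_def \<sigma>_def by (intro sum.cong refl) auto
    then show "mism_total V \<pi> A \<le> mism_total V \<pi>0 A" using \<pi>(2)[OF F(2)] by simp
    show "mism_total V \<pi> A \<le> mism_total V (\<pi>(v := j)) A" if "v \<in> V" "j < 4" for v j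
    proof (rule \<pi>(2))
      show "\<pi>(v := j) \<in> F"
        using \<pi>(1) that unfolding F_def PiE_def extensional_def by auto
    qed
  qed
qed

text \<open>The deficit bounds the variance of the part sizes by \<open>8 * 10^-13 n^3\<close>, and
  a bad vertex contributes at least \<open>n^2/400\<close> to it, so bad vertices are few. All other
  vertices lie in parts larger than \<open>n/5\<close>, of which there are at most four.\<close>

lemma multipartite_near_optimal_partition:
  assumes H: "multipartite_on V H" and ne: "V \<noteq> {}"
  defines "n \<equiv> real (card V)"
  assumes near: "(9/128 - 1 / 10000000000000) * n ^ 5 \<le> balance V H"
  obtains \<pi> where "\<And>u. u \<in> V \<Longrightarrow> \<pi> u < (4::nat)" "mism_total V \<pi> H \<le> n\<^sup>2 / 1000000000"
proof -
  have fin: "finite V" and irr: "\<And>x. x \<in> V \<Longrightarrow> \<not> H x x"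
    and tr: "\<And>x y z. x \<in> V \<Longrightarrow> y \<in> V \<Longrightarrow> z \<in> V \<Longrightarrow> \<not> H x y \<Longrightarrow> H x z = H y z"
    using H unfolding multipartite_on_def graph_on_def by blast+
  have n: "0 < n" using ne fin unfolding n_def by (auto simp: card_gt_0_iff)
  define Y where "Y = nonnbrs V H"
  define C where "C = (\<lambda>v. {u \<in> V. \<not> H v u})"
  have Ycard: "Y v = real (card (C v))" for v
    unfolding Y_def C_def nonnbrs_def using fin by (simp add: Int_def)
  have CC: "C x = C y \<longleftrightarrow> \<not> H x y" if "x \<in> V" "y \<in> V" for x y
  proof
    assume "C x = C y"
    moreover have "y \<in> C y" using that irr by (simp add: C_def)
    ultimately show "\<not> H x y" by (auto simp: C_def)
  next
    assume "\<not> H x y"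
    then have "H x z = H y z" if "z \<in> V" for z using tr \<open>x \<in> V\<close> \<open>y \<in> V\<close> that by blast
    then show "C x = C y" by (auto simp: C_def)
  qed
  have disj: "C x \<inter> C y = {}" if "x \<in> V" "y \<in> V" "C x \<noteq> C y" for x y
  proof (rule ccontr)
    assume "C x \<inter> C y \<noteq> {}"
    then obtain z where z: "z \<in> V" "\<not> H x z" "\<not> H y z" by (auto simp: C_def)
    then show False using CC[OF that(1) z(1)] CC[OF that(2) z(1)] that(3) by simp
  qed
  define bad where "bad = {v \<in> V. n / 20 \<le> \<bar>Y v - n / 4\<bar>}"
  have bad_few: "real (card bad) \<le> n / 3000000000"
  proof -
    define Q where "Q = (\<Sum>v\<in>V. (Y v - n / 4)\<^sup>2)"
    have "n\<^sup>2 / 8 * Q \<le> 1 / 10000000000000 * n ^ 5"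
      using multipartite_deficit_ge[OF H] near unfolding balance_def n_def[symmetric] Y_def[symmetric] Q_def left_diff_distrib
      by linarith
    then have "n\<^sup>2 / 8 * Q \<le> n\<^sup>2 / 8 * (8 / 10000000000000 * n ^ 3)" by (simp add: power_numeral_reduce)
    then have Q: "Q \<le> 8 / 10000000000000 * n ^ 3" by (rule mult_left_le_imp_le) (use n in simp)
    have "n\<^sup>2 / 400 * real (card bad) = (\<Sum>v\<in>bad. (n / 20)\<^sup>2)" by (simp add: power2_eq_square)
    also have "\<dots> \<le> (\<Sum>v\<in>bad. (Y v - n / 4)\<^sup>2)"
      by (rule sum_mono) (use n in \<open>simp add: bad_def abs_le_square_iff[symmetric]\<close>)
    also have "\<dots> \<le> Q" unfolding Q_def by (rule sum_mono2[OF fin]) (auto simp: bad_def)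
    also note Q
    also have "8 / 10000000000000 * n ^ 3 \<le> n\<^sup>2 / 400 * (n / 3000000000)"
      using n by (simp add: power_numeral_reduce)
    finally show ?thesis by (rule mult_left_le_imp_le) (use n in simp)
  qed
  define good where "good = V - bad"
  have goodV: "good \<subseteq> V" "finite good" unfolding good_def using fin by auto
  have "card (C ` good) \<le> card {..<4::nat}"
  proof (rule ccontr)
    assume "\<not> ?thesis"
    then have "5 \<le> real (card (C ` good))" by simp
    then have "n \<le> real (card (C ` good)) * (n / 5)" using mult_right_mono[of 5 "real (card (C ` good))" "n / 5"] n by simp
    also have "\<dots> = (\<Sum>D\<in>C ` good. n / 5)" by simp
    also have "\<dots> < (\<Sum>D\<in>C ` good. real (card D))"
    proof (rule sum_strict_mono)
      show "finite (C ` good)" using goodV by simp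
      show "C ` good \<noteq> {}" using \<open>5 \<le> real (card (C ` good))\<close> by auto
      fix D assume "D \<in> C ` good"
      then obtain v where v: "v \<in> V" "v \<notin> bad" "D = C v" unfolding good_def by auto
      then have "\<bar>Y v - n / 4\<bar> < n / 20" unfolding bad_def by auto
      then show "n / 5 < real (card D)" unfolding v(3) Ycard[symmetric] by linarith
    qed
    also have "\<dots> = real (\<Sum>D\<in>C ` good. card D)" by simp
    also have "(\<Sum>D\<in>C ` good. card D) = card (\<Union>(C ` good))"
    proof (rule card_Union_disjoint[symmetric])
      show "pairwise disjnt (C ` good)"
        unfolding pairwise_def disjnt_def using disj goodV by blast
      show "finite D" if "D \<in> C ` good" for D using that fin by (auto simp: C_def)
    qed
    also have "\<dots> \<le> card V" by (rule card_mono[OF fin]) (auto simp: C_def)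
    finally show False unfolding n_def by simp
  qed
  then obtain idx where idx: "idx ` (C ` good) \<subseteq> {..<4::nat}" "inj_on idx (C ` good)"
    using card_le_inj[of "C ` good" "{..<4::nat}"] goodV by auto
  \<comment> \<open>The label 0 of bad vertices is arbitrary: all pairs meeting \<open>bad\<close>
    are written off as mismatches.\<close>
  define \<pi> where "\<pi> = (\<lambda>v. if v \<in> good then idx (C v) else 0)"
  show ?thesis
  proof
    show "\<pi> u < 4" for u using idx(1) unfolding \<pi>_def by auto
    have "mism_total V \<pi> H \<le> (\<Sum>x\<in>V. \<Sum>y\<in>V. of_bool (x \<in> bad) + of_bool (y \<in> bad))"
      unfolding mism_total_def mism_deg_def
    proof (intro sum_mono)
      fix x y assume V: "x \<in> V" "y \<in> V"
      show "mism \<pi> H x y \<le> of_bool (x \<in> bad) + of_bool (y \<in> bad)"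
      proof (cases "x \<in> bad \<or> y \<in> bad")
        case True
        then show ?thesis using mism_le_1[of \<pi> H x y] by auto
      next
        case False
        then have "x \<in> good" "y \<in> good" using V by (auto simp: good_def)
        then have "\<pi> x = \<pi> y \<longleftrightarrow> C x = C y" unfolding \<pi>_def using idx(2) by (auto simp: inj_on_def)
        then show ?thesis using CC[OF V] by (simp add: mism_def)
      qed
    qed
    also have "\<dots> = 2 * n * real (card bad)"
    proof -
      have "(\<Sum>x\<in>V. of_bool (x \<in> bad)) = real (card bad)"
      proof -
        have "V \<inter> bad = bad" unfolding bad_def by auto
        then show ?thesis using fin by simp
      qed
      then show ?thesis unfolding sum.distrib sum_constant sum_distrib_left[symmetric] n_def by simp
    qed
    also have "\<dots> \<le> 2 * n * (n / 3000000000)" by (rule mult_left_mono[OF bad_few]) (use n in simp)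
    also have "\<dots> \<le> n\<^sup>2 / 1000000000" by (simp add: power2_eq_square)
    finally show "mism_total V \<pi> H \<le> n\<^sup>2 / 1000000000" .
  qed
qed

section \<open>An integer potential that increases under suitable cloning\<close>

definition nat_copies :: "'a set \<Rightarrow> ('a \<Rightarrow> 'a \<Rightarrow> bool) \<Rightarrow> nat" where
  "nat_copies V A = sum5 V (\<lambda>a a' b b' c. of_bool (is_copy A a a' b b' c))"

definition nat_arcs :: "'a set \<Rightarrow> ('a \<Rightarrow> 'a \<Rightarrow> bool) \<Rightarrow> nat" where
  "nat_arcs V A = (\<Sum>a\<in>V. \<Sum>b\<in>V. of_bool (A a b))"

definition nat_cherries :: "'a set \<Rightarrow> ('a \<Rightarrow> 'a \<Rightarrow> bool) \<Rightarrow> nat" where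
  "nat_cherries V A = (\<Sum>c\<in>V. \<Sum>a\<in>V. \<Sum>a'\<in>V. of_bool (A c a \<and> A c a'))"

lemma real_nat_counts:
  "real (nat_copies V A) = copies V A" "real (nat_arcs V A) = arcs_count V A"
  "real (nat_cherries V A) = wcherries V (\<lambda>_. 1) A"
  by (simp_all add: nat_copies_def nat_arcs_def nat_cherries_def wcopies_def warcs_def wcherries_def)

lemma nat_counts_le:
  "nat_copies V A \<le> card V ^ 5" "nat_arcs V A \<le> card V ^ 2" "nat_cherries V A \<le> card V ^ 3"
proof -
  have "nat_copies V A \<le> sum5 V (\<lambda>a a' b b' c. 1)"
    unfolding nat_copies_def by (intro sum_mono) simp
  then show "nat_copies V A \<le> card V ^ 5" by (simp add: power_numeral_reduce)
  have "nat_arcs V A \<le> (\<Sum>a\<in>V. \<Sum>a'\<in>V. 1)"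
    unfolding nat_arcs_def by (intro sum_mono) simp
  then show "nat_arcs V A \<le> card V ^ 2" by (simp add: power_numeral_reduce)
  have "nat_cherries V A \<le> (\<Sum>a\<in>V. \<Sum>a'\<in>V. \<Sum>c\<in>V. 1)"
    unfolding nat_cherries_def by (intro sum_mono) simp
  then show "nat_cherries V A \<le> card V ^ 3" by (simp add: power_numeral_reduce)
qed

text \<open>Cherries only break ties: they are strictly convex under the replacement of a vertex by a clone
  of a non-adjacent one.\<close>

definition potential :: "'a set \<Rightarrow> ('a \<Rightarrow> 'a \<Rightarrow> bool) \<Rightarrow> nat" where
  "potential V A = (card V ^ 3 + 1) * (16 * nat_copies V A + card V ^ 3 * nat_arcs V A) + nat_cherries V A"

text \<open>Cherries number at most \<open>card V ^ 3\<close>, less than the factor in front of the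
  integer \<open>16 * balance\<close>. The potential therefore orders graphs lexicographically, with
  balance first.\<close>

lemma potential_less_balance_le:
  assumes "potential V A < potential V A'"
  shows "balance V A \<le> balance V A'"
proof -
  let ?b = "\<lambda>A. 16 * nat_copies V A + card V ^ 3 * nat_arcs V A"
  have "?b A \<le> ?b A'"
  proof (rule ccontr)
    assume "\<not> ?b A \<le> ?b A'"
    then have "?b A' + 1 \<le> ?b A" by simp
    from mult_left_mono[OF this, of "card V ^ 3 + 1"]
    have "potential V A' \<le> potential V A"
      using nat_counts_le(3)[of V A'] unfolding potential_def by (simp add: algebra_simps)
    then show False using assms by simp
  qed
  then have "real (?b A) \<le> real (?b A')" by (rule of_nat_mono)
  then show ?thesis unfolding balance_def real_nat_counts[symmetric] by (simp add: field_simps)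
qed

lemma graph_on_clone:
  assumes "graph_on V A" "u \<in> V" "v \<in> V"
  shows "graph_on V (clone A u v)"
  unfolding graph_on_def
proof (intro conjI ballI)
  have sym: "A x y = A y x" if "x \<in> V" "y \<in> V" for x y
    using assms(1) that unfolding graph_on_def by blast
  show "finite V" "\<And>x. x \<in> V \<Longrightarrow> \<not> clone A u v x x"
    using assms unfolding graph_on_def clone_def by auto
  show "clone A u v x y = clone A u v y x" if "x \<in> V" "y \<in> V" for x y
    unfolding clone_def by (rule sym) (use that assms in auto)
qed

text \<open>Only pairs containing \<open>u\<close> change. This is the discrete continuity that
  keeps symmetrisation from jumping over a range of mismatch totals.\<close>

lemma mism_total_clone:
  assumes A: "graph_on V A" and uv: "u \<in> V" "v \<in> V"
  shows "mism_total V \<pi> A \<le> mism_total V \<pi> (clone A u v) + 2 * real (card V)"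
proof -
  have total: "mism_total V \<pi> H = (\<Sum>x\<in>V. \<Sum>y\<in>V. if x = u \<or> y = u then 0 else mism \<pi> H x y) + 2 * mism_deg V \<pi> H u"
    if "graph_on V H" for H
    unfolding mism_total_def mism_deg_def
    by (rule sum_remove_row_column[OF _ uv(1) mism_sym[OF that]])
      (use that uv in \<open>auto simp: mism_def graph_on_def\<close>)
  have "(\<Sum>x\<in>V. \<Sum>y\<in>V. if x = u \<or> y = u then 0 else mism \<pi> A x y) =
      (\<Sum>x\<in>V. \<Sum>y\<in>V. if x = u \<or> y = u then 0 else mism \<pi> (clone A u v) x y)"
    by (intro sum.cong refl) (auto simp: mism_def clone_def)
  moreover have "mism_deg V \<pi> A u \<le> (\<Sum>y\<in>V. 1)"
    unfolding mism_deg_def by (rule sum_mono) (rule mism_le_1)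
  ultimately show ?thesis
    using total[OF A] total[OF graph_on_clone[OF A uv]] mism_deg_nonneg[of V \<pi> "clone A u v" u] by simp
qed

text \<open>Copies are convex, arcs linear and cherries strictly convex under the two opposite
  clonings. The average potential of the two results therefore exceeds the original one, so one of
  them improves it.\<close>

lemma exists_better_clone:
  assumes A: "graph_on V A" and xyz: "x \<in> V" "y \<in> V" "z \<in> V" "\<not> A x y" "A x z \<noteq> A y z"
  obtains u v where "u \<in> V" "v \<in> V" "potential V A < potential V (clone A u v)"
proof -
  interpret nonadjacent V A x y using A xyz by unfold_locales
  have fin: "finite V" using A by (simp add: graph_on_def)
  define n where "n = real (card V)"
  define b where "b = (\<lambda>H. 16 * copies V H + n ^ 3 * arcs_count V H)"
  have pot: "real (potential V H) = (n ^ 3 + 1) * b H + wcherries V (\<lambda>_. 1) H" for H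
    unfolding potential_def b_def n_def real_nat_counts[symmetric] by (simp add: algebra_simps)
  note cl = copies_clone[OF fin, of x y] copies_clone[OF fin, of y x] arcs_count_clone[OF fin, of x y]
    arcs_count_clone[OF fin, of y x] cherries_clone[OF fin, of x y] cherries_clone[OF fin, of y x]
  have "n ^ 3 * (arcs_count V (clone A x y) + arcs_count V (clone A y x)) = n ^ 3 * (2 * arcs_count V A)"
    using arcs_linear cl xyz by simp
  then have "2 * b A \<le> b (clone A x y) + b (clone A y x)"
    using copies_convex cl xyz unfolding b_def by (simp add: distrib_left)
  then have "(n ^ 3 + 1) * (2 * b A) \<le> (n ^ 3 + 1) * (b (clone A x y) + b (clone A y x))"
    by (rule mult_left_mono) (simp add: n_def)
  then have "2 * real (potential V A) < real (potential V (clone A x y)) + real (potential V (clone A y x))"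
    using cherries_strictly_convex[OF xyz(3,5)] unfolding pot cl(5)[OF xyz(1,2)] cl(6)[OF xyz(2,1)]
    by (simp add: distrib_left)
  then have "potential V A < potential V (clone A x y) \<or> potential V A < potential V (clone A y x)" by linarith
  then show ?thesis using that xyz by blast
qed

text \<open>Symmetrisation moves one vertex at a time, so on its way from a graph far from every 4-partition
  to a multipartite graph it would have to pass through a range of small distances at which the balance
  is too small.\<close>

lemma near_optimal_partition:
  assumes A: "graph_on V A" and big: "10 ^ 12 \<le> real (card V)"
    and near: "(9/128 - 1 / 10000000000000) * real (card V) ^ 5 \<le> balance V A"
  obtains \<pi> where "\<And>u. u \<in> V \<Longrightarrow> \<pi> u < (4::nat)" "mism_total V \<pi> A \<le> (real (card V))\<^sup>2 / 1000000000"
proof -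
  define n where "n = real (card V)"
  have n: "0 < n" "10 ^ 12 \<le> n" using big unfolding n_def by simp_all
  have fin: "finite V" using A by (simp add: graph_on_def)
  have ne: "V \<noteq> {}" using n unfolding n_def by auto
  define far where "far = (\<lambda>H. graph_on V H \<and> (9/128 - 1 / 10000000000000) * n ^ 5 \<le> balance V H
    \<and> (\<forall>\<pi>. (\<forall>u\<in>V. \<pi> u < (4::nat)) \<longrightarrow> n\<^sup>2 / 1000000000 < mism_total V \<pi> H))"
  have "\<not> far A"
  proof
    assume "far A"
    define bound where "bound = (card V ^ 3 + 1) * (16 * card V ^ 5 + card V ^ 3 * card V ^ 2) + card V ^ 3"
    have "potential V H < bound + 1" for H
      using nat_counts_le[of V H] unfolding potential_def bound_def
      by (intro le_imp_less_Suc[unfolded Suc_eq_plus1] add_mono mult_mono) auto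
    \<comment> \<open>Instead of following the process, take a far graph of largest potential: an
      improving clone of it keeps the balance but cannot be far.\<close>
    then obtain H where H: "far H" "\<And>H'. far H' \<Longrightarrow> potential V H' \<le> potential V H"
      using ex_has_greatest_nat[of far A "potential V" "bound + 1"] \<open>far A\<close> by blast
    have gH: "graph_on V H" and bH: "(9/128 - 1 / 10000000000000) * n ^ 5 \<le> balance V H"
      and dH: "\<And>\<pi>. (\<And>u. u \<in> V \<Longrightarrow> \<pi> u < (4::nat)) \<Longrightarrow> n\<^sup>2 / 1000000000 < mism_total V \<pi> H"
      using H(1) unfolding far_def by auto
    show False
    proof (cases "multipartite_on V H")
      case True
      then obtain \<pi> where "\<And>u. u \<in> V \<Longrightarrow> \<pi> u < (4::nat)" "mism_total V \<pi> H \<le> n\<^sup>2 / 1000000000"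
        using multipartite_near_optimal_partition[OF True ne] bH unfolding n_def by blast
      then show False using dH by fastforce
    next
      case False
      then obtain x y z where "x \<in> V" "y \<in> V" "z \<in> V" "\<not> H x y" "H x z \<noteq> H y z"
        using gH unfolding multipartite_on_def by blast
      then obtain u v where uv: "u \<in> V" "v \<in> V" and pot: "potential V H < potential V (clone H u v)"
        by (rule exists_better_clone[OF gH])
      define K where "K = clone H u v"
      have gK: "graph_on V K" unfolding K_def by (rule graph_on_clone[OF gH uv])
      have bK: "(9/128 - 1 / 10000000000000) * n ^ 5 \<le> balance V K"
        using bH potential_less_balance_le[OF pot] unfolding K_def by simp
      have "\<not> far K" using H(2)[of K] pot unfolding K_def by auto
      then obtain \<pi>0 where \<pi>0: "\<And>u. u \<in> V \<Longrightarrow> \<pi>0 u < (4::nat)" "mism_total V \<pi>0 K \<le> n\<^sup>2 / 1000000000"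
        using gK bK unfolding far_def by force
      obtain \<pi> where \<pi>: "\<And>u. u \<in> V \<Longrightarrow> \<pi> u < 4" "mism_total V \<pi> K \<le> mism_total V \<pi>0 K"
        "\<And>v j. v \<in> V \<Longrightarrow> j < 4 \<Longrightarrow> mism_total V \<pi> K \<le> mism_total V (\<pi>(v := j)) K"
        using exists_optimal_partition[OF fin, of \<pi>0 K] \<pi>0(1) by blast
      have "balance V K \<le> 9/128 * n ^ 5 - n ^ 3 * mism_total V \<pi> K / 64 + 10 * n ^ 4"
      proof (rule near_balance_le[OF gK _ ne n_def])
        show "mism_total V \<pi> K \<le> n\<^sup>2 / 1000000000" using \<pi>(2) \<pi>0(2) by simp
        show "(9 / 128 - 1 / 1000000000) * n ^ 5 \<le> balance V K"
          by (rule order_trans[OF mult_right_mono bK]) (use n in simp_all)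
      qed (use \<pi> in blast)+
      moreover have "n\<^sup>2 / 1000000000 \<le> mism_total V \<pi> K + 2 * n"
        using dH[OF \<pi>(1)] mism_total_clone[OF gH uv, of \<pi>] unfolding n_def K_def by fastforce
      then have "n ^ 3 * (n\<^sup>2 / 1000000000) \<le> n ^ 3 * (mism_total V \<pi> K + 2 * n)"
        by (rule mult_left_mono) (use n in simp)
      \<comment> \<open>\<open>K\<close> is within \<open>2 * n\<close> of the threshold
        \<open>10^-9 n^2\<close>, so the local estimate forces a loss of about
        \<open>n^5 / (64 * 10^9)\<close>, against an allowed deficit of \<open>10^-13 n^5\<close>.
        At \<open>n \<ge> 10^12\<close> the difference divided by \<open>n^4\<close> exceeds 15,
        more than the lower-order terms \<open>10 + 1/32\<close>.\<close>
      ultimately have "n ^ 4 * (n / 64000000000 - n / 10000000000000) \<le> n ^ 4 * (10 + 1/32)"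
        using bK by (simp add: power_numeral_reduce field_simps)
      then have "n / 64000000000 - n / 10000000000000 \<le> 10 + 1/32" by (rule mult_left_le_imp_le) (use n in simp)
      then show False using n by simp
    qed
  qed
  then obtain \<pi> where "\<forall>u\<in>V. \<pi> u < (4::nat)" "\<not> n\<^sup>2 / 1000000000 < mism_total V \<pi> A"
    using A near unfolding far_def n_def by blast
  then show ?thesis using that[of \<pi>] unfolding n_def by simp
qed

lemma copies_bound_near_optimum:
  assumes A: "graph_on V A" and big: "10 ^ 12 \<le> real (card V)"
  defines "n \<equiv> real (card V)"
  assumes near: "(9/128 - 1 / 10000000000000) * n ^ 5 \<le> balance V A"
  shows "copies V A \<le> 3/128 * n ^ 5 - n ^ 3 * (3/4 * n\<^sup>2 - arcs_count V A) / 64 + 10 * n ^ 4"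
proof -
  have n: "0 < n" using big unfolding n_def by simp
  have fin: "finite V" using A by (simp add: graph_on_def)
  have ne: "V \<noteq> {}" using n unfolding n_def by auto
  obtain \<pi>0 where \<pi>0: "\<And>u. u \<in> V \<Longrightarrow> \<pi>0 u < (4::nat)" "mism_total V \<pi>0 A \<le> n\<^sup>2 / 1000000000"
    using near_optimal_partition[OF A big] near unfolding n_def by blast
  obtain \<pi> where \<pi>: "\<And>u. u \<in> V \<Longrightarrow> \<pi> u < 4" "mism_total V \<pi> A \<le> mism_total V \<pi>0 A"
    "\<And>v j. v \<in> V \<Longrightarrow> j < 4 \<Longrightarrow> mism_total V \<pi> A \<le> mism_total V (\<pi>(v := j)) A"
    using exists_optimal_partition[OF fin, of \<pi>0 A] \<pi>0(1) by blast
  show ?thesis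
  proof (rule near_copies_le_arcs[OF A _ ne n_def[THEN meta_eq_to_obj_eq]])
    show "mism_total V \<pi> A \<le> n\<^sup>2 / 1000000000" using \<pi>(2) \<pi>0(2) by simp
    show "(9 / 128 - 1 / 1000000000) * n ^ 5 \<le> balance V A"
      by (rule order_trans[OF mult_right_mono near]) (use n in simp_all)
  qed (use \<pi> in blast)+
qed

section \<open>Induced densities\<close>

definition adj :: "'a pair_pre_digraph \<Rightarrow> 'a \<Rightarrow> 'a \<Rightarrow> bool" where
  "adj G x y \<longleftrightarrow> (x, y) \<in> parcs G"

lemma graph_on_adj:
  assumes "pair_graph G"
  shows "graph_on (pverts G) (adj G)"
proof -
  interpret pair_graph G by fact
  have "(y, x) \<in> parcs G" if "(x, y) \<in> parcs G" for x y
    using arcs_ends_symmetric[OF pair_sym_arcs] that by simp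
  then show ?thesis
    unfolding graph_on_def adj_def using pair_finite_verts pair_no_loops by fastforce
qed

lemma induced_iso_iff:
  assumes "pair_wf_digraph H" "pair_graph G" "S \<subseteq> pverts G"
  shows "digraph_iso (with_proj H) (with_proj G \<restriction> S) \<longleftrightarrow>
    (\<exists>f. bij_betw f (pverts H) S \<and> (\<forall>u\<in>pverts H. \<forall>v\<in>pverts H. (u, v) \<in> parcs H \<longleftrightarrow> adj G (f u) (f v)))"
proof -
  define G' where "G' = \<lparr>pverts = S, parcs = {e \<in> parcs G. fst e \<in> S \<and> snd e \<in> S}\<rparr>"
  have eq: "with_proj G \<restriction> S = with_proj G'"
    by (simp add: induce_subgraph_def with_proj_def G'_def)
  have wf: "pair_wf_digraph G'" by unfold_locales (auto simp: G'_def)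
  have "(f u, f v) \<in> parcs G' \<longleftrightarrow> adj G (f u) (f v)" if "bij_betw f (pverts H) S" "u \<in> pverts H" "v \<in> pverts H" for f u v
    using that bij_betwE[OF that(1)] by (auto simp: G'_def adj_def)
  moreover have "pverts G' = S" by (simp add: G'_def)
  ultimately show ?thesis
    unfolding eq digraph_iso_with_proj_iff[OF assms(1) wf] by fastforce
qed

lemma card_eq_mult_fibres:
  assumes "finite A" "\<And>y. y \<in> f ` A \<Longrightarrow> card {x \<in> A. f x = y} = k"
  shows "card A = k * card (f ` A)"
proof -
  have "card A = (\<Sum>x\<in>A. 1)" by simp
  also have "\<dots> = (\<Sum>y\<in>f ` A. \<Sum>x\<in>{x \<in> A. f x = y}. 1)"
    by (rule sum.image_gen[OF assms(1)])
  also have "\<dots> = (\<Sum>y\<in>f ` A. k)" by (rule sum.cong[OF refl]) (use assms(2) in simp)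
  finally show ?thesis by (simp add: mult.commute)
qed

lemma pair_graphD_wf: "pair_graph G \<Longrightarrow> pair_wf_digraph G"
  by (simp add: pair_graph_def pair_digraph_def pair_fin_digraph_def)

lemma ind_count_edge:
  assumes G: "pair_graph G"
  shows "arcs_count (pverts G) (adj G) = 2 * real (ind_count (complete_graph 2) G)"
proof -
  interpret pair_graph G by fact
  define V where "V = pverts G"
  have gr: "graph_on V (adj G)" unfolding V_def by (rule graph_on_adj[OF G])
  have fin: "finite V" and irr: "\<And>x. x \<in> V \<Longrightarrow> \<not> adj G x x" and sym: "\<And>x y. x \<in> V \<Longrightarrow> y \<in> V \<Longrightarrow> adj G x y = adj G y x"
    using gr unfolding graph_on_def by blast+
  define E where "E = {p \<in> V \<times> V. adj G (fst p) (snd p)}"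
  define f where "f = (\<lambda>p::'a \<times> 'a. {fst p, snd p})"
  have "f ` E = {S. S \<subseteq> V \<and> digraph_iso (with_proj (complete_graph 2)) (with_proj G \<restriction> S)}"
  proof (intro equalityI subsetI)
    fix S assume "S \<in> f ` E"
    then obtain u v where uv: "u \<in> V" "v \<in> V" "adj G u v" "S = {u, v}" unfolding E_def f_def by auto
    then have "u \<noteq> v" using irr by auto
    define h where "h = (\<lambda>i::nat. if i = 0 then u else v)"
    have "{..<2::nat} = {0, 1}" by auto
    then have "bij_betw h {..<2} S" using \<open>u \<noteq> v\<close> uv by (auto simp: bij_betw_def h_def inj_on_def)
    moreover have "i < 2 \<and> j < 2 \<and> i \<noteq> j \<longleftrightarrow> adj G (h i) (h j)" if "i < 2" "j < 2" for i j :: nat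
      using that uv irr sym[of u v] by (auto simp: h_def less_2_cases_iff)
    ultimately show "S \<in> {S. S \<subseteq> V \<and> digraph_iso (with_proj (complete_graph 2)) (with_proj G \<restriction> S)}"
      using uv induced_iso_iff[OF pair_graphD_wf[OF pair_graph_complete_graph[of 2]] G, of S]
      unfolding V_def by (auto simp: complete_graph_def)
  next
    fix S assume "S \<in> {S. S \<subseteq> V \<and> digraph_iso (with_proj (complete_graph 2)) (with_proj G \<restriction> S)}"
    then obtain h where S: "S \<subseteq> V" and h: "bij_betw h {..<2::nat} S"
      and a: "\<And>i j. i < 2 \<Longrightarrow> j < 2 \<Longrightarrow> i \<noteq> j \<longleftrightarrow> adj G (h i) (h j)"
      using induced_iso_iff[OF pair_graphD_wf[OF pair_graph_complete_graph[of 2]] G, of S]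
      unfolding V_def by (auto simp: complete_graph_def)
    have "S = h ` {..<2}" using h by (simp add: bij_betw_def)
    also have "{..<2::nat} = {0, 1}" by auto
    finally have "S = {h 0, h 1}" by simp
    moreover have "adj G (h 0) (h 1)" using a[of 0 1] by simp
    ultimately have "(h 0, h 1) \<in> E" "S = f (h 0, h 1)" using S by (auto simp: E_def f_def)
    then show "S \<in> f ` E" by blast
  qed
  moreover have "card E = 2 * card (f ` E)"
  proof (rule card_eq_mult_fibres)
    show "finite E" unfolding E_def using fin by simp
    fix S assume "S \<in> f ` E"
    then obtain u v where uv: "u \<in> V" "v \<in> V" "adj G u v" "S = {u, v}" unfolding E_def f_def by auto
    then have "u \<noteq> v" using irr by auto
    have "{x \<in> E. f x = S} = {(u, v), (v, u)}"
      using uv \<open>u \<noteq> v\<close> sym[of u v] irr by (auto simp: E_def f_def doubleton_eq_iff)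
    then show "card {x \<in> E. f x = S} = 2" using \<open>u \<noteq> v\<close> by simp
  qed
  moreover have "arcs_count V (adj G) = real (card E)"
  proof -
    have "arcs_count V (adj G) = (\<Sum>p\<in>V \<times> V. of_bool (adj G (fst p) (snd p)))"
      unfolding warcs_def by (simp add: sum.cartesian_product split_def)
    also have "\<dots> = real (card E)"
    proof -
      have "(V \<times> V) \<inter> {p. adj G (fst p) (snd p)} = E" unfolding E_def by auto
      then show ?thesis using fin by simp
    qed
    finally show ?thesis .
  qed
  ultimately show ?thesis unfolding ind_count_def V_def by simp
qed

section \<open>Induced copies as ordered tuples\<close>

definition copy_tuples :: "'a set \<Rightarrow> ('a \<Rightarrow> 'a \<Rightarrow> bool) \<Rightarrow> ('a \<times> 'a \<times> 'a \<times> 'a \<times> 'a) set" where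
  "copy_tuples V A = {(a, a', b, b', c). {a, a', b, b', c} \<subseteq> V \<and> is_copy A a a' b b' c \<and> a \<noteq> a' \<and> b \<noteq> b'}"

definition tuple_set :: "'a \<times> 'a \<times> 'a \<times> 'a \<times> 'a \<Rightarrow> 'a set" where
  "tuple_set = (\<lambda>(a, a', b, b', c). {a, a', b, b', c})"

abbreviation K221 :: "(nat \<times> nat) pair_pre_digraph" where
  "K221 \<equiv> complete_multipartite [2, 2, 1]"

lemma pverts_K221: "pverts K221 = {(0, 0), (0, 1), (1, 0), (1, 1), (2, 0)}"
proof -
  have "{(i, j). i < length [2, 2, 1::nat] \<and> j < [2, 2, 1::nat] ! i} = {(0, 0), (0, 1), (1, 0), (1, 1), (2, 0)}"
    by (auto simp: less_Suc_eq numeral_eq_Suc)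
  then show ?thesis by (simp add: complete_multipartite_def Let_def)
qed

lemma parcs_K221: "(u, v) \<in> parcs K221 \<longleftrightarrow> u \<in> pverts K221 \<and> v \<in> pverts K221 \<and> fst u \<noteq> fst v"
  by (simp add: complete_multipartite_def Let_def)

lemma copy_tuples_finite: "finite V \<Longrightarrow> finite (copy_tuples V A)"
  by (rule finite_subset[of _ "V \<times> V \<times> V \<times> V \<times> V"]) (auto simp: copy_tuples_def)

lemma copy_tuples_image:
  assumes G: "pair_graph G"
  shows "tuple_set ` copy_tuples (pverts G) (adj G) =
    {S. S \<subseteq> pverts G \<and> digraph_iso (with_proj K221) (with_proj G \<restriction> S)}"
proof (intro equalityI subsetI)
  have gr: "graph_on (pverts G) (adj G)" by (rule graph_on_adj[OF G])
  have irr: "\<And>x. x \<in> pverts G \<Longrightarrow> \<not> adj G x x" and sym: "\<And>x y. x \<in> pverts G \<Longrightarrow> y \<in> pverts G \<Longrightarrow> adj G x y = adj G y x"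
    using gr unfolding graph_on_def by blast+
  note iso = induced_iso_iff[OF pair_graphD_wf[OF pair_graph_complete_multipartite[of "[2, 2, 1]"]] G]
  {
    fix S assume "S \<in> tuple_set ` copy_tuples (pverts G) (adj G)"
    then obtain a a' b b' c where V: "{a, a', b, b', c} \<subseteq> pverts G" and cp: "is_copy (adj G) a a' b b' c" "a \<noteq> a'" "b \<noteq> b'"
      and S: "S = {a, a', b, b', c}"
      by (auto simp: tuple_set_def copy_tuples_def)
    define h where "h = (\<lambda>p::nat \<times> nat. if p = (0, 0) then a else if p = (0, 1) then a' else if p = (1, 0) then b
      else if p = (1, 1) then b' else c)"
    have ad: "adj G a b" "adj G a b'" "adj G a' b" "adj G a' b'" "adj G c a" "adj G c a'" "adj G c b" "adj G c b'"
      "\<not> adj G a a'" "\<not> adj G b b'" using cp unfolding is_copy_def by blast+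
    have ad': "adj G b a" "adj G b' a" "adj G b a'" "adj G b' a'" "adj G a c" "adj G a' c" "adj G b c" "adj G b' c"
      "\<not> adj G a' a" "\<not> adj G b' b" using ad sym V by blast+
    have ir: "\<not> adj G a a" "\<not> adj G a' a'" "\<not> adj G b b" "\<not> adj G b' b'" "\<not> adj G c c" using irr V by blast+
    have ne: "a \<noteq> b" "a \<noteq> b'" "a' \<noteq> b" "a' \<noteq> b'" "c \<noteq> a" "c \<noteq> a'" "c \<noteq> b" "c \<noteq> b'"
      using ad ir by blast+
    have "bij_betw h (pverts K221) S"
      unfolding pverts_K221 S bij_betw_def h_def using ne ne[symmetric] cp(2,3) cp(2,3)[symmetric] by auto
    moreover have "\<forall>u\<in>pverts K221. \<forall>v\<in>pverts K221. (u, v) \<in> parcs K221 \<longleftrightarrow> adj G (h u) (h v)"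
      unfolding parcs_K221 unfolding pverts_K221 h_def using ad ad' ir by simp
    ultimately show "S \<in> {S. S \<subseteq> pverts G \<and> digraph_iso (with_proj K221) (with_proj G \<restriction> S)}"
      using iso[of S] V unfolding S by blast
  next
    fix S assume "S \<in> {S. S \<subseteq> pverts G \<and> digraph_iso (with_proj K221) (with_proj G \<restriction> S)}"
    then obtain h where S: "S \<subseteq> pverts G" and h: "bij_betw h (pverts K221) S"
      and a: "\<forall>u\<in>pverts K221. \<forall>v\<in>pverts K221. (u, v) \<in> parcs K221 \<longleftrightarrow> adj G (h u) (h v)"
      using iso[of S] by blast
    let ?t = "(h (0, 0), h (0, 1), h (1, 0), h (1, 1), h (2, 0))"
    have SS: "S = {h (0, 0), h (0, 1), h (1, 0), h (1, 1), h (2, 0)}"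
      using h unfolding bij_betw_def pverts_K221 by auto
    have "h (0, 0) \<noteq> h (0, 1)" "h (1, 0) \<noteq> h (1, 1)"
      using h unfolding bij_betw_def pverts_K221 inj_on_def by auto
    moreover have "is_copy (adj G) (h (0, 0)) (h (0, 1)) (h (1, 0)) (h (1, 1)) (h (2, 0))"
      using a unfolding parcs_K221 unfolding pverts_K221 is_copy_def by simp
    ultimately have "?t \<in> copy_tuples (pverts G) (adj G)"
      using S SS by (auto simp: copy_tuples_def)
    moreover have "S = tuple_set ?t" unfolding SS tuple_set_def by simp
    ultimately show "S \<in> tuple_set ` copy_tuples (pverts G) (adj G)" by blast
  }
qed

text \<open>The non-adjacent pairs of a copy can be read off its vertex set, and so can the apex.
  What remains free is the order within each pair and the order of the two pairs, the eight
  automorphisms of \<open>K221\<close>.\<close>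

lemma copy_tuples_fibre:
  assumes A: "graph_on V A" and t: "t \<in> copy_tuples V A"
  shows "card {s \<in> copy_tuples V A. tuple_set s = tuple_set t} = 8"
proof -
  obtain a a' b b' c where t_eq: "t = (a, a', b, b', c)" by (cases t)
  have V: "{a, a', b, b', c} \<subseteq> V" and cp: "is_copy A a a' b b' c" "a \<noteq> a'" "b \<noteq> b'"
    using t unfolding t_eq copy_tuples_def by auto
  have irr: "\<And>x. x \<in> V \<Longrightarrow> \<not> A x x" and sym: "\<And>x y. x \<in> V \<Longrightarrow> y \<in> V \<Longrightarrow> A x y = A y x"
    using A unfolding graph_on_def by blast+
  have ad: "A a b" "A a b'" "A a' b" "A a' b'" "A c a" "A c a'" "A c b" "A c b'"
    "\<not> A a a'" "\<not> A b b'" using cp unfolding is_copy_def by blast+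
  have ad': "A b a" "A b' a" "A b a'" "A b' a'" "A a c" "A a' c" "A b c" "A b' c"
    "\<not> A a' a" "\<not> A b' b" using ad sym V by blast+
  have ir: "\<not> A a a" "\<not> A a' a'" "\<not> A b b" "\<not> A b' b'" "\<not> A c c" using irr V by blast+
  have ne: "a \<noteq> b" "a \<noteq> b'" "a' \<noteq> b" "a' \<noteq> b'" "c \<noteq> a" "c \<noteq> a'" "c \<noteq> b" "c \<noteq> b'"
    using ad ir by blast+
  define L where "L = {(a, a', b, b', c), (a', a, b, b', c), (a, a', b', b, c), (a', a, b', b, c),
    (b, b', a, a', c), (b', b, a, a', c), (b, b', a', a, c), (b', b, a', a, c)}"
  have "{s \<in> copy_tuples V A. tuple_set s = tuple_set t} = L"
  proof (intro equalityI subsetI)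
    fix s assume "s \<in> {s \<in> copy_tuples V A. tuple_set s = tuple_set t}"
    then obtain x x' y y' z where s: "s = (x, x', y, y', z)" and c': "is_copy A x x' y y' z" "x \<noteq> x'" "y \<noteq> y'"
      and sub: "{x, x', y, y', z} = {a, a', b, b', c}"
      by (cases s) (auto simp: copy_tuples_def tuple_set_def t_eq)
    have nonadj: "(p, q) \<in> {(a, a'), (a', a), (b, b'), (b', b)}"
      if "p \<in> {a, a', b, b', c}" "q \<in> {a, a', b, b', c}" "p \<noteq> q" "\<not> A p q" for p q
      using that ad ad' by auto
    have mem: "x \<in> {a, a', b, b', c}" "x' \<in> {a, a', b, b', c}" "y \<in> {a, a', b, b', c}" "y' \<in> {a, a', b, b', c}" "z \<in> {a, a', b, b', c}"
      unfolding sub[symmetric] by simp_all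
    have "(x, x') \<in> {(a, a'), (a', a), (b, b'), (b', b)}" "(y, y') \<in> {(a, a'), (a', a), (b, b'), (b', b)}"
    proof -
      have "\<not> A x x'" "\<not> A y y'" using c'(1) unfolding is_copy_def by blast+
      then show "(x, x') \<in> {(a, a'), (a', a), (b, b'), (b', b)}" "(y, y') \<in> {(a, a'), (a', a), (b, b'), (b', b)}"
        using nonadj[OF mem(1,2) c'(2)] nonadj[OF mem(3,4) c'(3)] by blast+
    qed
    moreover have "A x y" and Az: "A z x" "A z y" using c'(1) unfolding is_copy_def by blast+
    ultimately consider "(x, x') \<in> {(a, a'), (a', a)}" "(y, y') \<in> {(b, b'), (b', b)}"
      | "(x, x') \<in> {(b, b'), (b', b)}" "(y, y') \<in> {(a, a'), (a', a)}"
      using ad(9,10) ad'(9,10) ir by fastforce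
    then show "s \<in> L"
    proof cases
      case 1
      then have "z \<notin> {a, a'}" "z \<notin> {b, b'}" using Az ad(9,10) ad'(9,10) ir by auto
      then have "z = c" using mem(5) by blast
      then show ?thesis unfolding s L_def using 1 by auto
    next
      case 2
      then have "z \<notin> {a, a'}" "z \<notin> {b, b'}" using Az ad(9,10) ad'(9,10) ir by auto
      then have "z = c" using mem(5) by blast
      then show ?thesis unfolding s L_def using 2 by auto
    qed
  next
    fix s assume "s \<in> L"
    then show "s \<in> {s \<in> copy_tuples V A. tuple_set s = tuple_set t}"
      unfolding L_def t_eq copy_tuples_def tuple_set_def is_copy_def using V ad ad' cp(2,3) cp(2,3)[symmetric]
      by (elim insertE emptyE) (simp_all add: insert_commute)
  qed
  moreover have "card L = 8"
    unfolding L_def using ne ne[symmetric] cp(2,3) cp(2,3)[symmetric] by simp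
  ultimately show ?thesis by simp
qed

lemma copies_ind_count:
  assumes G: "pair_graph G"
  shows "8 * real (ind_count K221 G) \<le> copies (pverts G) (adj G)"
    and "copies (pverts G) (adj G) \<le> 8 * real (ind_count K221 G) + 2 * real (card (pverts G)) ^ 4"
proof -
  define V A where "V = pverts G" and "A = adj G"
  have gr: "graph_on V A" unfolding V_def A_def by (rule graph_on_adj[OF G])
  then have fin: "finite V" by (simp add: graph_on_def)
  have "card (copy_tuples V A) = 8 * card (tuple_set ` copy_tuples V A)"
    by (rule card_eq_mult_fibres[OF copy_tuples_finite[OF fin]]) (use copy_tuples_fibre[OF gr] in auto)
  also have "card (tuple_set ` copy_tuples V A) = ind_count K221 G"
    unfolding V_def A_def copy_tuples_image[OF G] ind_count_def ..
  finally have card: "8 * real (ind_count K221 G) = real (card (copy_tuples V A))" by simp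
  also have "\<dots> = sum5 V (\<lambda>a a' b b' c. of_bool (is_copy A a a' b b' c \<and> a \<noteq> a' \<and> b \<noteq> b'))"
  proof -
    have "sum5 V (\<lambda>a a' b b' c. of_bool (is_copy A a a' b b' c \<and> a \<noteq> a' \<and> b \<noteq> b'))
      = (\<Sum>t\<in>V \<times> V \<times> V \<times> V \<times> V. of_bool (t \<in> copy_tuples V A) :: real)"
      by (simp only: sum.cartesian_product) (rule sum.cong[OF refl], auto simp: copy_tuples_def)
    also have "\<dots> = real (card (copy_tuples V A))"
    proof -
      have "(V \<times> V \<times> V \<times> V \<times> V) \<inter> copy_tuples V A = copy_tuples V A" by (auto simp: copy_tuples_def)
      then show ?thesis using fin by simp
    qed
    finally show ?thesis by simp
  qed
  finally have eq: "8 * real (ind_count K221 G) = \<dots>" .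
  show "8 * real (ind_count K221 G) \<le> copies (pverts G) (adj G)"
    unfolding eq V_def[symmetric] A_def[symmetric] wcopies_def by (intro sum_mono) simp
  have delta: "(\<Sum>y\<in>V. of_bool (x = y)) = (1::real)" if "x \<in> V" for x
    using fin that by (simp add: of_bool_def)
  have "copies V A \<le> sum5 V (\<lambda>a a' b b' c. of_bool (is_copy A a a' b b' c \<and> a \<noteq> a' \<and> b \<noteq> b') + of_bool (a = a') + of_bool (b = b'))"
    unfolding wcopies_def by (intro sum_mono) simp
  also have "\<dots> = 8 * real (ind_count K221 G) + sum5 V (\<lambda>a a' b b' c. of_bool (a = a'))
     + sum5 V (\<lambda>a a' b b' c. of_bool (b = b'))"
    unfolding eq by (simp only: sum.distrib)
  also have "sum5 V (\<lambda>a a' b b' c. of_bool (a = a') :: real) = real (card V) ^ 4"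
    by (simp add: sum_distrib_left[symmetric] delta power_numeral_reduce del: sum_of_bool_eq)
  also have "sum5 V (\<lambda>a a' b b' c. of_bool (b = b') :: real) = real (card V) ^ 4"
    by (simp add: sum_distrib_left[symmetric] delta power_numeral_reduce del: sum_of_bool_eq)
  finally show "copies (pverts G) (adj G) \<le> 8 * real (ind_count K221 G) + 2 * real (card (pverts G)) ^ 4"
    unfolding V_def A_def by simp
qed

definition copy_density :: "'a pair_pre_digraph \<Rightarrow> real" where
  "copy_density G = copies (pverts G) (adj G) / real (card (pverts G)) ^ 5"

definition arc_density :: "'a pair_pre_digraph \<Rightarrow> real" where
  "arc_density G = arcs_count (pverts G) (adj G) / (real (card (pverts G)))\<^sup>2"

text \<open>Conversion factor from ordered tuples normalised by \<open>n^5\<close> to induced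
  density; its limit is \<open>5! / 8 = 15\<close>.\<close>

definition tuple_ratio :: "nat \<Rightarrow> real" where
  "tuple_ratio n = real n ^ 5 / (8 * real (n choose 5))"

lemma tuple_ratio_tendsto: "tuple_ratio \<longlonglongrightarrow> 15"
proof -
  have choose: "real (n choose 5) = real n * (real n - 1) * (real n - 2) * (real n - 3) * (real n - 4) / 120" for n
    unfolding binomial_gbinomial gbinomial_prod_rev
    by (simp add: numeral_eq_Suc prod.atLeast0_lessThan_Suc fact_numeral)
  have "tuple_ratio = (\<lambda>n. real n ^ 5 / (8 * (real n * (real n - 1) * (real n - 2) * (real n - 3) * (real n - 4) / 120)))"
    by (rule ext) (simp only: tuple_ratio_def choose)
  moreover have "(\<lambda>n. real n ^ 5 / (8 * (real n * (real n - 1) * (real n - 2) * (real n - 3) * (real n - 4) / 120))) \<longlonglongrightarrow> 15"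
    by real_asymp
  ultimately show ?thesis by simp
qed

lemma tuple_ratio_nonneg: "0 \<le> tuple_ratio n"
  by (simp add: tuple_ratio_def)

lemma card_pverts_K221: "card (pverts K221) = 5"
  by (simp add: card_complete_multipartite)

lemma
  assumes G: "pair_graph G" and n: "0 < card (pverts G)"
  shows ind_density_le: "ind_density K221 G \<le> tuple_ratio (card (pverts G)) * copy_density G"
    and ind_density_ge: "tuple_ratio (card (pverts G)) * (copy_density G - 2 / real (card (pverts G))) \<le> ind_density K221 G"
proof -
  define n where "n = card (pverts G)"
  define k where "k = real (ind_count K221 G)"
  define c where "c = copies (pverts G) (adj G)"
  define B where "B = real (n choose 5)"
  have B: "0 \<le> B" by (simp add: B_def)
  have n': "0 < real n" using n by (simp add: n_def)
  have c: "8 * k \<le> c" "c \<le> 8 * k + 2 * real n ^ 4"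
    using copies_ind_count[OF G] unfolding n_def k_def c_def by simp_all
  have dens: "ind_density K221 G = k / B"
    unfolding ind_density_def card_pverts_K221 n_def k_def B_def ..
  have ratio: "tuple_ratio n * (x / real n ^ 5) = x / 8 / B" for x
    unfolding tuple_ratio_def B_def[symmetric] using n' by simp
  have "k / B \<le> c / 8 / B" by (rule divide_right_mono[OF _ B]) (use c in simp)
  then show "ind_density K221 G \<le> tuple_ratio (card (pverts G)) * copy_density G"
    unfolding dens copy_density_def n_def[symmetric] c_def[symmetric] ratio .
  have split: "c / real n ^ 5 - 2 / real n = (c - 2 * real n ^ 4) / real n ^ 5"
    using n' by (simp add: power_numeral_reduce field_simps)
  have "(c - 2 * real n ^ 4) / 8 / B \<le> k / B" by (rule divide_right_mono[OF _ B]) (use c in simp)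
  then show "tuple_ratio (card (pverts G)) * (copy_density G - 2 / real (card (pverts G))) \<le> ind_density K221 G"
    unfolding dens copy_density_def n_def[symmetric] c_def[symmetric] split ratio .
qed

lemma ind_density_edge:
  assumes G: "pair_graph G"
  shows "arc_density G = ind_density (complete_graph 2) G * ((real (card (pverts G)) - 1) / real (card (pverts G)))"
proof -
  define n where "n = card (pverts G)"
  have choose: "real (n choose 2) = real n * (real n - 1) / 2"
    unfolding binomial_gbinomial gbinomial_prod_rev
    by (simp add: numeral_eq_Suc prod.atLeast0_lessThan_Suc fact_numeral)
  have K2: "card (pverts (complete_graph 2)) = 2" by (simp add: complete_graph_def)
  define k where "k = real (ind_count (complete_graph 2) G)"
  have eq: "2 * k / (real n)\<^sup>2 = k / (real n * (real n - 1) / 2) * ((real n - 1) / real n)" if "1 < n"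
    using that by (simp add: power2_eq_square field_simps)
  \<comment> \<open>With one vertex the edge density is a division by zero, hence 0, so the identity
    holds only because there are no edges; \<open>n = 0\<close> is trivial for the same
    convention.\<close>
  have "k = 0" if "n = 1"
  proof -
    have "card (pverts G) = 1" using that by (simp add: n_def)
    then obtain x where x: "pverts G = {x}" by (rule card_1_singletonE)
    moreover have "\<not> adj G x x" using graph_on_adj[OF G] unfolding x graph_on_def by simp
    ultimately have "arcs_count (pverts G) (adj G) = 0" by (simp add: warcs_def)
    then show ?thesis unfolding ind_count_edge[OF G] k_def by simp
  qed
  moreover have "n = 0 \<or> n = 1 \<or> 1 < n" by linarith
  ultimately have "2 * k / (real n)\<^sup>2 = k / (real n * (real n - 1) / 2) * ((real n - 1) / real n)"
    using eq by auto
  then show ?thesis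
    unfolding arc_density_def ind_density_def ind_count_edge[OF G] K2 n_def[symmetric] k_def[symmetric] choose .
qed

lemma density_sequences_arc_density:
  assumes "G \<in> density_sequences e"
  shows "(\<lambda>k. arc_density (G k)) \<longlonglongrightarrow> e"
proof -
  have G: "\<And>k. pair_graph (G k)" and card: "filterlim (\<lambda>k. card (pverts (G k))) at_top sequentially"
    and dens: "(\<lambda>k. ind_density (complete_graph 2) (G k)) \<longlonglongrightarrow> e"
    using assms by (auto simp: density_sequences_def)
  have "(\<lambda>n::nat. (real n - 1) / real n) \<longlonglongrightarrow> 1" by real_asymp
  from filterlim_compose[OF this card]
  have "(\<lambda>k. ind_density (complete_graph 2) (G k) * ((real (card (pverts (G k))) - 1) / real (card (pverts (G k))))) \<longlonglongrightarrow> e * 1"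
    by (intro tendsto_mult dens)
  then show ?thesis unfolding ind_density_edge[OF G] by simp
qed

lemma density_sequences_card_pos:
  assumes "G \<in> density_sequences e"
  shows "\<forall>\<^sub>F k in sequentially. N < card (pverts (G k))"
  using assms eventually_gt_at_top[of N] by (auto simp: density_sequences_def filterlim_iff)

text \<open>The bound \<open>u\<close> may depend on the index because the arc density and the order
  of \<open>G k\<close> only tend to their limits.\<close>

lemma max_ind_density_le:
  assumes "\<And>G. G \<in> density_sequences e \<Longrightarrow> \<exists>u. u \<longlonglongrightarrow> M \<and> (\<forall>\<^sub>F k in sequentially. copy_density (G k) \<le> u k)"
  shows "max_ind_density K221 e \<le> ereal (15 * M)"
  unfolding max_ind_density_def
proof (rule SUP_least)
  fix G assume mem: "G \<in> density_sequences e"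
  then obtain u where u: "u \<longlonglongrightarrow> M" "\<forall>\<^sub>F k in sequentially. copy_density (G k) \<le> u k" using assms by blast
  have G: "\<And>k. pair_graph (G k)" and card: "filterlim (\<lambda>k. card (pverts (G k))) at_top sequentially"
    using mem by (auto simp: density_sequences_def)
  have "\<forall>\<^sub>F k in sequentially. 0 < card (pverts (G k))"
    by (rule density_sequences_card_pos[OF mem])
  with u(2) have ev: "\<forall>\<^sub>F k in sequentially. ereal (ind_density K221 (G k)) \<le> ereal (tuple_ratio (card (pverts (G k))) * u k)"
  proof eventually_elim
    case (elim k)
    then show ?case
      using ind_density_le[OF G, of k] mult_left_mono[OF elim(1) tuple_ratio_nonneg[of "card (pverts (G k))"]] by simp
  qed
  have "(\<lambda>k. tuple_ratio (card (pverts (G k))) * u k) \<longlonglongrightarrow> 15 * M"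
    by (intro tendsto_mult u filterlim_compose[OF tuple_ratio_tendsto card])
  then have "limsup (\<lambda>k. ereal (tuple_ratio (card (pverts (G k))) * u k)) = ereal (15 * M)"
    by (intro lim_imp_Limsup) auto
  with Limsup_mono[OF ev] show "limsup (\<lambda>k. ereal (ind_density K221 (G k))) \<le> ereal (15 * M)" by simp
qed

lemma max_ind_density_ge:
  assumes mem: "G \<in> density_sequences e" and lim: "(\<lambda>k. copy_density (G k)) \<longlonglongrightarrow> M"
  shows "ereal (15 * M) \<le> max_ind_density K221 e"
proof -
  have G: "\<And>k. pair_graph (G k)" and card: "filterlim (\<lambda>k. card (pverts (G k))) at_top sequentially"
    using mem by (auto simp: density_sequences_def)
  have "\<forall>\<^sub>F k in sequentially. 0 < card (pverts (G k))"
    by (rule density_sequences_card_pos[OF mem])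
  then have ev: "\<forall>\<^sub>F k in sequentially. ereal (tuple_ratio (card (pverts (G k))) * (copy_density (G k) - 2 / real (card (pverts (G k))))) \<le> ereal (ind_density K221 (G k))"
  proof eventually_elim
    case (elim k)
    show ?case unfolding ereal_less_eq by (rule ind_density_ge[OF G elim])
  qed
  have "(\<lambda>n::nat. 2 / real n) \<longlonglongrightarrow> 0" by real_asymp
  from filterlim_compose[OF this card]
  have "(\<lambda>k. tuple_ratio (card (pverts (G k))) * (copy_density (G k) - 2 / real (card (pverts (G k))))) \<longlonglongrightarrow> 15 * (M - 0)"
    by (intro tendsto_mult tendsto_diff lim filterlim_compose[OF tuple_ratio_tendsto card])
  then have "limsup (\<lambda>k. ereal (tuple_ratio (card (pverts (G k))) * (copy_density (G k) - 2 / real (card (pverts (G k)))))) = ereal (15 * M)"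
    by (intro lim_imp_Limsup) auto
  with Limsup_mono[OF ev] have "ereal (15 * M) \<le> limsup (\<lambda>k. ereal (ind_density K221 (G k)))" by simp
  also have "\<dots> \<le> max_ind_density K221 e"
    unfolding max_ind_density_def by (rule SUP_upper[OF mem])
  finally show ?thesis .
qed

section \<open>Vanishing at edge densities 0 and 1\<close>

lemma copies_le_arcs: "copies V A \<le> real (card V) ^ 3 * arcs_count V A"
proof -
  have "copies V A \<le> sum5 V (\<lambda>a a' b b' c. of_bool (A a b))"
    unfolding wcopies_def by (intro sum_mono) (simp add: is_copy_def)
  also have "\<dots> = real (card V) ^ 3 * arcs_count V A"
    unfolding warcs_def sum_constant sum_distrib_left[symmetric] by (simp add: power_numeral_reduce)
  finally show ?thesis .
qed

lemma copies_le_nonarcs: "copies V A \<le> real (card V) ^ 3 * ((real (card V))\<^sup>2 - arcs_count V A)"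
proof -
  have "copies V A \<le> sum5 V (\<lambda>a a' b b' c. 1 - of_bool (A a a'))"
    unfolding wcopies_def by (intro sum_mono) (simp add: is_copy_def)
  also have "\<dots> = real (card V) ^ 3 * ((real (card V))\<^sup>2 - arcs_count V A)"
    unfolding warcs_def sum_constant sum_distrib_left[symmetric] sum_subtractf
    by (simp add: power_numeral_reduce)
  finally show ?thesis .
qed

lemma copy_density_le:
  shows "copy_density G \<le> arc_density G" and "0 < card (pverts G) \<Longrightarrow> copy_density G \<le> 1 - arc_density G"
proof -
  define n where "n = real (card (pverts G))"
  have reduce: "n ^ 3 * x / n ^ 5 = x / n\<^sup>2" for x
    by (cases "n = 0") (simp_all add: power_numeral_reduce)
  have "copy_density G \<le> n ^ 3 * arcs_count (pverts G) (adj G) / n ^ 5"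
    unfolding copy_density_def n_def by (rule divide_right_mono[OF copies_le_arcs]) simp
  then show "copy_density G \<le> arc_density G"
    unfolding arc_density_def n_def[symmetric] reduce .
  assume "0 < card (pverts G)"
  then have n: "n\<^sup>2 \<noteq> 0" by (simp add: n_def)
  have "copy_density G \<le> n ^ 3 * (n\<^sup>2 - arcs_count (pverts G) (adj G)) / n ^ 5"
    unfolding copy_density_def n_def by (rule divide_right_mono[OF copies_le_nonarcs]) simp
  then show "copy_density G \<le> 1 - arc_density G"
    unfolding arc_density_def n_def[symmetric] reduce diff_divide_distrib using n by simp
qed

lemma max_ind_density_0: "max_ind_density K221 0 \<le> ereal 0"
proof -
  have "max_ind_density K221 0 \<le> ereal (15 * 0)"
  proof (rule max_ind_density_le)
    fix G assume mem: "G \<in> density_sequences 0"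
    show "\<exists>u. u \<longlonglongrightarrow> 0 \<and> (\<forall>\<^sub>F k in sequentially. copy_density (G k) \<le> u k)"
      by (intro exI[of _ "\<lambda>k. arc_density (G k)"] conjI density_sequences_arc_density[OF mem] always_eventually
        allI copy_density_le(1))
  qed
  then show ?thesis unfolding mult_zero_right .
qed

lemma max_ind_density_1: "max_ind_density K221 1 \<le> ereal 0"
proof -
  have "max_ind_density K221 1 \<le> ereal (15 * 0)"
  proof (rule max_ind_density_le)
    fix G assume mem: "G \<in> density_sequences 1"
    have "(\<lambda>k. 1 - arc_density (G k)) \<longlonglongrightarrow> 1 - 1"
      by (intro tendsto_diff tendsto_const density_sequences_arc_density[OF mem])
    moreover have "\<forall>\<^sub>F k in sequentially. 0 < card (pverts (G k))"
      by (rule density_sequences_card_pos[OF mem])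
    then have "\<forall>\<^sub>F k in sequentially. copy_density (G k) \<le> 1 - arc_density (G k)"
      by eventually_elim (rule copy_density_le(2))
    ultimately show "\<exists>u. u \<longlonglongrightarrow> 0 \<and> (\<forall>\<^sub>F k in sequentially. copy_density (G k) \<le> u k)" by auto
  qed
  then show ?thesis unfolding mult_zero_right .
qed

section \<open>Values of the extremal function\<close>

definition balanced_graph :: "nat \<Rightarrow> nat \<Rightarrow> nat pair_pre_digraph" where
  "balanced_graph r m = \<lparr>pverts = {..<r * m}, parcs = {(u, v). u < r * m \<and> v < r * m \<and> u mod r \<noteq> v mod r}\<rparr>"

lemma pair_graph_balanced_graph: "pair_graph (balanced_graph r m)"
proof -
  have "finite {(u, v). u < r * m \<and> v < r * m \<and> u mod r \<noteq> v mod r}"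
    by (rule finite_subset[of _ "{..<r * m} \<times> {..<r * m}"]) auto
  then show ?thesis
    by unfold_locales (auto simp: balanced_graph_def symmetric_def intro!: symI)
qed

lemma card_mod_class:
  assumes "i < r"
  shows "card {u \<in> {..<r * m}. u mod r = i} = m"
proof -
  have "{u \<in> {..<r * m}. u mod r = i} = (\<lambda>j. j * r + i) ` {..<m}"
  proof (intro equalityI subsetI)
    fix u assume u: "u \<in> {u \<in> {..<r * m}. u mod r = i}"
    then have "u = (u div r) * r + i" by (metis (mono_tags, lifting) div_mult_mod_eq mem_Collect_eq)
    moreover have "u div r < m" using u by (auto simp: less_mult_imp_div_less mult.commute)
    ultimately show "u \<in> (\<lambda>j. j * r + i) ` {..<m}" by blast
  next
    fix u assume "u \<in> (\<lambda>j. j * r + i) ` {..<m}"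
    then obtain j where j: "j < m" "u = j * r + i" by auto
    have "j * r + i < (j + 1) * r" using assms by simp
    also have "\<dots> \<le> m * r" using j(1) by (intro mult_right_mono) auto
    finally show "u \<in> {u \<in> {..<r * m}. u mod r = i}" using j assms by (simp add: mult.commute)
  qed
  moreover have "inj_on (\<lambda>j. j * r + i) {..<m}" using assms by (auto simp: inj_on_def)
  ultimately show ?thesis by (simp add: card_image)
qed

lemma balanced_graph_densities:
  assumes r: "0 < r" and m: "0 < m"
  shows "copy_density (balanced_graph r m) = 1 / real r ^ 2 - 3 / real r ^ 3 + 2 / real r ^ 4"
    and "arc_density (balanced_graph r m) = 1 - 1 / real r"
proof -
  define V A where "V = pverts (balanced_graph r m)" and "A = adj (balanced_graph r m)"
  have V: "V = {..<r * m}" by (simp add: V_def balanced_graph_def)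
  have A: "A u v \<longleftrightarrow> u mod r \<noteq> v mod r" if "u \<in> V" "v \<in> V" for u v
    using that unfolding V by (auto simp: A_def adj_def balanced_graph_def)
  have mp: "multipartite_on V A"
    unfolding multipartite_on_def graph_on_def using A by (auto simp: V)
  have Y: "nonnbrs V A v = real m" if "v \<in> V" for v
  proof -
    have "nonnbrs V A v = (\<Sum>u\<in>V. of_bool (u mod r = v mod r))"
      unfolding nonnbrs_def by (rule sum.cong[OF refl]) (use A[OF that] in auto)
    also have "\<dots> = real (card {u \<in> V. u mod r = v mod r})" by (simp add: V Int_def)
    also have "\<dots> = real m" unfolding V using card_mod_class[of "v mod r" r m] r by simp
    finally show ?thesis .
  qed
  have S: "(\<Sum>v\<in>V. nonnbrs V A v ^ k) = real r * real m * real m ^ k" for k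
  proof -
    have "(\<Sum>v\<in>V. nonnbrs V A v ^ k) = (\<Sum>v\<in>V. real m ^ k)" by (rule sum.cong[OF refl]) (simp add: Y)
    then show ?thesis by (simp add: V)
  qed
  have S1: "(\<Sum>v\<in>V. nonnbrs V A v) = real r * real m * real m" using S[of 1] by simp
  have cV: "real (card V) = real r * real m" by (simp add: V)
  show "copy_density (balanced_graph r m) = 1 / real r ^ 2 - 3 / real r ^ 3 + 2 / real r ^ 4"
    unfolding copy_density_def V_def[symmetric] A_def[symmetric] multipartite_copies_moments(1)[OF mp] S S1 cV
    using r m by (simp add: power_numeral_reduce field_simps)
  show "arc_density (balanced_graph r m) = 1 - 1 / real r"
    unfolding arc_density_def V_def[symmetric] A_def[symmetric] multipartite_copies_moments(2)[OF mp] S1 cV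
    using r m by (simp add: power_numeral_reduce field_simps)
qed

lemma balanced_graph_density_sequence:
  assumes "0 < r"
  shows "(\<lambda>k. balanced_graph r (Suc k)) \<in> density_sequences (1 - 1 / real r)"
proof -
  let ?G = "\<lambda>k. balanced_graph r (Suc k)"
  have card: "card (pverts (?G k)) = r * Suc k" for k by (simp add: balanced_graph_def)
  have lim: "filterlim (\<lambda>k. card (pverts (?G k))) at_top sequentially"
    unfolding card
  proof (rule filterlim_at_top_mono[OF filterlim_Suc])
    have "Suc k \<le> r * Suc k" for k using assms by (cases r) auto
    then show "\<forall>\<^sub>F k in sequentially. Suc k \<le> r * Suc k" by (intro always_eventually allI)
  qed
  have dens: "ind_density (complete_graph 2) (?G k) = (1 - 1 / real r) * (real (card (pverts (?G k))) / (real (card (pverts (?G k))) - 1))"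
    if "1 < card (pverts (?G k))" for k
  proof -
    define n where "n = real (card (pverts (?G k)))"
    have "1 < n" using that by (simp add: n_def)
    moreover have "1 - 1 / real r = ind_density (complete_graph 2) (?G k) * ((n - 1) / n)"
      using ind_density_edge[OF pair_graph_balanced_graph, of r "Suc k"] balanced_graph_densities(2)[OF assms, of "Suc k"]
      unfolding n_def by simp
    ultimately show ?thesis unfolding n_def[symmetric] by simp
  qed
  have "(\<lambda>n::nat. real n / (real n - 1)) \<longlonglongrightarrow> 1" by real_asymp
  from filterlim_compose[OF this lim]
  have "(\<lambda>k. (1 - 1 / real r) * (real (card (pverts (?G k))) / (real (card (pverts (?G k))) - 1))) \<longlonglongrightarrow> (1 - 1 / real r) * 1"
    by (intro tendsto_mult tendsto_const)
  moreover have "\<forall>\<^sub>F k in sequentially. 1 < card (pverts (?G k))"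
    using lim eventually_gt_at_top[of 1] by (auto simp: filterlim_iff)
  then have "\<forall>\<^sub>F k in sequentially. (1 - 1 / real r) * (real (card (pverts (?G k))) / (real (card (pverts (?G k))) - 1))
      = ind_density (complete_graph 2) (?G k)"
    by eventually_elim (simp only: dens)
  ultimately have "(\<lambda>k. ind_density (complete_graph 2) (?G k)) \<longlonglongrightarrow> 1 - 1 / real r"
    using Lim_transform_eventually by fastforce
  then show ?thesis unfolding density_sequences_def using pair_graph_balanced_graph lim by blast
qed

lemma max_ind_density_balanced:
  assumes "0 < r"
  shows "ereal (15 * (1 / real r ^ 2 - 3 / real r ^ 3 + 2 / real r ^ 4)) \<le> max_ind_density K221 (1 - 1 / real r)"
proof (rule max_ind_density_ge[OF balanced_graph_density_sequence[OF assms]])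
  show "(\<lambda>k. copy_density (balanced_graph r (Suc k))) \<longlonglongrightarrow> 1 / real r ^ 2 - 3 / real r ^ 3 + 2 / real r ^ 4"
    unfolding balanced_graph_densities(1)[OF assms zero_less_Suc] by (rule tendsto_const)
qed

text \<open>\<open>M\<close> is the larger of two bounds. If the normalised balance is below
  \<open>9/128 - 10^-13\<close>, the penalty line gives \<open>3/128 - 10^-13 + \<eta>/16\<close>,
  below \<open>3/128\<close> because \<open>\<eta> \<le> 10^-13\<close>. Otherwise stability
  applies, and the local estimate gives \<open>3/128 - \<eta>/64\<close>.\<close>

lemma max_ind_density_dip:
  fixes \<eta> :: real
  assumes \<eta>: "0 < \<eta>" "\<eta> \<le> 1 / 10000000000000"
  shows "max_ind_density K221 (3/4 - \<eta>) < ereal (45/128)"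
proof -
  define M where "M = max (3/128 - \<eta> / 64) (9/128 - 1 / 10000000000000 - (3/4 - \<eta>) / 16)"
  have "max_ind_density K221 (3/4 - \<eta>) \<le> ereal (15 * M)"
  proof (rule max_ind_density_le)
    fix G assume mem: "G \<in> density_sequences (3/4 - \<eta>)"
    then have G: "\<And>k. pair_graph (G k)" and card: "filterlim (\<lambda>k. card (pverts (G k))) at_top sequentially"
      by (auto simp: density_sequences_def)
    note lim = density_sequences_arc_density[OF mem]
    define u where "u = (\<lambda>k. max (3/128 - (3/4 - arc_density (G k)) / 64 + 10 / real (card (pverts (G k))))
      (9/128 - 1 / 10000000000000 - arc_density (G k) / 16))"
    have "(\<lambda>n::nat. 10 / real n) \<longlonglongrightarrow> 0" by real_asymp
    from filterlim_compose[OF this card]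
    have "u \<longlonglongrightarrow> max (3/128 - (3/4 - (3/4 - \<eta>)) / 64 + 0) (9/128 - 1 / 10000000000000 - (3/4 - \<eta>) / 16)"
      unfolding u_def by (intro tendsto_max tendsto_add tendsto_diff tendsto_divide tendsto_const lim) simp_all
    then have "u \<longlonglongrightarrow> M" by (simp add: M_def)
    moreover have "\<forall>\<^sub>F k in sequentially. copy_density (G k) \<le> u k"
      using density_sequences_card_pos[OF mem, of "10 ^ 12"]
    proof eventually_elim
      case (elim k)
      define V A where "V = pverts (G k)" and "A = adj (G k)"
      define n where "n = real (card V)"
      have gr: "graph_on V A" unfolding V_def A_def by (rule graph_on_adj[OF G])
      have big: "10 ^ 12 \<le> real (card V)"
      proof -
        have "real (10 ^ 12) \<le> real (card V)" using elim unfolding V_def by (intro of_nat_mono less_imp_le)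
        then show ?thesis by (simp only: of_nat_power of_nat_numeral)
      qed
      then have n: "0 < n" unfolding n_def by simp
      have c: "copies V A = copy_density (G k) * n ^ 5"
        using n unfolding copy_density_def V_def A_def n_def by simp
      have a: "arcs_count V A = arc_density (G k) * n\<^sup>2"
        using n unfolding arc_density_def V_def A_def n_def by simp
      have n5: "n ^ 3 * n\<^sup>2 = n ^ 5" "n ^ 4 = n ^ 5 / n" using n by (simp_all add: power_numeral_reduce)
      have bal: "balance V A = (copy_density (G k) + arc_density (G k) / 16) * n ^ 5"
        unfolding balance_def c a n_def[symmetric] n5(1)[symmetric] by (simp add: algebra_simps)
      show ?case
      proof (cases "9/128 - 1 / 10000000000000 \<le> copy_density (G k) + arc_density (G k) / 16")
        case True
        then have "(9/128 - 1 / 10000000000000) * n ^ 5 \<le> balance V A"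
          unfolding bal by (rule mult_right_mono) (use n in simp)
        then have "copies V A \<le> 3/128 * n ^ 5 - n ^ 3 * (3/4 * n\<^sup>2 - arcs_count V A) / 64 + 10 * n ^ 4"
          unfolding n_def by (rule copies_bound_near_optimum[OF gr big])
        also have "\<dots> = (3/128 - (3/4 - arc_density (G k)) / 64 + 10 / n) * n ^ 5"
          unfolding a n5(2) n5(1)[symmetric] by (simp add: algebra_simps)
        finally have "copy_density (G k) \<le> 3/128 - (3/4 - arc_density (G k)) / 64 + 10 / n"
          unfolding c by (rule mult_right_le_imp_le) (use n in simp)
        then show ?thesis unfolding u_def n_def V_def by simp
      next
        case False
        then show ?thesis unfolding u_def by simp
      qed
    qed
    ultimately show "\<exists>u. u \<longlonglongrightarrow> M \<and> (\<forall>\<^sub>F k in sequentially. copy_density (G k) \<le> u k)" by blast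
  qed
  also have "ereal (15 * M) < ereal (45/128)"
  proof -
    have "9/128 - 1 / 10000000000000 - (3/4 - \<eta>) / 16 < 3/128"
      using \<eta> unfolding diff_divide_distrib by linarith
    moreover have "3/128 - \<eta> / 64 < 3/128" using \<eta>(1) by simp
    ultimately have "M < 3/128" unfolding M_def max_less_iff_conj by (rule conjI[rotated])
    then show ?thesis by simp
  qed
  finally show ?thesis .
qed

section \<open>Two local maxima\<close>

text \<open>Upper semicontinuity, by a diagonal argument.\<close>

lemma max_ind_density_limit_ge:
  assumes y: "y \<longlonglongrightarrow> x" and large: "\<And>k. c < max_ind_density H (y k)"
  shows "c \<le> max_ind_density H x"
proof -
  have "\<exists>K :: nat pair_pre_digraph. pair_graph K \<and> k \<le> card (pverts K) \<and> \<bar>ind_density (complete_graph 2) K - y k\<bar> < 1 / real (Suc k)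
      \<and> c \<le> ereal (ind_density H K)" for k
  proof -
    obtain G where mem: "G \<in> density_sequences (y k)" and lim: "c < limsup (\<lambda>n. ereal (ind_density H (G n)))"
      using large[of k] unfolding max_ind_density_def less_SUP_iff by blast
    have freq: "\<exists>\<^sub>F n in sequentially. c \<le> ereal (ind_density H (G n))"
    proof (rule ccontr)
      assume "\<not> ?thesis"
      then have "\<forall>\<^sub>F n in sequentially. ereal (ind_density H (G n)) \<le> c"
        unfolding not_frequently by eventually_elim simp
      then have "limsup (\<lambda>n. ereal (ind_density H (G n))) \<le> c" by (rule Limsup_bounded)
      then show False using lim by simp
    qed
    have ev1: "\<forall>\<^sub>F n in sequentially. k \<le> card (pverts (G n))"
      using mem by (auto simp: density_sequences_def filterlim_at_top)
    have ev2: "\<forall>\<^sub>F n in sequentially. \<bar>ind_density (complete_graph 2) (G n) - y k\<bar> < 1 / real (Suc k)"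
      using mem tendstoD[of "\<lambda>n. ind_density (complete_graph 2) (G n)" "y k" sequentially "1 / real (Suc k)"]
      by (auto simp: density_sequences_def dist_real_def)
    have "\<exists>\<^sub>F n in sequentially. c \<le> ereal (ind_density H (G n)) \<and> k \<le> card (pverts (G n))
        \<and> \<bar>ind_density (complete_graph 2) (G n) - y k\<bar> < 1 / real (Suc k)"
      by (rule frequently_rev_mp[OF freq]) (use ev1 ev2 in eventually_elim, simp)
    then obtain n where n: "c \<le> ereal (ind_density H (G n)) \<and> k \<le> card (pverts (G n))
        \<and> \<bar>ind_density (complete_graph 2) (G n) - y k\<bar> < 1 / real (Suc k)"
      by (rule frequentlyE)
    have "pair_graph (G n)" using mem by (simp add: density_sequences_def)
    with n show ?thesis by blast
  qed
  then obtain K :: "nat \<Rightarrow> nat pair_pre_digraph" where K: "\<And>k. pair_graph (K k)" "\<And>k. k \<le> card (pverts (K k))"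
    "\<And>k. \<bar>ind_density (complete_graph 2) (K k) - y k\<bar> < 1 / real (Suc k)" "\<And>k. c \<le> ereal (ind_density H (K k))"
    by metis
  have "(\<lambda>k. ind_density (complete_graph 2) (K k) - y k) \<longlonglongrightarrow> 0"
  proof (rule Lim_null_comparison)
    show "\<forall>\<^sub>F k in sequentially. norm (ind_density (complete_graph 2) (K k) - y k) \<le> 1 / real (Suc k)"
      using K(3) by (intro always_eventually allI) (simp add: less_imp_le)
    show "(\<lambda>k. 1 / real (Suc k)) \<longlonglongrightarrow> 0" by real_asymp
  qed
  from tendsto_add[OF this y] have "(\<lambda>k. ind_density (complete_graph 2) (K k)) \<longlonglongrightarrow> x" by simp
  moreover have "filterlim (\<lambda>k. card (pverts (K k))) at_top sequentially"
    by (rule filterlim_at_top_mono[OF filterlim_ident]) (use K(2) in simp)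
  ultimately have mem: "K \<in> density_sequences x" using K(1) by (simp add: density_sequences_def)
  have "c \<le> limsup (\<lambda>k. ereal (ind_density H (K k)))"
    by (rule le_Limsup) (use K(4) in \<open>simp_all add: always_eventually\<close>)
  also have "\<dots> \<le> max_ind_density H x"
    unfolding max_ind_density_def by (rule SUP_upper[OF mem])
  finally show ?thesis .
qed

text \<open>A convergent subsequence of a maximising sequence has, by upper semicontinuity, a
  maximiser on \<open>{lo..hi}\<close> as its limit. The value at \<open>mid\<close> keeps the
  maximiser away from both ends, so it is a local maximum.\<close>

lemma local_max_between:
  assumes order: "lo < mid" "mid < hi"
    and less: "max_ind_density H lo < max_ind_density H mid" "max_ind_density H hi < max_ind_density H mid"
  obtains x where "lo < x" "x < hi" "local_max_at (max_ind_density H) x"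
proof -
  let ?f = "max_ind_density H"
  define S where "S = (SUP y\<in>{lo..hi}. ?f y)"
  obtain g :: "nat \<Rightarrow> ereal" where g: "incseq g" "range g \<subseteq> ?f ` {lo..hi}" "S = (SUP k. g k)"
    using Sup_countable_SUP[of "?f ` {lo..hi}"] order unfolding S_def by auto
  have "\<exists>y. y \<in> {lo..hi} \<and> g k = ?f y" for k using g(2) by blast
  then obtain y where y: "\<And>k. y k \<in> {lo..hi}" "\<And>k. g k = ?f (y k)" by metis
  obtain x r where x: "x \<in> {lo..hi}" and r: "strict_mono r" "(y \<circ> r) \<longlonglongrightarrow> x"
    using compact_Icc[of lo hi] y(1) unfolding compact_def by blast
  have "S \<le> ?f x"
  proof (rule dense_le)
    fix c assume "c < S"
    then obtain k0 where k0: "c < g k0" unfolding g(3) less_SUP_iff by auto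
    have "(\<lambda>k. (y \<circ> r) (k + k0)) \<longlonglongrightarrow> x" by (rule LIMSEQ_ignore_initial_segment[OF r(2)])
    moreover have "c < ?f ((y \<circ> r) (k + k0))" for k
    proof -
      have "k0 \<le> r (k + k0)" using seq_suble[OF r(1), of "k + k0"] by simp
      then have "g k0 \<le> g (r (k + k0))" using g(1) by (simp add: incseqD)
      then show ?thesis using k0 y(2) by simp
    qed
    ultimately show "c \<le> ?f x" by (rule max_ind_density_limit_ge)
  qed
  then have max: "?f z \<le> ?f x" if "z \<in> {lo..hi}" for z
    using SUP_upper[OF that, of ?f] unfolding S_def by (rule order_trans[rotated])
  have "?f mid \<le> ?f x" using max[of mid] order by simp
  then have "x \<noteq> lo" "x \<noteq> hi" using less by auto
  then have "lo < x" "x < hi" using x by auto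
  moreover from this have "local_max_at ?f x"
    unfolding local_max_at_def
    by (intro eventually_nhds[THEN iffD2] exI[of _ "{lo<..<hi}"]) (use max in auto)
  ultimately show ?thesis using that by blast
qed

theorem theorem1p3:
  shows "\<exists>x \<in> {0<..<1::real}. \<exists>y \<in> {0<..<1::real}. x \<noteq> y
    \<and> local_max_at (max_ind_density (complete_multipartite [2, 2, 1])) x
    \<and> local_max_at (max_ind_density (complete_multipartite [2, 2, 1])) y"
proof -
  \<comment> \<open>This point ends the interval of the first maximum and starts that of the second,
    so the two are distinct.\<close>
  define e where "e = (3/4 - 1 / 10000000000000 :: real)"
  have e: "2/3 < e" "e < 3/4" by (simp_all add: e_def)
  have dip: "max_ind_density K221 e < ereal (45/128)"
    unfolding e_def by (rule max_ind_density_dip) simp_all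
  have three: "ereal (10/27) \<le> max_ind_density K221 (2/3)"
    using max_ind_density_balanced[of 3] by (simp add: power_numeral_reduce)
  have four: "ereal (45/128) \<le> max_ind_density K221 (3/4)"
    using max_ind_density_balanced[of 4] by (simp add: power_numeral_reduce)
  obtain x where x: "0 < x" "x < e" "local_max_at (max_ind_density K221) x"
  proof (rule local_max_between[of 0 "2/3" e K221])
    have "ereal 0 < ereal (10/27)" by simp
    then show "max_ind_density K221 0 < max_ind_density K221 (2/3)"
      using max_ind_density_0 three by (meson le_less_trans less_le_trans)
    have "ereal (45/128) < ereal (10/27)" by simp
    then show "max_ind_density K221 e < max_ind_density K221 (2/3)"
      using dip three by (meson less_trans less_le_trans)
  qed (use e in auto)
  obtain y where y: "e < y" "y < 1" "local_max_at (max_ind_density K221) y"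
  proof (rule local_max_between[of e "3/4" 1 K221])
    show "max_ind_density K221 e < max_ind_density K221 (3/4)"
      using dip four by (rule less_le_trans)
    have "ereal 0 < ereal (45/128)" by simp
    then show "max_ind_density K221 1 < max_ind_density K221 (3/4)"
      using max_ind_density_1 four by (meson le_less_trans less_le_trans)
  qed (use e in auto)
  show ?thesis
  proof (intro bexI conjI)
    show "x \<noteq> y" using x(2) y(1) by simp
    show "x \<in> {0<..<1}" "y \<in> {0<..<1}" using x(1,2) y(1,2) e by auto
  qed (fact x(3) y(3))+
qed

end
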